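(* Let $n\geq 2$ and $r\geq 4$ be integers, and let $[I]\in\operatorname{Hilb}^{h_{r,n}}_S$ be a closed point with $H_{S/\overline{I}}(1)=2$. If $[I]\in\operatorname{Slip}_{r,n}$, then $(\overline{I})^2\cdot\mathfrak{m}^{r-4}\subseteq I$. Moreover, if $(\overline{I})^2\cdot\mathfrak{m}^{r-4}\subseteq I$, then there exists a homogeneous ideal $J\subseteq S$ with $[J]\in\operatorname{Slip}_{r,n}$ and $I_{\geq r-2}=J_{\geq r-2}$.
   Context: $\Bbbk$ algebraically closed, $S=\Bbbk[\alpha_0,\ldots,\alpha_n]$ standard graded, $\mathfrak{m}=(\alpha_0,\ldots,\alpha_n)$, $\overline{I}$ is the saturation of $I$ with respect to $\mathfrak{m}$, $I_{\geq a}=\bigoplus_{b\geq a}I_b$. $h_{r,n}(a)=\min\{\dim_\Bbbk S_a,r\}$. $\operatorname{Hilb}^{h}_S$ is the multigraded Hilbert scheme parametrizing homogeneous ideals $I$ with $H_{S/I}=h$. $\operatorname{Slip}_{r,n}$ is the closure in $\operatorname{Hilb}^{h_{r,n}}_S$ of the set of closed points corresponding to saturated ideals of $r$ distinct points of $\mathbb{P}^n$. *)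

theory Defs
  imports "HOL-Library.Poly_Mapping" "HOL-Computational_Algebra.Polynomial" "HOL-Library.Cardinality"
begin

text \<open>The polynomial ring S = k[alpha_0,...,alpha_n] is modelled as the type
  of finitely supported maps from monomials to 'k, where the finite type 'n indexes the
  variables, so CARD('n) = n + 1.\<close>

type_synonym ('n, 'k) mpoly = "('n \<Rightarrow>\<^sub>0 nat) \<Rightarrow>\<^sub>0 'k"

definition alg_closed :: "'k::field itself \<Rightarrow> bool" where
  "alg_closed _ \<longleftrightarrow> (\<forall>p :: 'k poly. degree p > 0 \<longrightarrow> (\<exists>x. poly p x = 0))"

definition mdeg :: "('n::finite \<Rightarrow>\<^sub>0 nat) \<Rightarrow> nat" where
  "mdeg m = (\<Sum>i\<in>UNIV. Poly_Mapping.lookup m i)"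

definition var :: "'n \<Rightarrow> ('n, 'k::comm_ring_1) mpoly" where
  "var i = Poly_Mapping.single (Poly_Mapping.single i 1) 1"

definition pconst :: "'k::comm_ring_1 \<Rightarrow> ('n, 'k) mpoly" where
  "pconst c = Poly_Mapping.single 0 c"

definition scale :: "'k::field \<Rightarrow> ('n, 'k) mpoly \<Rightarrow> ('n, 'k) mpoly" where
  "scale c p = pconst c * p"

definition vdim :: "('n, 'k::field) mpoly set \<Rightarrow> nat" where
  "vdim V = vector_space.dim (scale :: 'k \<Rightarrow> ('n, 'k) mpoly \<Rightarrow> _) V"

definition homog :: "nat \<Rightarrow> ('n::finite, 'k::comm_ring_1) mpoly \<Rightarrow> bool" where
  "homog a p \<longleftrightarrow> (\<forall>m\<in>Poly_Mapping.keys p. mdeg m = a)"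

definition Sdeg :: "nat \<Rightarrow> ('n::finite, 'k::comm_ring_1) mpoly set" where
  "Sdeg a = {p. homog a p}"

definition comp_deg :: "('n::finite, 'k::comm_ring_1) mpoly set \<Rightarrow> nat \<Rightarrow> ('n, 'k) mpoly set" where
  "comp_deg I a = I \<inter> Sdeg a"

definition eval :: "('n::finite, 'k::comm_ring_1) mpoly \<Rightarrow> ('n \<Rightarrow> 'k) \<Rightarrow> 'k" where
  "eval p x = (\<Sum>m\<in>Poly_Mapping.keys p. Poly_Mapping.lookup p m * (\<Prod>i\<in>UNIV. x i ^ Poly_Mapping.lookup m i))"

definition is_ideal :: "('n, 'k::comm_ring_1) mpoly set \<Rightarrow> bool" where
  "is_ideal I \<longleftrightarrow> 0 \<in> I \<and> (\<forall>a\<in>I. \<forall>b\<in>I. a + b \<in> I) \<and> (\<forall>s. \<forall>a\<in>I. s * a \<in> I)"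

definition ideal_gen :: "('n, 'k::comm_ring_1) mpoly set \<Rightarrow> ('n, 'k) mpoly set" where
  "ideal_gen X = \<Inter>{J. is_ideal J \<and> X \<subseteq> J}"

definition homog_ideal :: "('n::finite, 'k::comm_ring_1) mpoly set \<Rightarrow> bool" where
  "homog_ideal I \<longleftrightarrow> is_ideal I \<and> I = ideal_gen {p\<in>I. \<exists>a. homog a p}"

definition ideal_prod :: "('n, 'k::comm_ring_1) mpoly set \<Rightarrow> ('n, 'k) mpoly set \<Rightarrow> ('n, 'k) mpoly set" where
  "ideal_prod I J = ideal_gen {a * b |a b. a \<in> I \<and> b \<in> J}"

definition irrel :: "('n, 'k::comm_ring_1) mpoly set" where
  "irrel = ideal_gen (range var)"

definition irrel_pow :: "nat \<Rightarrow> ('n, 'k::comm_ring_1) mpoly set" where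
  "irrel_pow k = ((ideal_prod irrel) ^^ k) UNIV"

definition saturation :: "('n, 'k::comm_ring_1) mpoly set \<Rightarrow> ('n, 'k) mpoly set" where
  "saturation I = {f. \<exists>k. \<forall>g\<in>irrel_pow k. g * f \<in> I}"

definition trunc_ge :: "('n::finite, 'k::comm_ring_1) mpoly set \<Rightarrow> nat \<Rightarrow> ('n, 'k) mpoly set" where
  "trunc_ge I a = {p\<in>I. \<forall>m\<in>Poly_Mapping.keys p. mdeg m \<ge> a}"

definition hilb_fun :: "('n::finite, 'k::field) mpoly set \<Rightarrow> nat \<Rightarrow> nat" where
  "hilb_fun I a = vdim (Sdeg a :: ('n, 'k) mpoly set) - vdim (comp_deg I a)"

definition h_rn :: "'n::finite itself \<Rightarrow> 'k::field itself \<Rightarrow> nat \<Rightarrow> nat \<Rightarrow> nat" where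
  "h_rn _ _ r a = min (vdim (Sdeg a :: ('n, 'k) mpoly set)) r"

text \<open>closed points of the multigraded Hilbert scheme Hilb^h_S\<close>
definition Hilb :: "(nat \<Rightarrow> nat) \<Rightarrow> ('n::finite, 'k::field) mpoly set set" where
  "Hilb h = {I. homog_ideal I \<and> hilb_fun I = h}"

text \<open>saturated (vanishing) ideal of a finite set of points of P^n, given by representatives\<close>
definition points_ideal :: "('n::finite \<Rightarrow> 'k::field) set \<Rightarrow> ('n, 'k) mpoly set" where
  "points_ideal X = ideal_gen {f. (\<exists>a. homog a f) \<and> (\<forall>x\<in>X. eval f x = 0)}"

definition distinct_proj_points :: "nat \<Rightarrow> ('n::finite \<Rightarrow> 'k::field) set \<Rightarrow> bool" where
  "distinct_proj_points r X \<longleftrightarrow> finite X \<and> card X = r \<and> (\<forall>x\<in>X. \<exists>i. x i \<noteq> 0) \<and>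
     (\<forall>x\<in>X. \<forall>y\<in>X. (\<exists>c. y = (\<lambda>i. c * x i)) \<longrightarrow> x = y)"

inductive_set polyfun :: "(('v \<Rightarrow> 'k::comm_ring_1) \<Rightarrow> 'k) set" where
  pf_const: "(\<lambda>_. c) \<in> polyfun"
| pf_var: "(\<lambda>M. M v) \<in> polyfun"
| pf_add: "f \<in> polyfun \<Longrightarrow> g \<in> polyfun \<Longrightarrow> (\<lambda>M. f M + g M) \<in> polyfun"
| pf_mult: "f \<in> polyfun \<Longrightarrow> g \<in> polyfun \<Longrightarrow> (\<lambda>M. f M * g M) \<in> polyfun"

text \<open>Stiefel coordinates: M represents the components I_a, a < N, of I, i.e. for each
  a < N the rows j < dim I_a of M (coefficients w.r.t. the monomial basis of S_a)
  form a basis of I_a; all other entries are 0.\<close>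
definition row :: "(nat \<times> nat \<times> ('n::finite \<Rightarrow>\<^sub>0 nat) \<Rightarrow> 'k::comm_ring_1) \<Rightarrow> nat \<Rightarrow> nat \<Rightarrow> ('n, 'k) mpoly" where
  "row M a j = (\<Sum>m\<in>{m. mdeg m = a}. Poly_Mapping.single m (M (a, j, m)))"

definition stiefel_rep :: "nat \<Rightarrow> ('n::finite, 'k::field) mpoly set \<Rightarrow>
    (nat \<times> nat \<times> ('n \<Rightarrow>\<^sub>0 nat) \<Rightarrow> 'k) \<Rightarrow> bool" where
  "stiefel_rep N I M \<longleftrightarrow>
     (\<forall>a j m. (N \<le> a \<or> vdim (comp_deg I a) \<le> j \<or> mdeg m \<noteq> a) \<longrightarrow> M (a, j, m) = 0) \<and>
     (\<forall>a<N. (\<forall>c. (\<Sum>j<vdim (comp_deg I a). scale (c j) (row M a j)) = 0 \<longrightarrow> (\<forall>j<vdim (comp_deg I a). c j = 0))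
          \<and> comp_deg I a = {\<Sum>j<vdim (comp_deg I a). scale (c j) (row M a j) |c. True})"

text \<open>Zariski closure in Hilb^h of a set T of its closed points: I is in the closure iff for
  every N its image in the product of the Grassmannians Gr(I_a, S_a), a < N, lies in the
  closure of the image of T (computed via Stiefel coordinates).\<close>
definition hilb_closure :: "(nat \<Rightarrow> nat) \<Rightarrow> ('n::finite, 'k::field) mpoly set set \<Rightarrow> ('n, 'k) mpoly set set" where
  "hilb_closure h T = {I\<in>Hilb h. \<forall>N. \<forall>f\<in>polyfun.
      (\<forall>J\<in>T. \<forall>M. stiefel_rep N J M \<longrightarrow> f M = 0) \<longrightarrow> (\<forall>M. stiefel_rep N I M \<longrightarrow> f M = 0)}"

definition Slip :: "'n::finite itself \<Rightarrow> 'k::field itself \<Rightarrow> nat \<Rightarrow> ('n, 'k) mpoly set set" where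
  "Slip tn tk r = hilb_closure (h_rn tn tk r)
     ({points_ideal X |X. distinct_proj_points r X} \<inter> Hilb (h_rn tn tk r))"

end

theory Submission
  imports "Jordan_Normal_Form.Determinant" Defs
begin

text \<open>The hypothesis says that the scheme cut out by I is a divisor g = 0 of degree r on a line L. Only
  the piece of degree r - 2 matters: there I is a hyperplane in its saturation, while in all higher
  degrees both agree.

  Necessity. Near I, a set of r points is a graph over L: in affine coordinates (x, y) it lies on
  y = P(x) with g(x) = 0, where P tends to 0 in the limit. Let lam(f) be the coefficient of
  x^(r - 1) in f mod g. The hyperplane in degree r - 2 is the kernel of F \<mapsto> lam(F(x, P(x))) on forms
  vanishing on L. For a product P Q the terms P_0 Q and P_1 x Q have small factors P_0, P_1, and every
  coefficient P_k with k \<ge> 2 is a combination of the numbers lam(x^b P) with b \<le> r - 3; so lam(P Q) is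
  a combination with small coefficients of values of the functional on forms divisible by a single
  equation of L. Clearing denominators by Cramer's rule gives a polynomial in Stiefel coordinates
  that vanishes on all sets of points, hence at I.

  Sufficiency. A hyperplane containing the square of the ideal of L is the kernel of
  F \<mapsto> lam(\<Sum> P_i \<partial>F/\<partial>y_i) for suitable P_i. Moving r points along y_i = t P_i(x) + t^2 Q_i(x), with Q_i
  chosen so that the points are in general position at t = 1, the ideals of the points have a limit J
  at t = 0, which agrees with I in degrees at least r - 2.\<close>

text \<open>On L the scheme is g = 0, so the quotient by the saturation has Hilbert function 1, 2,
  ..., r - 1, r, r, ...; the value r prescribed for I exceeds it by one in degree r - 2 and by
  nothing later. Below r - 2, J need not agree with I.

  Membership in the closure is tested only by polynomials in Stiefel coordinates, so necessity needs
  one identity valid for every set of r points. The functional in degree r - 2 is recovered only up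
  to an unknown factor; it enters each term of the formula for lam(P Q) exactly once, so the factor
  cancels. The other numbers P_0, P_1, lam(x^k Q) are read off in a large degree D: there they carry
  no unknown factor, and they vanish at I because multiples of the equations of L of degree D lie in
  I.

  In the sufficiency g may have multiple roots. Hence x moves as well, from the roots of g to
  distinct values, and divisibility by a product of linear factors over k[t] replaces any discussion
  of multiplicities. For a family vanishing along the arcs, order t^0 gives divisibility by g, order
  t^1 gives the functional, and t^2 Q_i comes too late to matter. Only the inclusion of J in I is
  shown; equality is a matter of dimension.\<close>

abbreviation lk where "lk \<equiv> Poly_Mapping.lookup"

section \<open>Linear algebra in the graded pieces\<close>

text \<open>Elimination by induction on the equations: a trivial equation is dropped, any other one
  has a pivot \<open>b0\<close> and removes one unknown. The dimension counts of the later sections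
  rest on it.\<close>

lemma hom_system:
  fixes M :: "'a \<Rightarrow> 'b \<Rightarrow> 'k::field"
  assumes "finite A" "finite B" "card A < card B"
  shows "\<exists>u. (\<exists>b\<in>B. u b \<noteq> 0) \<and> (\<forall>a\<in>A. (\<Sum>b\<in>B. M a b * u b) = 0)"
  using assms
proof (induction A arbitrary: B M rule: finite_induct)
  case empty
  then have "B \<noteq> {}" by auto
  then show ?case by (intro exI[of _ "\<lambda>_. 1"]) auto
next
  case (insert a A)
  show ?case
  proof (cases "\<forall>b\<in>B. M a b = 0")
    case True
    have "card A < card B" using insert by simp
    from insert.IH[OF insert.prems(1) this, of M] True show ?thesis by auto
  next
    case False
    then obtain b0 where b0: "b0 \<in> B" "M a b0 \<noteq> 0" by blast
    define B' where "B' = B - {b0}"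
    have B': "finite B'" "card A < card B'" "B = insert b0 B'" "b0 \<notin> B'"
      using insert b0 by (auto simp: B'_def)
    from insert.IH[OF B'(1,2), of "\<lambda>a' b. M a' b - M a' b0 / M a b0 * M a b"]
    obtain u where u: "\<exists>b\<in>B'. u b \<noteq> 0"
      "\<And>a'. a' \<in> A \<Longrightarrow> (\<Sum>b\<in>B'. (M a' b - M a' b0 / M a b0 * M a b) * u b) = 0" by blast
    \<comment> \<open>The value at the pivot is forced by equation \<open>a\<close>; the reduced
      equations were formed so that the others then hold too.\<close>
    define v where "v = u(b0 := - (\<Sum>b\<in>B'. M a b * u b) / M a b0)"
    have v: "(\<Sum>b\<in>B. M a' b * v b) = M a' b0 * v b0 + (\<Sum>b\<in>B'. M a' b * u b)" for a'
      using B' by (auto simp: v_def intro!: sum.cong)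
    have "(\<Sum>b\<in>B. M a' b * v b) = 0" if "a' \<in> insert a A" for a'
    proof (cases "a' = a")
      case True
      show ?thesis using b0(2) by (simp add: v True) (simp add: v_def)
    next
      case False
      then have a': "a' \<in> A" using that by simp
      have "(\<Sum>b\<in>B'. M a' b * u b) = M a' b0 / M a b0 * (\<Sum>b\<in>B'. M a b * u b)"
        using u(2)[OF a'] by (simp add: sum_subtractf sum_distrib_left left_diff_distrib mult.assoc)
      then show ?thesis by (simp add: v) (simp add: v_def)
    qed
    moreover have "\<exists>b\<in>B. v b \<noteq> 0" using u(1) B' by (auto simp: v_def)
    ultimately show ?thesis by blast
  qed
qed

lemma lk_scale [simp]: "lk (scale c p) m = c * lk p m"
proof -
  have "lk (Poly_Mapping.map ((*) c) p) m = c * lk p m"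
    by (simp add: Poly_Mapping.map.rep_eq when_def)
  then show ?thesis by (simp add: mult_map_scale_conv_mult scale_def pconst_def)
qed

interpretation mp: vector_space "scale :: 'k::field \<Rightarrow> ('n, 'k) mpoly \<Rightarrow> ('n, 'k) mpoly"
  by unfold_locales
    (auto intro!: poly_mapping_eqI simp: lookup_add algebra_simps)

lemma scale_mult_left: "scale c p * q = scale c (p * q)"
  by (simp add: scale_def mult.assoc)

lemma scale_mult_right: "p * scale c q = scale c (p * q)"
  by (simp add: scale_def mult.left_commute)

lemma mpoly_as_sum: "p = (\<Sum>m\<in>Poly_Mapping.keys p. Poly_Mapping.single m (lk p m))"
  by (rule poly_mapping_eqI)
    (auto simp: lookup_sum lookup_single when_def in_keys_iff sum.delta)

lemma mpoly_induct [case_names single add]: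
  fixes P :: "('n, 'k::comm_ring_1) mpoly \<Rightarrow> bool"
  assumes "\<And>m c. P (Poly_Mapping.single m c)" "\<And>f g. P f \<Longrightarrow> P g \<Longrightarrow> P (f + g)"
  shows "P p"
proof -
  have P0: "P 0" using assms(1)[of 0 0] by simp
  have "P (\<Sum>m\<in>A. Poly_Mapping.single m (lk p m))" if "finite A" for A
    using that by (induction A rule: finite_induct) (auto intro: assms P0)
  from this[of "Poly_Mapping.keys p"] show ?thesis using mpoly_as_sum[of p] by simp
qed

lemma mdeg_zero [simp]: "mdeg 0 = 0"
  by (simp add: mdeg_def)

lemma mdeg_add [simp]: "mdeg (a + b) = mdeg a + mdeg b"
  by (simp add: mdeg_def lookup_add sum.distrib)

lemma mdeg_single [simp]: "mdeg (Poly_Mapping.single i k) = k"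
  by (simp add: mdeg_def lookup_single when_def)

lemma mdeg_0_iff [simp]: "mdeg m = 0 \<longleftrightarrow> m = 0"
  by (auto simp: mdeg_def poly_mapping_eq_iff fun_eq_iff)

lemma finite_mdeg [simp]: "finite {m :: 'n::finite \<Rightarrow>\<^sub>0 nat. mdeg m = a}"
proof -
  have "Poly_Mapping.lookup ` {m :: 'n \<Rightarrow>\<^sub>0 nat. mdeg m = a} \<subseteq> PiE UNIV (\<lambda>_. {..a})"
  proof (intro image_subsetI PiE_I)
    fix m :: "'n \<Rightarrow>\<^sub>0 nat" and i :: 'n
    assume "m \<in> {m. mdeg m = a}"
    then show "lk m i \<in> {..a}" by (auto simp: mdeg_def intro!: member_le_sum)
  qed auto
  then have "finite (Poly_Mapping.lookup ` {m :: 'n \<Rightarrow>\<^sub>0 nat. mdeg m = a})"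
    by (rule finite_subset) (intro finite_PiE finite finite_atMost)
  then show ?thesis by (rule finite_imageD) (rule inj_onI, rule poly_mapping_eqI, simp only:)
qed

lemma Sdeg_iff: "p \<in> Sdeg a \<longleftrightarrow> (\<forall>m. lk p m \<noteq> 0 \<longrightarrow> mdeg m = a)"
  by (auto simp: Sdeg_def homog_def in_keys_iff)

lemma Sdeg_0 [simp]: "0 \<in> Sdeg a"
  by (simp add: Sdeg_iff)

lemma Sdeg_add: "p \<in> Sdeg a \<Longrightarrow> q \<in> Sdeg a \<Longrightarrow> p + q \<in> Sdeg a"
  unfolding Sdeg_iff by (metis add.right_neutral lookup_add)

lemma Sdeg_scale: "p \<in> Sdeg a \<Longrightarrow> scale c p \<in> Sdeg a"
  by (auto simp: Sdeg_iff)

lemma Sdeg_diff: "p \<in> Sdeg a \<Longrightarrow> q \<in> Sdeg a \<Longrightarrow> p - q \<in> Sdeg a"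
  unfolding Sdeg_iff by (metis diff_zero lookup_minus)

lemma Sdeg_sum: "(\<And>i. i \<in> A \<Longrightarrow> f i \<in> Sdeg a) \<Longrightarrow> sum f A \<in> Sdeg a"
  by (induction A rule: infinite_finite_induct) (auto intro: Sdeg_add)

lemma Sdeg_single: "mdeg m = a \<Longrightarrow> Poly_Mapping.single m c \<in> Sdeg a"
  by (auto simp: Sdeg_iff lookup_single when_def)

lemma Sdeg_mult: "p \<in> Sdeg a \<Longrightarrow> q \<in> Sdeg b \<Longrightarrow> p * q \<in> Sdeg (a + b)"
  unfolding Sdeg_def homog_def using keys_mult[of p q] by fastforce

lemma Sdeg_one: "1 \<in> Sdeg 0"
  by (auto simp: Sdeg_iff lookup_one when_def)

lemma Sdeg_power: "p \<in> Sdeg 1 \<Longrightarrow> p ^ k \<in> Sdeg k"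
  by (induction k) (use Sdeg_mult[of p 1] in \<open>simp_all add: Sdeg_one\<close>)

lemma Sdeg_var: "var i \<in> Sdeg 1"
  by (auto simp: var_def intro: Sdeg_single)

section \<open>Subspaces of forms and independence modulo a subspace\<close>

lemma subspD: assumes "mp.subspace V"
  shows "0 \<in> V" "x \<in> V \<Longrightarrow> y \<in> V \<Longrightarrow> x + y \<in> V" "x \<in> V \<Longrightarrow> y \<in> V \<Longrightarrow> x - y \<in> V" "x \<in> V \<Longrightarrow> scale c x \<in> V"
  "(\<And>i. i \<in> A \<Longrightarrow> f i \<in> V) \<Longrightarrow> sum f A \<in> V"
  using assms by (auto simp: mp.subspace_0 mp.subspace_add mp.subspace_diff mp.subspace_scale mp.subspace_sum)

lemma subsp_Sdeg: "mp.subspace (Sdeg a)"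
  by (auto simp: mp.subspace_def intro: Sdeg_add Sdeg_scale)

lemma subsp_zero: "mp.subspace {0}"
  by (auto simp: mp.subspace_def)

text \<open>Independence of classes in the quotient by \<open>V\<close>; \<open>V = {0}\<close> is
  ordinary independence. Indexed families are used instead of sets because they become columns of
  determinants.\<close>

definition indep_mod :: "('n, 'k::field) mpoly set \<Rightarrow> (nat \<Rightarrow> ('n, 'k) mpoly) \<Rightarrow> nat \<Rightarrow> bool" where
  "indep_mod V G m \<longleftrightarrow> (\<forall>c. (\<Sum>u<m. scale (c u) (G u)) \<in> V \<longrightarrow> (\<forall>u<m. c u = 0))"

lemma indep_modD: "indep_mod V G m \<Longrightarrow> (\<Sum>u<m. scale (c u) (G u)) \<in> V \<Longrightarrow> u < m \<Longrightarrow> c u = 0"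
  by (simp add: indep_mod_def)

lemma indep_mod_mono: "indep_mod V G m \<Longrightarrow> W \<subseteq> V \<Longrightarrow> indep_mod W G m"
  by (auto simp: indep_mod_def)

lemma combination_dependent:
  assumes "d < (m::nat)" "\<And>u. u < m \<Longrightarrow> G u = (\<Sum>j<d. scale (M u j) (b j))"
  shows "\<exists>c. (\<exists>u<m. c u \<noteq> 0) \<and> (\<Sum>u<m. scale (c u) (G u)) = 0"
proof -
  from hom_system[of "{..<d}" "{..<m}" "\<lambda>j u. M u j"] assms(1)
  obtain c where c: "\<exists>u<m. c u \<noteq> 0" "\<And>j. j < d \<Longrightarrow> (\<Sum>u<m. M u j * c u) = 0" by auto
  have "(\<Sum>u<m. scale (c u) (G u)) = (\<Sum>u<m. \<Sum>j<d. scale (M u j * c u) (b j))"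
    by (intro sum.cong) (simp_all add: assms(2) mp.scale_sum_right mult.commute)
  also have "\<dots> = (\<Sum>j<d. \<Sum>u<m. scale (M u j * c u) (b j))" by (rule sum.swap)
  also have "\<dots> = (\<Sum>j<d. scale (\<Sum>u<m. M u j * c u) (b j))" by (simp add: mp.scale_sum_left)
  also have "\<dots> = 0" by (intro sum.neutral) (simp add: c)
  finally show ?thesis using c by blast
qed

lemma Sdeg_span: "Sdeg a \<subseteq> mp.span ((\<lambda>m. Poly_Mapping.single m 1) ` {m. mdeg m = a})"
proof
  fix p :: "('a, 'b) mpoly" assume p: "p \<in> Sdeg a"
  have "Poly_Mapping.single m (lk p m) \<in> mp.span ((\<lambda>m. Poly_Mapping.single m 1) ` {m. mdeg m = a})"
    if "m \<in> Poly_Mapping.keys p" for m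
  proof -
    have "Poly_Mapping.single m (lk p m) = scale (lk p m) (Poly_Mapping.single m 1)"
      by (simp add: scale_def pconst_def mult_single)
    moreover have "mdeg m = a" using p that by (auto simp: Sdeg_iff in_keys_iff)
    ultimately show ?thesis by (simp add: mp.span_scale mp.span_base)
  qed
  then show "p \<in> mp.span ((\<lambda>m. Poly_Mapping.single m 1) ` {m. mdeg m = a})"
    by (subst mpoly_as_sum) (rule mp.span_sum)
qed

text \<open>The finitely many monomials of degree \<open>a\<close> span, so an independent subset of
  \<open>V\<close> is finite and \<open>vdim V\<close> is the length of a genuine basis, which can
  be numbered.\<close>

lemma basis_family:
  assumes "mp.subspace V" "V \<subseteq> Sdeg a"
  obtains v where "indep_mod {0} v (vdim V)" "\<And>j. j < vdim V \<Longrightarrow> v j \<in> V"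
    "\<And>F. F \<in> V \<Longrightarrow> \<exists>c. F = (\<Sum>j<vdim V. scale (c j) (v j))"
proof -
  obtain B where B: "B \<subseteq> V" "mp.independent B" "V \<subseteq> mp.span B" "card B = mp.dim V"
    using mp.basis_exists by blast
  have "finite B"
    by (rule mp.independent_span_bound[OF finite_imageI[OF finite_mdeg] B(2), THEN conjunct1])
      (rule subset_trans[OF subset_trans[OF B(1) assms(2)] Sdeg_span])
  have card: "card B = vdim V" using B(4) by (simp add: vdim_def)
  obtain v where v: "bij_betw v {..<vdim V} B"
    using ex_bij_betw_nat_finite[OF \<open>finite B\<close>] card by (auto simp: atLeast0LessThan)
  have sumB: "(\<Sum>j<vdim V. scale (f (v j)) (v j)) = (\<Sum>b\<in>B. scale (f b) b)" for f
    using sum.reindex_bij_betw[OF v, of "\<lambda>b. scale (f b) b"] by simp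
  show ?thesis
  proof
    show "indep_mod {0} v (vdim V)"
      unfolding indep_mod_def
    proof (intro allI impI)
      fix c u assume c: "(\<Sum>u<vdim V. scale (c u) (v u)) \<in> {0}" and u: "u < vdim V"
      define f where "f b = c (the_inv_into {..<vdim V} v b)" for b
      have f: "f (v j) = c j" if "j < vdim V" for j
        using that v by (simp add: f_def the_inv_into_f_f bij_betw_def)
      have "(\<Sum>b\<in>B. scale (f b) b) = 0"
        unfolding sumB[symmetric] using c by (simp add: f)
      then have "f (v u) = 0"
        using mp.independentD[OF B(2) \<open>finite B\<close> subset_refl] v u by (auto simp: bij_betw_def)
      then show "c u = 0" using f u by simp
    qed
    show "v j \<in> V" if "j < vdim V" for j using v that B(1) by (auto simp: bij_betw_def)
    show "\<exists>c. F = (\<Sum>j<vdim V. scale (c j) (v j))" if "F \<in> V" for F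
    proof -
      have "F \<in> range (\<lambda>u. \<Sum>b\<in>B. scale (u b) b)"
        using that B(3) mp.span_finite[OF \<open>finite B\<close>] by blast
      then obtain f where "F = (\<Sum>b\<in>B. scale (f b) b)" by (rule imageE)
      then show ?thesis using sumB[of f] by (auto intro: exI[of _ "\<lambda>j. f (v j)"])
    qed
  qed
qed

lemma indep_le_vdim:
  assumes "mp.subspace V" "V \<subseteq> Sdeg a" "indep_mod {0} G m" "\<And>u. u < m \<Longrightarrow> G u \<in> V"
  shows "m \<le> vdim V"
proof (rule ccontr)
  assume "\<not> ?thesis"
  then have lt: "vdim V < m" by simp
  obtain v where v: "indep_mod {0} v (vdim V)" "\<And>j. j < vdim V \<Longrightarrow> v j \<in> V"
    "\<And>F. F \<in> V \<Longrightarrow> \<exists>c. F = (\<Sum>j<vdim V. scale (c j) (v j))"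
    by (rule basis_family[OF assms(1,2)]) (rule that, assumption+)
  have "\<forall>u. \<exists>c. u < m \<longrightarrow> G u = (\<Sum>j<vdim V. scale (c j) (v j))" using v(3) assms(4) by blast
  from choice[OF this] obtain M where M: "\<And>u. u < m \<Longrightarrow> G u = (\<Sum>j<vdim V. scale (M u j) (v j))" by blast
  have "\<exists>c. (\<exists>u<m. c u \<noteq> 0) \<and> (\<Sum>u<m. scale (c u) (G u)) = 0"
    by (rule combination_dependent[OF lt]) (rule M)
  then obtain c where c: "(\<exists>u<m. c u \<noteq> 0) \<and> (\<Sum>u<m. scale (c u) (G u)) = 0" ..
  then have "(\<Sum>u<m. scale (c u) (G u)) \<in> {0}" by simp
  from indep_modD[OF assms(3) this] c show False by blast
qed

lemma vdim_le_span:
  assumes "mp.subspace V" "V \<subseteq> Sdeg a" "\<And>F. F \<in> V \<Longrightarrow> \<exists>c. F = (\<Sum>j<m. scale (c j) (w j))"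
  shows "vdim V \<le> m"
proof (rule ccontr)
  assume "\<not> ?thesis"
  then have lt: "m < vdim V" by simp
  obtain v where v: "indep_mod {0} v (vdim V)" "\<And>j. j < vdim V \<Longrightarrow> v j \<in> V"
    "\<And>F. F \<in> V \<Longrightarrow> \<exists>c. F = (\<Sum>j<vdim V. scale (c j) (v j))"
    by (rule basis_family[OF assms(1,2)]) (rule that, assumption+)
  have "\<forall>u. \<exists>c. u < vdim V \<longrightarrow> v u = (\<Sum>j<m. scale (c j) (w j))" using v(2) assms(3) by blast
  from choice[OF this] obtain M where M: "\<And>u. u < vdim V \<Longrightarrow> v u = (\<Sum>j<m. scale (M u j) (w j))" by blast
  have "\<exists>c. (\<exists>u<vdim V. c u \<noteq> 0) \<and> (\<Sum>u<vdim V. scale (c u) (v u)) = 0"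
    by (rule combination_dependent[OF lt]) (rule M)
  then obtain c where c: "(\<exists>u<vdim V. c u \<noteq> 0) \<and> (\<Sum>u<vdim V. scale (c u) (v u)) = 0" ..
  then have "(\<Sum>u<vdim V. scale (c u) (v u)) \<in> {0}" by simp
  from indep_modD[OF v(1) this] c show False by blast
qed

text \<open>In a relation involving \<open>F\<close> its coefficient could be divided out, which
  would express \<open>F\<close> modulo \<open>V\<close> by the others.\<close>

lemma indep_snoc:
  assumes "mp.subspace V" "indep_mod V v d" "\<And>c. F - (\<Sum>j<d. scale (c j) (v j)) \<notin> V"
  shows "indep_mod V (v(d := F)) (Suc d)"
  unfolding indep_mod_def
proof (intro allI impI)
  fix c u assume c: "(\<Sum>u<Suc d. scale (c u) ((v(d := F)) u)) \<in> V" and u: "u < Suc d"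
  have c': "(\<Sum>u<d. scale (c u) (v u)) + scale (c d) F \<in> V" using c by simp
  have cd: "c d = 0"
  proof (rule ccontr)
    assume nz: "c d \<noteq> 0"
    have "scale (1 / c d) ((\<Sum>u<d. scale (c u) (v u)) + scale (c d) F) \<in> V"
      using c' subspD(4)[OF assms(1)] by blast
    also have "scale (1 / c d) ((\<Sum>u<d. scale (c u) (v u)) + scale (c d) F)
      = F - (\<Sum>j<d. scale (- c j / c d) (v j))"
      using nz by (simp add: mp.scale_right_distrib mp.scale_sum_right sum_negf[symmetric]
          flip: mp.scale_minus_left)
    finally show False by (rule notE[OF assms(3)])
  qed
  then have "(\<Sum>u<d. scale (c u) (v u)) \<in> V" using c' by simp
  then show "c u = 0" using indep_modD[OF assms(2)] cd u less_Suc_eq by blast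
qed

text \<open>Vectors are appended until the dimension is reached; the first \<open>d\<close> entries
  stay in place, so coordinates along the original family remain the first ones.\<close>

lemma indep_extend:
  assumes "indep_mod {0} v d" "\<And>j. j < d \<Longrightarrow> v j \<in> Sdeg a"
  shows "\<exists>w. indep_mod {0} w (vdim (Sdeg a :: ('n::finite, 'k::field) mpoly set)) \<and>
    (\<forall>j<d. w j = v j) \<and> (\<forall>j<vdim (Sdeg a :: ('n, 'k) mpoly set). w j \<in> (Sdeg a :: ('n, 'k) mpoly set))"
  using assms
proof (induction "vdim (Sdeg a :: ('n, 'k) mpoly set) - d" arbitrary: d v)
  case 0
  then have "d = vdim (Sdeg a :: ('n, 'k) mpoly set)"
    using indep_le_vdim[OF subsp_Sdeg subset_refl 0(2)] by force
  then show ?case using 0 by (intro exI[of _ v]) auto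
next
  case (Suc k)
  have "\<exists>F\<in>Sdeg a. \<forall>c. F \<noteq> (\<Sum>j<d. scale (c j) (v j))"
    using vdim_le_span[OF subsp_Sdeg subset_refl, where m = d and w = v and a = a] Suc(2)
    by (metis diff_is_0_eq nat.distinct(1))
  then obtain F where F: "F \<in> Sdeg a" "\<And>c. F \<noteq> (\<Sum>j<d. scale (c j) (v j))" by blast
  have ind: "indep_mod {0} (v(d := F)) (Suc d)"
    by (rule indep_snoc[OF subsp_zero Suc(3)]) (use F(2) in simp)
  have "\<exists>w. indep_mod {0} w (vdim (Sdeg a :: ('n, 'k) mpoly set)) \<and>
    (\<forall>j<Suc d. w j = (v(d := F)) j) \<and> (\<forall>j<vdim (Sdeg a :: ('n, 'k) mpoly set). w j \<in> (Sdeg a :: ('n, 'k) mpoly set))"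
    by (rule Suc(1)[OF _ ind]) (use Suc(2,4) F in \<open>auto simp: less_Suc_eq\<close>)
  then obtain w where w: "indep_mod {0} w (vdim (Sdeg a :: ('n, 'k) mpoly set))"
    "\<forall>j<Suc d. w j = (v(d := F)) j" "\<forall>j<vdim (Sdeg a :: ('n, 'k) mpoly set). w j \<in> (Sdeg a :: ('n, 'k) mpoly set)"
    by blast
  then show ?case by (intro exI[of _ w]) (auto simp: less_Suc_eq)
qed

lemma indep_span:
  fixes v :: "nat \<Rightarrow> ('n::finite, 'k::field) mpoly"
  assumes "mp.subspace V" "V \<subseteq> Sdeg a" "indep_mod {0} v (vdim V)" "\<And>j. j < vdim V \<Longrightarrow> v j \<in> V" "F \<in> V"
  shows "\<exists>c. F = (\<Sum>j<vdim V. scale (c j) (v j))"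
proof (rule ccontr)
  assume n: "\<not> ?thesis"
  have ind: "indep_mod {0} (v(vdim V := F)) (Suc (vdim V))"
    by (rule indep_snoc[OF subsp_zero assms(3)]) (use n in auto)
  have "(v(vdim V := F)) u \<in> V" if "u < Suc (vdim V)" for u
    using that assms(4,5) by (auto simp: less_Suc_eq)
  from indep_le_vdim[OF assms(1,2) ind this] show False by simp
qed

lemma sum_lessThan_add: "(\<Sum>j<a + b. f j) = (\<Sum>j<a. f j) + (\<Sum>j<b. f (a + j))" for a b :: nat
  by (induction b) (auto simp: add.assoc)

lemma vdim_le: "mp.subspace V \<Longrightarrow> mp.subspace W \<Longrightarrow> V \<subseteq> W \<Longrightarrow> W \<subseteq> Sdeg a \<Longrightarrow> vdim V \<le> vdim W"
  by (rule basis_family[of V a], assumption, erule (1) subset_trans, rule indep_le_vdim[of W a]) (assumption | erule (1) subsetD | blast)+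

lemma indep_append:
  assumes "mp.subspace V" "indep_mod {0} v d" "\<And>j. j < d \<Longrightarrow> v j \<in> V" "indep_mod V G m"
  shows "indep_mod {0} (\<lambda>j. if j < d then v j else G (j - d)) (d + m)"
  unfolding indep_mod_def
proof (intro allI impI)
  fix c u assume c: "(\<Sum>u<d + m. scale (c u) (if u < d then v u else G (u - d))) \<in> {0}" and u: "u < d + m"
  have *: "(\<Sum>j<d. scale (c j) (v j)) + (\<Sum>j<m. scale (c (d + j)) (G j)) = 0"
    using c by (simp add: sum_lessThan_add)
  have "(\<Sum>j<m. scale (c (d + j)) (G j)) = (\<Sum>j<d. scale (- c j) (v j))"
    using minus_unique[OF *] by (simp add: mp.scale_minus_left sum_negf)
  also have "\<dots> \<in> V" by (intro subspD[OF assms(1)] assms(3)) auto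
  finally have **: "c (d + j) = 0" if "j < m" for j
    using indep_modD[OF assms(4), of "\<lambda>j. c (d + j)"] that by blast
  then have "(\<Sum>j<d. scale (c j) (v j)) \<in> {0}" using * by simp
  then have "c j = 0" if "j < d" for j using indep_modD[OF assms(2)] that by blast
  then show "c u = 0" using **[of "u - d"] u by (cases "u < d") auto
qed

lemma indep_mod_le:
  assumes "mp.subspace V" "V \<subseteq> Sdeg a" "indep_mod V G m" "\<And>u. u < m \<Longrightarrow> G u \<in> (Sdeg a :: ('n::finite, 'k::field) mpoly set)"
  shows "vdim V + m \<le> vdim (Sdeg a :: ('n, 'k) mpoly set)"
proof -
  obtain v where v: "indep_mod {0} v (vdim V)" "\<And>j. j < vdim V \<Longrightarrow> v j \<in> V"
    by (rule basis_family[OF assms(1,2)]) (rule that, assumption+)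
  have "(if j < vdim V then v j else G (j - vdim V)) \<in> Sdeg a" if "j < vdim V + m" for j
  proof (cases "j < vdim V")
    case True
    then show ?thesis using v(2) assms(2) by (auto simp only: if_True)
  next
    case False
    then have "j - vdim V < m" using that by linarith
    then show ?thesis using False assms(4) by (simp only: if_False)
  qed
  from indep_le_vdim[OF subsp_Sdeg subset_refl indep_append[OF assms(1) v assms(3)] this]
  show ?thesis .
qed

text \<open>A basis of \<open>V\<close> is completed to one of the whole graded piece; the added
  vectors represent a basis of the quotient, since a relation modulo \<open>V\<close> is a relation
  of the full basis.\<close>

lemma indep_mod_exists:
  assumes "mp.subspace V" "V \<subseteq> (Sdeg a :: ('n::finite, 'k::field) mpoly set)"
  obtains G where "indep_mod V G (vdim (Sdeg a :: ('n, 'k) mpoly set) - vdim V)"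
    "\<And>u. u < vdim (Sdeg a :: ('n, 'k) mpoly set) - vdim V \<Longrightarrow> G u \<in> Sdeg a"
proof -
  let ?s = "vdim (Sdeg a :: ('n, 'k) mpoly set)" let ?d = "vdim V"
  obtain v where v: "indep_mod {0} v (vdim V)" "\<And>j. j < vdim V \<Longrightarrow> v j \<in> V"
    "\<And>F. F \<in> V \<Longrightarrow> \<exists>c. F = (\<Sum>j<vdim V. scale (c j) (v j))"
    by (rule basis_family[OF assms(1,2)]) (rule that, assumption+)
  have "\<exists>w. indep_mod {0} w ?s \<and> (\<forall>j<?d. w j = v j) \<and> (\<forall>j<?s. w j \<in> (Sdeg a :: ('n, 'k) mpoly set))"
    by (rule indep_extend[OF v(1)]) (rule subsetD[OF assms(2) v(2)])
  then obtain w where w: "indep_mod {0} w ?s" "\<forall>j<?d. w j = v j" "\<forall>j<?s. w j \<in> (Sdeg a :: ('n, 'k) mpoly set)"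
    by (metis (no_types))
  have ds: "?d \<le> ?s" using vdim_le[OF assms(1) subsp_Sdeg assms(2) subset_refl] .
  show ?thesis
  proof
    show "indep_mod V (\<lambda>u. w (?d + u)) (?s - ?d)"
      unfolding indep_mod_def
    proof (intro allI impI)
      fix c u assume c: "(\<Sum>u<?s - ?d. scale (c u) (w (?d + u))) \<in> V" and u: "u < ?s - ?d"
      obtain e where e: "(\<Sum>u<?s - ?d. scale (c u) (w (?d + u))) = (\<Sum>j<?d. scale (e j) (v j))"
        using v(3)[OF c] by blast
      define f where "f j = (if j < ?d then - e j else c (j - ?d))" for j
      have "(\<Sum>j<?d + (?s - ?d). scale (f j) (w j)) = 0"
        unfolding sum_lessThan_add using w(2) by (simp add: f_def e mp.scale_minus_left sum_negf)
      then have "(\<Sum>j<?s. scale (f j) (w j)) \<in> {0}" using ds by simp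
      then have "f (?d + u) = 0" using indep_modD[OF w(1)] u by auto
      then show "c u = 0" by (simp add: f_def)
    qed
    show "w (?d + u) \<in> Sdeg a" if "u < ?s - ?d" for u
      using w(3) that by (simp add: less_diff_conv add.commute)
  qed
qed

text \<open>A family that fills the codimension of \<open>V\<close> spans the quotient: a form
  outside its span would prolong it beyond the codimension.\<close>

lemma indep_mod_span:
  assumes "mp.subspace V" "V \<subseteq> (Sdeg a :: ('n::finite, 'k::field) mpoly set)" "indep_mod V G m"
    "\<And>u. u < m \<Longrightarrow> G u \<in> Sdeg a" "vdim (Sdeg a :: ('n, 'k) mpoly set) - vdim V \<le> m" "F \<in> Sdeg a"
  shows "\<exists>c. F - (\<Sum>j<m. scale (c j) (G j)) \<in> V"
proof (rule ccontr)
  assume n: "\<not> ?thesis"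
  have ind: "indep_mod V (G(m := F)) (Suc m)"
    by (rule indep_snoc[OF assms(1,3)]) (use n in auto)
  have "(G(m := F)) u \<in> Sdeg a" if "u < Suc m" for u
    using that assms(4,6) by (auto simp: less_Suc_eq)
  from indep_mod_le[OF assms(1,2) ind this] assms(5) show False by simp
qed

lemma subsp_eqI:
  assumes "mp.subspace V" "V \<subseteq> W" "mp.subspace W" "W \<subseteq> (Sdeg a :: ('n::finite, 'k::field) mpoly set)"
    "vdim W \<le> vdim V"
  shows "V = W"
proof
  show "W \<subseteq> V"
  proof
    fix F assume F: "F \<in> W"
    obtain v where v: "indep_mod {0} v (vdim V)" "\<And>j. j < vdim V \<Longrightarrow> v j \<in> V"
      by (rule basis_family[OF assms(1) subset_trans[OF assms(2,4)]]) (rule that, assumption+)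
    have eq: "vdim W = vdim V" using vdim_le[OF assms(1,3,2,4)] assms(5) by simp
    have "\<exists>c. F = (\<Sum>j<vdim V. scale (c j) (v j))"
      using indep_span[OF assms(3,4), of v F] v F assms(2) unfolding eq by blast
    then show "F \<in> V" using v(2) by (auto intro!: subspD[OF assms(1)])
  qed
qed fact

section \<open>Graded ideals, saturation and evaluation\<close>

definition hcomp :: "nat \<Rightarrow> ('n::finite, 'k::comm_ring_1) mpoly \<Rightarrow> ('n, 'k) mpoly" where
  "hcomp a p = (\<Sum>m\<in>{m\<in>Poly_Mapping.keys p. mdeg m = a}. Poly_Mapping.single m (lk p m))"

lemma lk_hcomp [simp]: "lk (hcomp a p) m = (if mdeg m = a then lk p m else 0)"
  by (auto simp: hcomp_def lookup_sum lookup_single when_def sum.delta in_keys_iff)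

lemma hcomp_Sdeg [simp]: "hcomp a p \<in> Sdeg a"
  by (simp add: Sdeg_iff)

lemma hcomp_0 [simp]: "hcomp a 0 = 0"
  by (rule poly_mapping_eqI) simp

lemma hcomp_add: "hcomp a (p + q) = hcomp a p + hcomp a q"
  by (rule poly_mapping_eqI) (simp add: lookup_add)

lemma hcomp_same: "p \<in> Sdeg a \<Longrightarrow> hcomp a p = p"
  by (rule poly_mapping_eqI) (auto simp: Sdeg_iff)

lemma hcomp_other: "p \<in> Sdeg b \<Longrightarrow> a \<noteq> b \<Longrightarrow> hcomp a p = 0"
  by (rule poly_mapping_eqI) (auto simp: Sdeg_iff)

lemma hcomp_Sdeg_if: "p \<in> Sdeg b \<Longrightarrow> hcomp a p = (if a = b then p else 0)"
  by (simp add: hcomp_same hcomp_other)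

lemma sum_hcomp_eq: "p = (\<Sum>a\<in>mdeg ` Poly_Mapping.keys p. hcomp a p)"
  by (rule poly_mapping_eqI) (auto simp: lookup_sum sum.delta' in_keys_iff)

lemma hcomp_mult_Sdeg: "q \<in> Sdeg b \<Longrightarrow> hcomp (a + b) (p * q) = hcomp a p * q"
proof (induction p rule: mpoly_induct)
  case (single m c)
  then have "Poly_Mapping.single m c * q \<in> Sdeg (mdeg m + b)" by (intro Sdeg_mult Sdeg_single) auto
  moreover have "Poly_Mapping.single m c \<in> Sdeg (mdeg m)" by (intro Sdeg_single) auto
  ultimately show ?case by (auto simp: hcomp_Sdeg_if)
qed (simp add: hcomp_add algebra_simps)

lemma hcomp_mult: "hcomp a (p * q) = (\<Sum>b\<le>a. hcomp b p * hcomp (a - b) q)"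
proof (induction q rule: mpoly_induct)
  case (single m c)
  have q: "Poly_Mapping.single m c \<in> Sdeg (mdeg m)" by (intro Sdeg_single) auto
  show ?case
  proof (cases "mdeg m \<le> a")
    case True
    have "(\<Sum>b\<le>a. hcomp b p * hcomp (a - b) (Poly_Mapping.single m c))
      = (\<Sum>b\<le>a. if b = a - mdeg m then hcomp b p * Poly_Mapping.single m c else 0)"
      using True by (intro sum.cong) (auto simp: hcomp_Sdeg_if[OF q])
    also have "\<dots> = hcomp (a - mdeg m) p * Poly_Mapping.single m c" by (simp add: sum.delta)
    finally show ?thesis using hcomp_mult_Sdeg[OF q, of "a - mdeg m" p] True by simp
  next
    case False
    have "hcomp a (p * Poly_Mapping.single m c) = 0"
    proof (induction p rule: mpoly_induct)
      case (single m' c')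
      have "Poly_Mapping.single m' c' * Poly_Mapping.single m c \<in> Sdeg (mdeg m' + mdeg m)"
        by (intro Sdeg_mult Sdeg_single) auto
      then show ?case using False by (subst hcomp_other) auto
    qed (simp add: hcomp_add algebra_simps)
    moreover have "hcomp (a - b) (Poly_Mapping.single m c) = 0" for b
      using False by (simp add: hcomp_Sdeg_if[OF q])
    ultimately show ?thesis by simp
  qed
qed (simp add: hcomp_add algebra_simps sum.distrib)

lemma is_idealD: assumes "is_ideal I"
  shows "0 \<in> I" "a \<in> I \<Longrightarrow> b \<in> I \<Longrightarrow> a + b \<in> I" "a \<in> I \<Longrightarrow> s * a \<in> I" "a \<in> I \<Longrightarrow> a * s \<in> I"
    "a \<in> I \<Longrightarrow> b \<in> I \<Longrightarrow> a - b \<in> I" "(\<And>i. i \<in> A \<Longrightarrow> f i \<in> I) \<Longrightarrow> sum f A \<in> I"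
proof -
  show 1: "0 \<in> I" and 2: "\<And>a b. a \<in> I \<Longrightarrow> b \<in> I \<Longrightarrow> a + b \<in> I" and 3: "\<And>s a. a \<in> I \<Longrightarrow> s * a \<in> I"
    using assms by (auto simp: is_ideal_def)
  show "a \<in> I \<Longrightarrow> a * s \<in> I" using 3[of a s] by (simp add: mult.commute)
  show "a \<in> I \<Longrightarrow> b \<in> I \<Longrightarrow> a - b \<in> I" using 2[of a "- b"] 3[of b "- 1"] by simp
  show "(\<And>i. i \<in> A \<Longrightarrow> f i \<in> I) \<Longrightarrow> sum f A \<in> I"
    by (induction A rule: infinite_finite_induct) (auto intro: 1 2)
qed

lemma is_ideal_scale: "is_ideal I \<Longrightarrow> p \<in> I \<Longrightarrow> scale c p \<in> I"
  by (simp add: scale_def is_idealD(3))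

lemma subsp_ideal: "is_ideal I \<Longrightarrow> mp.subspace I"
  by (simp add: mp.subspace_def is_idealD is_ideal_scale)

lemma subsp_comp_deg: "is_ideal I \<Longrightarrow> mp.subspace (comp_deg I a)"
  using subsp_ideal[of I] subsp_Sdeg[of a] by (auto simp: comp_deg_def mp.subspace_def)

lemma comp_deg_subset: "comp_deg I a \<subseteq> Sdeg a"
  by (simp add: comp_deg_def)

lemma is_ideal_ideal_gen: "is_ideal (ideal_gen X)"
  by (simp add: ideal_gen_def is_ideal_def)

lemma ideal_gen_superset: "x \<in> X \<Longrightarrow> x \<in> ideal_gen X"
  by (auto simp: ideal_gen_def)

lemma ideal_gen_least: "is_ideal J \<Longrightarrow> X \<subseteq> J \<Longrightarrow> ideal_gen X \<subseteq> J"
  by (auto simp: ideal_gen_def)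

text \<open>The polynomials all of whose components lie in \<open>I\<close> form an ideal; it
  contains the homogeneous elements of \<open>I\<close>, hence everything they generate.\<close>

lemma homog_ideal_iff: "homog_ideal I \<longleftrightarrow> is_ideal I \<and> (\<forall>f\<in>I. \<forall>a. hcomp a f \<in> I)"
proof
  assume h: "homog_ideal I"
  then have I: "is_ideal I" and eq: "I = ideal_gen {p\<in>I. \<exists>a. homog a p}" by (auto simp: homog_ideal_def)
  define J where "J = {f. \<forall>a. hcomp a f \<in> I}"
  have "is_ideal J"
    unfolding is_ideal_def
  proof (intro conjI ballI allI)
    show "0 \<in> J" by (simp add: J_def is_idealD(1)[OF I])
    show "p + q \<in> J" if "p \<in> J" "q \<in> J" for p q
      using that by (simp add: J_def hcomp_add is_idealD(2)[OF I])
    show "s * p \<in> J" if "p \<in> J" for s p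
      unfolding J_def hcomp_mult mem_Collect_eq
      by (intro allI is_idealD(6)[OF I] is_idealD(3)[OF I]) (use that in \<open>simp add: J_def\<close>)
  qed
  moreover have "{p\<in>I. \<exists>a. homog a p} \<subseteq> J"
  proof clarsimp
    fix p a assume "p \<in> I" "homog a p"
    then show "p \<in> J" using hcomp_Sdeg_if[of p a] is_idealD(1)[OF I]
      by (simp add: J_def Sdeg_def)
  qed
  ultimately have "ideal_gen {p\<in>I. \<exists>a. homog a p} \<subseteq> J" by (rule ideal_gen_least)
  then have "I \<subseteq> J" unfolding eq[symmetric] .
  then have "\<forall>f\<in>I. \<forall>a. hcomp a f \<in> I" unfolding J_def by blast
  then show "is_ideal I \<and> (\<forall>f\<in>I. \<forall>a. hcomp a f \<in> I)" using I by blast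
next
  assume I: "is_ideal I \<and> (\<forall>f\<in>I. \<forall>a. hcomp a f \<in> I)"
  have "I \<subseteq> ideal_gen {p\<in>I. \<exists>a. homog a p}"
  proof
    fix f assume f: "f \<in> I"
    have "hcomp a f \<in> ideal_gen {p\<in>I. \<exists>a. homog a p}" for a
      using I f hcomp_Sdeg[of a f] by (intro ideal_gen_superset) (auto simp: Sdeg_def)
    then show "f \<in> ideal_gen {p\<in>I. \<exists>a. homog a p}"
      by (subst sum_hcomp_eq) (intro is_idealD(6) is_ideal_ideal_gen)
  qed
  then show "homog_ideal I"
    using I ideal_gen_least[of I "{p\<in>I. \<exists>a. homog a p}"] by (auto simp: homog_ideal_def)
qed

lemma mem_homog_ideal_iff:
  assumes "homog_ideal I"
  shows "f \<in> I \<longleftrightarrow> (\<forall>a. hcomp a f \<in> I)"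
proof
  assume "\<forall>a. hcomp a f \<in> I"
  then show "f \<in> I" using assms
    by (subst sum_hcomp_eq) (auto intro!: is_idealD(6) simp: homog_ideal_def)
qed (use assms homog_ideal_iff in blast)

section \<open>Powers of the irrelevant ideal and saturation\<close>

lemma is_ideal_min_degree: "is_ideal {p. \<forall>m\<in>Poly_Mapping.keys p. k \<le> mdeg m}"
  unfolding is_ideal_def
proof (intro conjI ballI allI; clarsimp)
  fix p q :: "('a, 'b) mpoly" and m
  assume "\<forall>m\<in>Poly_Mapping.keys p. k \<le> mdeg m" "\<forall>m\<in>Poly_Mapping.keys q. k \<le> mdeg m"
    "m \<in> Poly_Mapping.keys (p + q)"
  then show "k \<le> mdeg m" using keys_add[of p q] by auto
next
  fix p q :: "('a, 'b) mpoly" and m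
  assume "\<forall>m\<in>Poly_Mapping.keys p. k \<le> mdeg m" "m \<in> Poly_Mapping.keys (q * p)"
  then show "k \<le> mdeg m" using keys_mult[of q p] by (fastforce intro: trans_le_add2)
qed

lemma monomial_split:
  assumes "mdeg m > 0"
  obtains i m' where "m = Poly_Mapping.single i 1 + m'"
proof -
  have "\<exists>i. lk m i \<noteq> 0" using assms by (auto simp: mdeg_def intro: ccontr)
  then obtain i where i: "lk m i > 0" by blast
  show ?thesis
  proof
    show "m = Poly_Mapping.single i 1 + (m - Poly_Mapping.single i 1)"
      using i by (intro poly_mapping_eqI) (auto simp: lookup_add lookup_minus lookup_single when_def)
  qed
qed

lemma single_Suc: "Poly_Mapping.single (Poly_Mapping.single i 1 + m) c = var i * Poly_Mapping.single m c"
  by (simp add: var_def mult_single)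

lemma irrel_pow_0: "irrel_pow 0 = UNIV"
  by (simp add: irrel_pow_def)

lemma irrel_pow_Suc: "irrel_pow (Suc k) = ideal_prod irrel (irrel_pow k)"
  by (simp add: irrel_pow_def)

lemma is_ideal_irrel_pow: "is_ideal (irrel_pow k)"
  by (cases k) (auto simp: irrel_pow_0 irrel_pow_Suc ideal_prod_def is_ideal_ideal_gen, simp add: is_ideal_def)

text \<open>A monomial of degree at least \<open>k\<close> splits off \<open>k\<close> variables one
  at a time; conversely having no term of degree below \<open>k\<close> is an ideal condition that
  holds for the generators.\<close>

lemma irrel_pow_iff:
  fixes p :: "('n::finite, 'k::comm_ring_1) mpoly"
  shows "p \<in> irrel_pow k \<longleftrightarrow> (\<forall>m\<in>Poly_Mapping.keys p. k \<le> mdeg m)"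
proof -
  have irr: "irrel \<subseteq> {p :: ('n, 'k) mpoly. \<forall>m\<in>Poly_Mapping.keys p. 1 \<le> mdeg m}"
    unfolding irrel_def
    by (rule ideal_gen_least[OF is_ideal_min_degree]) (auto simp: var_def)
  have sub: "irrel_pow k \<subseteq> {p :: ('n, 'k) mpoly. \<forall>m\<in>Poly_Mapping.keys p. k \<le> mdeg m}" for k
  proof (induction k)
    case (Suc k)
    have "a * b \<in> {p :: ('n, 'k) mpoly. \<forall>m\<in>Poly_Mapping.keys p. Suc k \<le> mdeg m}"
      if "a \<in> irrel" "b \<in> irrel_pow k" for a b
    proof clarsimp
      fix m assume "m \<in> Poly_Mapping.keys (a * b)"
      then obtain u v where "m = u + v" "u \<in> Poly_Mapping.keys a" "v \<in> Poly_Mapping.keys b"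
        using keys_mult[of a b] by auto
      moreover have "1 \<le> mdeg u" using irr that(1) calculation(2) by auto
      moreover have "k \<le> mdeg v" using Suc that(2) calculation(3) by auto
      ultimately show "Suc k \<le> mdeg m" by simp
    qed
    then show ?case unfolding irrel_pow_Suc ideal_prod_def
      by (intro ideal_gen_least[OF is_ideal_min_degree]) auto
  qed simp
  have mon: "Poly_Mapping.single m c \<in> irrel_pow k" if "k \<le> mdeg m" for k m and c :: 'k
    using that
  proof (induction k arbitrary: m)
    case (Suc k)
    then obtain i m' where m: "m = Poly_Mapping.single i 1 + m'" using monomial_split[of m] by auto
    then have "Poly_Mapping.single m' c \<in> irrel_pow k" using Suc by auto
    moreover have "var i \<in> irrel" unfolding irrel_def by (rule ideal_gen_superset) auto
    ultimately show ?case unfolding irrel_pow_Suc ideal_prod_def m single_Suc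
      by (intro ideal_gen_superset) auto
  qed (simp add: irrel_pow_0)
  show ?thesis
  proof
    assume "\<forall>m\<in>Poly_Mapping.keys p. k \<le> mdeg m"
    then show "p \<in> irrel_pow k"
      by (subst mpoly_as_sum) (auto intro!: is_idealD(6)[OF is_ideal_irrel_pow] mon)
  qed (use sub in auto)
qed

lemma Sdeg_irrel_pow: "F \<in> Sdeg b \<Longrightarrow> k \<le> b \<Longrightarrow> F \<in> irrel_pow k"
  by (auto simp: irrel_pow_iff Sdeg_iff in_keys_iff)

text \<open>A multiplier from the \<open>k\<close>-th power is the sum of its components, all of
  degree at least \<open>k\<close>. Testing with forms only allows degrees to be tracked.\<close>

lemma saturation_iff:
  assumes "is_ideal I"
  shows "f \<in> saturation I \<longleftrightarrow> (\<exists>k. \<forall>b\<ge>k. \<forall>F\<in>Sdeg b. F * f \<in> I)"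
proof
  assume "f \<in> saturation I"
  then show "\<exists>k. \<forall>b\<ge>k. \<forall>F\<in>Sdeg b. F * f \<in> I"
    unfolding saturation_def using Sdeg_irrel_pow by blast
next
  assume "\<exists>k. \<forall>b\<ge>k. \<forall>F\<in>Sdeg b. F * f \<in> I"
  then obtain k where k: "\<And>b F. k \<le> b \<Longrightarrow> F \<in> Sdeg b \<Longrightarrow> F * f \<in> I" by blast
  have "g * f \<in> I" if g: "g \<in> irrel_pow k" for g
  proof -
    have "(\<Sum>a\<in>mdeg ` Poly_Mapping.keys g. hcomp a g * f) \<in> I"
    proof (intro is_idealD(6)[OF assms])
      fix a assume "a \<in> mdeg ` Poly_Mapping.keys g"
      then have "k \<le> a" using g by (auto simp: irrel_pow_iff)
      then show "hcomp a g * f \<in> I" by (rule k[OF _ hcomp_Sdeg])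
    qed
    then show ?thesis using sum_hcomp_eq[of g] by (simp flip: sum_distrib_right)
  qed
  then show "f \<in> saturation I" by (auto simp: saturation_def)
qed

lemma saturation_superset: "is_ideal I \<Longrightarrow> I \<subseteq> saturation I"
  by (auto simp: saturation_def is_idealD)

lemma is_ideal_saturation:
  assumes "is_ideal (I :: ('n::finite, 'k::comm_ring_1) mpoly set)"
  shows "is_ideal (saturation I)"
  unfolding is_ideal_def
proof (intro conjI ballI allI)
  show "0 \<in> saturation I" using saturation_superset[OF assms] is_idealD(1)[OF assms] by auto
next
  fix a b assume "a \<in> saturation I" "b \<in> saturation I"
  then obtain k l where "\<forall>b\<ge>k. \<forall>F\<in>Sdeg b. F * a \<in> I" "\<forall>b'\<ge>l. \<forall>F\<in>Sdeg b'. F * b \<in> I"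
    unfolding saturation_iff[OF assms] by blast
  then have "\<forall>b'\<ge>max k l. \<forall>F\<in>Sdeg b'. F * (a + b) \<in> I"
    by (auto simp: distrib_left intro!: is_idealD(2)[OF assms])
  then show "a + b \<in> saturation I" unfolding saturation_iff[OF assms] by blast
next
  fix s a assume "a \<in> saturation I"
  then obtain k where "\<forall>b\<ge>k. \<forall>F\<in>Sdeg b. F * a \<in> I"
    unfolding saturation_iff[OF assms] by blast
  then have "\<forall>b\<ge>k. \<forall>F\<in>Sdeg b. F * (s * a) \<in> I"
    using is_idealD(3)[OF assms] by (metis mult.left_commute)
  then show "s * a \<in> saturation I" unfolding saturation_iff[OF assms] by blast
qed

lemma homog_ideal_saturation:
  assumes "homog_ideal I"
  shows "homog_ideal (saturation I)"
  unfolding homog_ideal_iff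
proof (intro conjI ballI allI)
  have I: "is_ideal I" and hc: "\<And>f a. f \<in> I \<Longrightarrow> hcomp a f \<in> I" using assms by (auto simp: homog_ideal_iff)
  show "is_ideal (saturation I)" by (rule is_ideal_saturation[OF I])
  fix f a assume "f \<in> saturation I"
  then obtain k where k: "\<And>b F. k \<le> b \<Longrightarrow> F \<in> Sdeg b \<Longrightarrow> F * f \<in> I"
    unfolding saturation_iff[OF I] by blast
  have "F * hcomp a f \<in> I" if "k \<le> b" "F \<in> Sdeg b" for b F
    using hc[OF k[OF that], of "a + b"] hcomp_mult_Sdeg[OF that(2), of a f] by (simp add: mult.commute)
  then show "hcomp a f \<in> saturation I" unfolding saturation_iff[OF I] by blast
qed

section \<open>Evaluation at points\<close>

definition monv :: "('n \<Rightarrow> 'k::comm_ring_1) \<Rightarrow> ('n::finite \<Rightarrow>\<^sub>0 nat) \<Rightarrow> 'k" where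
  "monv x m = (\<Prod>i\<in>UNIV. x i ^ lk m i)"

lemma monv_add: "monv x (m + m') = monv x m * monv x m'"
  by (simp add: monv_def lookup_add power_add prod.distrib)

lemma monv_0 [simp]: "monv x 0 = 1"
  by (simp add: monv_def)

lemma monv_single [simp]: "monv x (Poly_Mapping.single i k) = x i ^ k"
  by (simp add: monv_def lookup_single when_def if_distrib[of "\<lambda>k. _ ^ k"] prod.delta' cong: if_cong)

lemma eval_superset:
  assumes "finite A" "Poly_Mapping.keys p \<subseteq> A"
  shows "eval p x = (\<Sum>m\<in>A. lk p m * monv x m)"
  unfolding eval_def monv_def[symmetric]
  by (rule sum.mono_neutral_left[OF assms]) (auto simp: in_keys_iff)

lemma eval_Sdeg: "p \<in> Sdeg a \<Longrightarrow> eval p x = (\<Sum>m | mdeg m = a. lk p m * monv x m)"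
  by (rule eval_superset) (auto simp: Sdeg_iff in_keys_iff)

lemma eval_0 [simp]: "eval 0 x = 0"
  by (simp add: eval_def)

lemma eval_single [simp]: "eval (Poly_Mapping.single m c) x = c * monv x m"
  by (subst eval_superset[of "{m}"]) auto

lemma eval_add [simp]: "eval (p + q) x = eval p x + eval q x"
proof -
  let ?A = "Poly_Mapping.keys p \<union> Poly_Mapping.keys q"
  show ?thesis
    using eval_superset[of ?A p x] eval_superset[of ?A q x] eval_superset[of ?A "p + q" x] keys_add[of p q]
    by (simp add: lookup_add distrib_right sum.distrib)
qed

lemma eval_mult [simp]: "eval (p * q) x = eval p x * eval q x"
proof (induction p rule: mpoly_induct)
  case (single m c)
  show ?case
    by (induction q rule: mpoly_induct) (simp_all add: mult_single monv_add algebra_simps)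
qed (simp add: distrib_right)

lemma eval_1 [simp]: "eval 1 x = 1"
  using eval_single[of 0 1 x] by (simp del: eval_single)

lemma eval_minus [simp]: "eval (- p) x = - eval p x"
  using eval_add[of p "- p" x] by (simp add: eq_neg_iff_add_eq_0 add.commute del: eval_add)

lemma eval_diff [simp]: "eval (p - q) x = eval p x - eval q x"
  using eval_add[of p "- q" x] by (simp del: eval_add)

lemma eval_var [simp]: "eval (var i) x = x i"
  by (simp add: var_def)

lemma eval_scale [simp]: "eval (scale c p) x = c * eval p x"
  by (simp add: scale_def pconst_def)

lemma eval_sum: "eval (sum f A) x = (\<Sum>i\<in>A. eval (f i) x)"
  by (induction A rule: infinite_finite_induct) auto

lemma eval_power [simp]: "eval (p ^ k) x = eval p x ^ k"
  by (induction k) auto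

lemma eval_homog:
  assumes "F \<in> Sdeg a"
  shows "eval F (\<lambda>i. c * x i) = c ^ a * eval F x"
proof -
  have "monv (\<lambda>i. c * x i) m = c ^ mdeg m * monv x m" for m
    by (simp add: monv_def power_mult_distrib prod.distrib mdeg_def power_sum)
  then show ?thesis using assms
    by (simp add: eval_Sdeg sum_distrib_left algebra_simps)
qed

text \<open>Every monomial of positive degree contains a variable. This serves as the induction step
  for statements about forms of all degrees.\<close>

lemma Sdeg_Suc_subset:
  fixes W :: "('n::finite, 'k::field) mpoly set"
  assumes "mp.subspace W" "\<And>i G. G \<in> Sdeg a \<Longrightarrow> var i * G \<in> W"
  shows "Sdeg (Suc a) \<subseteq> W"
proof
  fix F :: "('n, 'k) mpoly" assume F: "F \<in> Sdeg (Suc a)"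
  have "Poly_Mapping.single m (lk F m) \<in> W" if "m \<in> Poly_Mapping.keys F" for m
  proof -
    have "mdeg m = Suc a" using F that by (auto simp: Sdeg_iff in_keys_iff)
    moreover from this obtain i m' where m: "m = Poly_Mapping.single i 1 + m'"
      using monomial_split[of m] by auto
    ultimately have "Poly_Mapping.single m' (lk F m) \<in> Sdeg a" by (intro Sdeg_single) simp
    then show ?thesis using assms(2) unfolding m single_Suc by blast
  qed
  then show "F \<in> W" by (subst mpoly_as_sum) (intro subspD(5)[OF assms(1)])
qed

lemma Sdeg_0_const: "F \<in> Sdeg 0 \<Longrightarrow> F = scale (lk F 0) 1"
  by (rule poly_mapping_eqI) (auto simp: Sdeg_iff lookup_one when_def)

text \<open>Vanishing on \<open>X\<close> is itself an ideal condition, so generating an ideal from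
  the vanishing forms adds no new forms.\<close>

lemma comp_deg_points_ideal:
  "comp_deg (points_ideal X) a = {f\<in>Sdeg a. \<forall>x\<in>X. eval f x = 0}"
proof -
  have "is_ideal {f. \<forall>x\<in>X. eval f x = 0}" by (auto simp: is_ideal_def)
  then have "points_ideal X \<subseteq> {f. \<forall>x\<in>X. eval f x = 0}"
    unfolding points_ideal_def by (rule ideal_gen_least) auto
  then show ?thesis
    by (auto simp: comp_deg_def Sdeg_def points_ideal_def intro!: ideal_gen_superset)
qed

section \<open>Binary forms and linear coordinates\<close>

text \<open>Homogenization z0^a p(z1/z0). Coefficients of \<open>p\<close> beyond degree
  \<open>a\<close> are silently dropped, hence the degree bounds in the lemmas below; the dropping
  is exploited later for degree r - 2.\<close>

definition hz :: "('n::finite, 'k::field) mpoly \<Rightarrow> ('n, 'k) mpoly \<Rightarrow> nat \<Rightarrow> 'k poly \<Rightarrow> ('n, 'k) mpoly" where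
  "hz z0 z1 a p = (\<Sum>k\<le>a. scale (coeff p k) (z0 ^ (a - k) * z1 ^ k))"

lemma hz_0 [simp]: "hz z0 z1 a 0 = 0"
  by (simp add: hz_def)

lemma hz_add: "hz z0 z1 a (p + q) = hz z0 z1 a p + hz z0 z1 a q"
  by (simp add: hz_def mp.scale_left_distrib sum.distrib)

lemma hz_smult: "hz z0 z1 a (smult c p) = scale c (hz z0 z1 a p)"
  by (simp add: hz_def mp.scale_sum_right)

lemma hz_diff: "hz z0 z1 a (p - q) = hz z0 z1 a p - hz z0 z1 a q"
  by (simp add: hz_def mp.scale_left_diff_distrib sum_subtractf)

lemma hz_sum: "hz z0 z1 a (sum f A) = (\<Sum>i\<in>A. hz z0 z1 a (f i))"
  by (induction A rule: infinite_finite_induct) (auto simp: hz_add)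

lemma hz_monom: "k \<le> a \<Longrightarrow> hz z0 z1 a (monom c k) = scale c (z0 ^ (a - k) * z1 ^ k)"
  by (simp add: hz_def if_distrib[of "\<lambda>c. scale c _"] sum.delta cong: if_cong)

lemma hz_const: "hz z0 z1 a [:c:] = scale c (z0 ^ a)"
  using hz_monom[of 0 a z0 z1 c] by (simp add: monom_0)

lemma hz_one: "hz z0 z1 a 1 = z0 ^ a"
  using hz_const[of z0 z1 a 1] by (simp add: one_pCons)

lemma hz_Sdeg: "z0 \<in> Sdeg 1 \<Longrightarrow> z1 \<in> Sdeg 1 \<Longrightarrow> hz z0 z1 a p \<in> Sdeg a"
  unfolding hz_def
proof (intro Sdeg_sum Sdeg_scale)
  fix k assume z: "z0 \<in> Sdeg 1" "z1 \<in> Sdeg 1" "k \<in> {..a}"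
  have "z0 ^ (a - k) * z1 ^ k \<in> Sdeg ((a - k) + k)" by (intro Sdeg_mult Sdeg_power z)
  then show "z0 ^ (a - k) * z1 ^ k \<in> Sdeg a" using z by simp
qed

lemma eval_hz:
  assumes "eval z0 x = 1" "degree p \<le> a"
  shows "eval (hz z0 z1 a p) x = poly p (eval z1 x)"
proof -
  have "poly p (eval z1 x) = (\<Sum>i\<le>a. coeff p i * eval z1 x ^ i)"
    unfolding poly_altdef by (rule sum.mono_neutral_left) (use assms in \<open>auto simp: coeff_eq_0\<close>)
  then show ?thesis by (simp add: hz_def eval_sum assms)
qed

lemma hz_times_z0:
  assumes "degree p \<le> a"
  shows "z0 * hz z0 z1 a p = hz z0 z1 (Suc a) p"
proof -
  have "coeff p (Suc a) = 0" using assms by (simp add: coeff_eq_0)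
  moreover have "(\<Sum>k\<le>a. scale (coeff p k) (z0 ^ (Suc a - k) * z1 ^ k)) = (\<Sum>k\<le>a. scale (coeff p k) (z0 * (z0 ^ (a - k) * z1 ^ k)))"
    by (intro sum.cong) (auto simp: Suc_diff_le mult.assoc)
  ultimately show ?thesis by (simp add: hz_def sum_distrib_left scale_mult_right)
qed

lemma hz_times_z1: "z1 * hz z0 z1 a p = hz z0 z1 (Suc a) (pCons 0 p)"
  by (simp add: hz_def sum_distrib_left scale_mult_right mult.left_commute sum.atMost_Suc_shift del: sum.atMost_Suc)

lemma hz_times_z0_power:
  "degree p \<le> a \<Longrightarrow> z0 ^ b * hz z0 z1 a p = hz z0 z1 (a + b) p"
  by (induction b) (auto simp: mult.assoc hz_times_z0)

text \<open>Induction along \<open>pCons\<close>: a factor z0 raises the degree and keeps the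
  polynomial, a factor z1 also multiplies the polynomial by the indeterminate.\<close>

lemma hz_mult:
  "degree p \<le> a \<Longrightarrow> degree q \<le> b \<Longrightarrow> hz z0 z1 a p * hz z0 z1 b q = hz z0 z1 (a + b) (p * q)"
proof (induction p arbitrary: a)
  case (pCons c p)
  have 1: "hz z0 z1 a [:c:] * hz z0 z1 b q = hz z0 z1 (a + b) (smult c q)"
    using hz_times_z0_power[of q b z0 a z1] pCons.prems
    by (simp add: hz_const scale_mult_left hz_smult add.commute)
  have 2: "hz z0 z1 a (pCons 0 p) * hz z0 z1 b q = hz z0 z1 (a + b) (pCons 0 (p * q))"
  proof (cases "p = 0")
    case False
    then obtain a' where a': "a = Suc a'" "degree p \<le> a'"
      using pCons.prems by (cases a) auto
    then show ?thesis using pCons.IH[of a'] pCons.prems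
      by (simp add: mult.assoc flip: hz_times_z1)
  qed simp
  have "pCons c p = [:c:] + pCons 0 p" by simp
  then have "hz z0 z1 a (pCons c p) * hz z0 z1 b q = hz z0 z1 (a + b) (smult c q) + hz z0 z1 (a + b) (pCons 0 (p * q))"
    using 1 2 by (metis (no_types, lifting) distrib_right hz_add)
  then show ?case by (simp add: hz_add)
qed simp

section \<open>Coordinates adapted to a line\<close>

lemma linear_form:
  assumes "F \<in> Sdeg 1"
  shows "\<exists>d. F = (\<Sum>i\<in>UNIV. scale (d i) (var i))"
proof -
  let ?W = "{F :: ('a, 'b) mpoly. \<exists>d. F = (\<Sum>i\<in>UNIV. scale (d i) (var i))}"
  have "mp.subspace ?W"
    unfolding mp.subspace_def
  proof (intro conjI ballI allI)
    show "0 \<in> ?W" by (auto intro: exI[of _ "\<lambda>_. 0"])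
  next
    fix F G assume "F \<in> ?W" "G \<in> ?W"
    then obtain d e where "F = (\<Sum>i\<in>UNIV. scale (d i) (var i))" "G = (\<Sum>i\<in>UNIV. scale (e i) (var i))" by blast
    then show "F + G \<in> ?W"
      by (auto intro!: exI[of _ "\<lambda>i. d i + e i"] simp: mp.scale_left_distrib sum.distrib)
  next
    fix F c assume "F \<in> ?W"
    then obtain d where "F = (\<Sum>i\<in>UNIV. scale (d i) (var i))" by blast
    then show "scale c F \<in> ?W"
      by (auto intro!: exI[of _ "\<lambda>i. c * d i"] simp: mp.scale_sum_right)
  qed
  moreover have "var i * G \<in> ?W" if "G \<in> Sdeg 0" for i and G :: "('a, 'b) mpoly"
  proof -
    have "var i * G = scale (lk G 0) (var i)"
      by (subst Sdeg_0_const[OF that]) (simp add: scale_mult_right)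
    also have "\<dots> = (\<Sum>j\<in>UNIV. scale (if j = i then lk G 0 else 0) (var j))"
      by (simp add: if_distrib[of "\<lambda>c. scale c _"] sum.delta' cong: if_cong)
    finally show ?thesis by (intro CollectI exI)
  qed
  ultimately have "Sdeg (Suc 0) \<subseteq> ?W" by (rule Sdeg_Suc_subset)
  then show ?thesis using assms by auto
qed

text \<open>\<open>y 0\<close> and \<open>y 1\<close> are coordinates on a line and the
  \<open>y (i + 2)\<close>, \<open>i < n\<close>, its equations. \<open>c\<close> is the inverse
  coordinate matrix, used once on forms and once on points. Thus \<open>n\<close> is the codimension
  of the line, one less than the dimension of the projective space.\<close>

locale coords =
  fixes y :: "nat \<Rightarrow> ('n::finite, 'k::field) mpoly" and n :: nat and c :: "'n \<Rightarrow> nat \<Rightarrow> 'k"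
  assumes y_Sdeg: "j < n + 2 \<Longrightarrow> y j \<in> Sdeg 1"
    and var_eq: "var i = (\<Sum>j<n + 2. scale (c i j) (y j))"
    and eval_y: "j < n + 2 \<Longrightarrow> eval (y j) (\<lambda>i. \<Sum>j<n + 2. c i j * a j) = a j"

lemma coords_exists:
  fixes y :: "nat \<Rightarrow> ('n::finite, 'k::field) mpoly"
  assumes "indep_mod {0} y (n + 2)" "\<And>j. j < n + 2 \<Longrightarrow> y j \<in> Sdeg 1"
    "vdim (Sdeg 1 :: ('n, 'k) mpoly set) = n + 2"
  shows "\<exists>c. coords y n c"
proof -
  have "\<exists>c. var i = (\<Sum>j<n + 2. scale (c j) (y j))" for i :: 'n
    using indep_span[OF subsp_Sdeg subset_refl, of y 1 "var i"] assms Sdeg_var[of i] by simp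
  then have "\<forall>i :: 'n. \<exists>c. var i = (\<Sum>j<n + 2. scale (c j) (y j))" by blast
  from choice[OF this] obtain c where c: "\<forall>i :: 'n. var i = (\<Sum>j<n + 2. scale (c i j) (y j))" ..
  have "eval (y l) (\<lambda>i. \<Sum>j<n + 2. c i j * a j) = a l" if l: "l < n + 2" for l and a :: "nat \<Rightarrow> 'k"
  proof -
    obtain d where d: "y l = (\<Sum>i\<in>UNIV. scale (d i) (var i))" using linear_form[OF assms(2)[OF l]] ..
    \<comment> \<open>Row \<open>l\<close> of the product of the two coordinate matrices;
      independence of \<open>y\<close> forces it to be a unit row.\<close>
    define e where "e j = (\<Sum>i\<in>UNIV. d i * c i j)" for j
    have "y l = (\<Sum>i\<in>UNIV. scale (d i) (\<Sum>j<n + 2. scale (c i j) (y j)))"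
      unfolding d using c by simp
    also have "\<dots> = (\<Sum>j<n + 2. scale (e j) (y j))"
      unfolding e_def mp.scale_sum_left mp.scale_sum_right by (subst sum.swap) simp
    finally have yl: "y l = (\<Sum>j<n + 2. scale (e j) (y j))" .
    have yl': "y l = (\<Sum>j<n + 2. scale (if j = l then 1 else 0) (y j))"
      using l by (simp only: if_distrib[of "\<lambda>c. scale c _"] mp.scale_zero_left sum.delta' finite_lessThan) simp
    have "(\<Sum>j<n + 2. scale (e j - (if j = l then 1 else 0)) (y j)) = y l - y l"
      unfolding mp.scale_left_diff_distrib sum_subtractf yl[symmetric] yl'[symmetric] ..
    then have "(\<Sum>j<n + 2. scale (e j - (if j = l then 1 else 0)) (y j)) \<in> {0}" by simp
    from indep_modD[OF assms(1) this] have e: "e j = (if j = l then 1 else 0)" if "j < n + 2" for j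
      using that by fastforce
    have "eval (y l) (\<lambda>i. \<Sum>j<n + 2. c i j * a j) = (\<Sum>i\<in>UNIV. d i * (\<Sum>j<n + 2. c i j * a j))"
      unfolding d by (simp add: eval_sum)
    also have "\<dots> = (\<Sum>j<n + 2. e j * a j)"
      unfolding e_def sum_distrib_left sum_distrib_right by (subst sum.swap) (simp add: mult.assoc)
    also have "\<dots> = (\<Sum>j<n + 2. if j = l then a j else 0)" by (intro sum.cong) (auto simp: e)
    also have "\<dots> = a l" using l by (simp add: sum.delta)
    finally show ?thesis .
  qed
  then show ?thesis using assms(2) c by (intro exI[of _ c]) (unfold_locales, auto)
qed

context coords
begin

abbreviation "hh \<equiv> hz (y 0) (y 1)"

definition pt :: "(nat \<Rightarrow> 'k) \<Rightarrow> 'n \<Rightarrow> 'k" where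
  "pt a = (\<lambda>i. \<Sum>j<n + 2. c i j * a j)"

lemma eval_y_pt [simp]: "j < n + 2 \<Longrightarrow> eval (y j) (pt a) = a j"
  using eval_y unfolding pt_def .

lemma pt_eval: "pt (\<lambda>j. eval (y j) x) = x"
proof
  fix i
  have "x i = eval (var i) x" by simp
  also have "\<dots> = (\<Sum>j<n + 2. c i j * eval (y j) x)" unfolding var_eq[of i] by (simp add: eval_sum)
  finally show "pt (\<lambda>j. eval (y j) x) i = x i" by (simp add: pt_def)
qed

lemma y01_Sdeg [simp]: "y 0 \<in> Sdeg 1" "y 1 \<in> Sdeg 1" "y (Suc 0) \<in> Sdeg 1" "y 0 \<in> Sdeg (Suc 0)" "y (Suc 0) \<in> Sdeg (Suc 0)"
  using y_Sdeg[of 0] y_Sdeg[of 1] by auto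

lemma hh_Sdeg [simp]: "hh a p \<in> Sdeg a" "hz (y 0) (y (Suc 0)) a p \<in> Sdeg a"
  using hz_Sdeg[of "y 0" "y 1"] by auto

lemma y_times_Sdeg: "j < n + 2 \<Longrightarrow> F \<in> Sdeg a \<Longrightarrow> y j * F \<in> Sdeg (Suc a)"
  using Sdeg_mult[OF y_Sdeg, of j F a] by simp

text \<open>Taylor expansion of \<open>F\<close> along the line: \<open>p\<close> is the
  restriction, \<open>q i\<close> the derivative in direction \<open>y (i + 2)\<close> on the line,
  and \<open>H\<close> a remainder in the square of the ideal of the line. The clauses for
  \<open>a = 0\<close> and \<open>a < 2\<close> make up for truncated subtraction in the
  degrees.\<close>

definition decomposes :: "nat \<Rightarrow> ('n, 'k) mpoly \<Rightarrow> 'k poly \<Rightarrow> (nat \<Rightarrow> 'k poly) \<Rightarrow> (nat \<Rightarrow> nat \<Rightarrow> ('n, 'k) mpoly) \<Rightarrow> bool" where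
  "decomposes a F p q H \<longleftrightarrow> degree p \<le> a \<and> (\<forall>i. degree (q i) \<le> a - 1 \<and> (a = 0 \<longrightarrow> q i = 0)) \<and>
     (\<forall>i j. H i j \<in> Sdeg (a - 2) \<and> (a < 2 \<longrightarrow> H i j = 0)) \<and>
     F = hh a p + (\<Sum>i<n. y (i + 2) * hh (a - 1) (q i)) + (\<Sum>i<n. \<Sum>j<n. y (i + 2) * y (j + 2) * H i j)"

lemma decomposes_add:
  assumes "decomposes a F p q H" "decomposes a F' p' q' H'"
  shows "decomposes a (F + F') (p + p') (\<lambda>i. q i + q' i) (\<lambda>i j. H i j + H' i j)"
  using assms unfolding decomposes_def
  by (auto intro!: degree_add_le Sdeg_add simp: hz_add algebra_simps sum.distrib)

lemma decomposes_scale: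
  assumes "decomposes a F p q H"
  shows "decomposes a (scale b F) (smult b p) (\<lambda>i. smult b (q i)) (\<lambda>i j. scale b (H i j))"
  using assms unfolding decomposes_def
  by (auto intro!: Sdeg_scale order_trans[OF degree_smult_le] simp: hz_smult mp.scale_right_distrib mp.scale_sum_right scale_mult_right)

lemma decomposes_y0:
  assumes "decomposes a F p q H"
  shows "decomposes (Suc a) (y 0 * F) p q (\<lambda>i j. y 0 * H i j)"
proof -
  have H: "y 0 * H i j \<in> Sdeg (Suc a - 2)" for i j
    using assms y_times_Sdeg[of 0 "H i j" "a - 2"] unfolding decomposes_def
    by (cases "a < 2") (auto simp: Suc_diff_Suc numeral_2_eq_2)
  have q: "y 0 * hh (a - 1) (q i) = hh a (q i)" for i
    using assms hz_times_z0[of "q i" "a - 1" "y 0" "y 1"] unfolding decomposes_def by (cases a) auto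
  have "y 0 * F = hh (Suc a) p + (\<Sum>i<n. y (i + 2) * hh a (q i)) + (\<Sum>i<n. \<Sum>j<n. y (i + 2) * y (j + 2) * (y 0 * H i j))"
  proof -
    have F: "F = hh a p + (\<Sum>i<n. y (i + 2) * hh (a - 1) (q i)) + (\<Sum>i<n. \<Sum>j<n. y (i + 2) * y (j + 2) * H i j)"
      and p: "degree p \<le> a" using assms unfolding decomposes_def by blast+
    have 1: "y 0 * hh a p = hh (Suc a) p" using p by (intro hz_times_z0)
    have 2: "y 0 * (\<Sum>i<n. y (i + 2) * hh (a - 1) (q i)) = (\<Sum>i<n. y (i + 2) * hh a (q i))"
      unfolding sum_distrib_left by (intro sum.cong refl) (simp only: mult.left_commute[of "y 0"] q)
    have 3: "y 0 * (\<Sum>i<n. \<Sum>j<n. y (i + 2) * y (j + 2) * H i j) = (\<Sum>i<n. \<Sum>j<n. y (i + 2) * y (j + 2) * (y 0 * H i j))"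
      unfolding sum_distrib_left by (intro sum.cong refl) (simp only: mult.left_commute[of "y 0"])
    show ?thesis by (subst F) (simp only: distrib_left 1 2 3)
  qed
  then show ?thesis using assms H unfolding decomposes_def
    by (auto intro: le_SucI order_trans[OF _ diff_le_self])
qed

lemma decomposes_y1:
  assumes "decomposes a F p q H"
  shows "decomposes (Suc a) (y 1 * F) (pCons 0 p) (\<lambda>i. pCons 0 (q i)) (\<lambda>i j. y 1 * H i j)"
proof -
  have H: "y 1 * H i j \<in> Sdeg (Suc a - 2)" for i j
    using assms y_times_Sdeg[of 1 "H i j" "a - 2"] unfolding decomposes_def
    by (cases "a < 2") (auto simp: Suc_diff_Suc numeral_2_eq_2)
  have q: "y 1 * hh (a - 1) (q i) = hh a (pCons 0 (q i))" for i
    using assms hz_times_z1[of "y 1" "y 0" "a - 1" "q i"] unfolding decomposes_def by (cases a) auto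
  have dq: "degree (pCons 0 (q i)) \<le> a" for i
    using assms degree_pCons_le[of 0 "q i"] unfolding decomposes_def
    by (cases a) (auto intro: order_trans[OF degree_pCons_le])
  have "y 1 * F = hh (Suc a) (pCons 0 p) + (\<Sum>i<n. y (i + 2) * hh a (pCons 0 (q i))) + (\<Sum>i<n. \<Sum>j<n. y (i + 2) * y (j + 2) * (y 1 * H i j))"
  proof -
    have F: "F = hh a p + (\<Sum>i<n. y (i + 2) * hh (a - 1) (q i)) + (\<Sum>i<n. \<Sum>j<n. y (i + 2) * y (j + 2) * H i j)"
      and p: "degree p \<le> a" using assms unfolding decomposes_def by blast+
    have 1: "y 1 * hh a p = hh (Suc a) (pCons 0 p)" using p by (intro hz_times_z1)
    have 2: "y 1 * (\<Sum>i<n. y (i + 2) * hh (a - 1) (q i)) = (\<Sum>i<n. y (i + 2) * hh a (pCons 0 (q i)))"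
      unfolding sum_distrib_left by (intro sum.cong refl) (simp only: mult.left_commute[of "y 1"] q)
    have 3: "y 1 * (\<Sum>i<n. \<Sum>j<n. y (i + 2) * y (j + 2) * H i j) = (\<Sum>i<n. \<Sum>j<n. y (i + 2) * y (j + 2) * (y 1 * H i j))"
      unfolding sum_distrib_left by (intro sum.cong refl) (simp only: mult.left_commute[of "y 1"])
    show ?thesis by (subst F) (simp only: distrib_left 1 2 3)
  qed
  then show ?thesis using assms H dq unfolding decomposes_def
    by (auto intro: order_trans[OF degree_pCons_le])
qed

text \<open>A factor vanishing on the line shifts the expansion by one order: the restriction
  becomes a derivative, and the derivatives move into the remainder.\<close>

lemma decomposes_y:
  assumes "decomposes a F p q H" "l < n"
  shows "decomposes (Suc a) (y (l + 2) * F) 0 (\<lambda>i. if i = l then p else 0)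
    (\<lambda>i j. y (l + 2) * H i j + (if i = l then hh (a - 1) (q j) else 0))"
proof -
  have yl: "y (l + 2) \<in> Sdeg 1" using assms(2) by (intro y_Sdeg) simp
  have H: "y (l + 2) * H i j \<in> Sdeg (Suc a - 2)" for i j
    using assms y_times_Sdeg[of "l + 2" "H i j" "a - 2"] unfolding decomposes_def
    by (cases "a < 2") (auto simp: Suc_diff_Suc numeral_2_eq_2)
  have q: "hh (a - 1) (q j) \<in> Sdeg (Suc a - 2)" for j by (simp add: numeral_2_eq_2)
  have q0: "a = 0 \<Longrightarrow> q j = 0" for j using assms unfolding decomposes_def by simp
  have 1: "(\<Sum>i<n. y (i + 2) * hh a (if i = l then p else 0)) = y (l + 2) * hh a p"
    using assms(2) by (simp add: if_distrib[of "\<lambda>p. _ * hz _ _ _ p"] sum.delta' cong: if_cong)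
  have 2: "(\<Sum>i<n. \<Sum>j<n. y (i + 2) * y (j + 2) * (if i = l then hh (a - 1) (q j) else 0))
    = y (l + 2) * (\<Sum>j<n. y (j + 2) * hh (a - 1) (q j))"
  proof -
    have "(\<Sum>i<n. \<Sum>j<n. y (i + 2) * y (j + 2) * (if i = l then hh (a - 1) (q j) else 0))
      = (\<Sum>i<n. if i = l then y (l + 2) * (\<Sum>j<n. y (j + 2) * hh (a - 1) (q j)) else 0)"
      by (intro sum.cong) (auto simp: sum_distrib_left mult.assoc)
    then show ?thesis using assms(2) by (simp add: sum.delta')
  qed
  have "y (l + 2) * F = y (l + 2) * hh a p + y (l + 2) * (\<Sum>i<n. y (i + 2) * hh (a - 1) (q i))
      + (\<Sum>i<n. \<Sum>j<n. y (i + 2) * y (j + 2) * (y (l + 2) * H i j))"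
    using assms(1) unfolding decomposes_def
    by (simp add: distrib_left sum_distrib_left mult.left_commute mult.assoc)
  then have "y (l + 2) * F = hh (Suc a) 0 + (\<Sum>i<n. y (i + 2) * hh (Suc a - 1) (if i = l then p else 0))
    + (\<Sum>i<n. \<Sum>j<n. y (i + 2) * y (j + 2) * (y (l + 2) * H i j + (if i = l then hh (a - 1) (q j) else 0)))"
    unfolding distrib_left[of "_ * _"] sum.distrib 2 diff_Suc_1 1 by (simp add: algebra_simps)
  moreover have "y (l + 2) * H i j + (if i = l then hh (a - 1) (q j) else 0) \<in> Sdeg (Suc a - 2)" for i j
    using H[of i j] q[of j] by (auto intro: Sdeg_add)
  moreover have "Suc a < 2 \<Longrightarrow> y (l + 2) * H i j + (if i = l then hh (a - 1) (q j) else 0) = 0" for i j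
    using assms(1) q0[of j] unfolding decomposes_def by simp
  ultimately show ?thesis using assms(1) unfolding decomposes_def by auto
qed

text \<open>The forms with an expansion make up a subspace. Each variable is a combination of the
  \<open>y j\<close>, and multiplication by any \<open>y j\<close> has been treated, so the degree
  induction applies.\<close>

lemma decomposition: "F \<in> Sdeg a \<Longrightarrow> \<exists>p q H. decomposes a F p q H"
proof (induction a arbitrary: F)
  case 0
  have "decomposes 0 F [:lk F 0:] (\<lambda>_. 0) (\<lambda>_ _. 0)"
    unfolding decomposes_def using Sdeg_0_const[OF 0] by (simp add: hz_const)
  then show ?case by blast
next
  case (Suc a)
  let ?W = "{F. \<exists>p q H. decomposes (Suc a) F p q H}"
  have 0: "decomposes (Suc a) 0 0 (\<lambda>_. 0) (\<lambda>_ _. 0)" by (simp add: decomposes_def)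
  have W: "mp.subspace ?W"
    unfolding mp.subspace_def using 0 decomposes_add decomposes_scale by blast
  have "y j * G \<in> ?W" if Gj: "G \<in> Sdeg a" "j < n + 2" for j G
  proof -
    obtain p q H where G: "decomposes a G p q H" using Suc.IH[OF Gj(1)] by blast
    consider "j = 0" | "j = 1" | l where "j = l + 2" "l < n"
    proof (cases "j < 2")
      case False
      with that(3)[of "j - 2"] Gj(2) show ?thesis by simp
    qed (use that(1,2) in force)
    then show ?thesis using decomposes_y0[OF G] decomposes_y1[OF G] decomposes_y[OF G] by cases blast+
  qed
  then have "var i * G \<in> ?W" if "G \<in> Sdeg a" for i G
    unfolding var_eq[of i] sum_distrib_right scale_mult_left using that
    by (intro subspD[OF W]) auto
  from Sdeg_Suc_subset[OF W this] Suc.prems show ?case by blast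
qed

lemma decomposition_line:
  assumes "F \<in> Sdeg (Suc a)"
  shows "\<exists>p H. degree p \<le> Suc a \<and> (\<forall>i. H i \<in> Sdeg a) \<and> F = hh (Suc a) p + (\<Sum>i<n. y (i + 2) * H i)"
proof -
  obtain p q H where F: "decomposes (Suc a) F p q H" using decomposition[OF assms] by blast
  show ?thesis
  proof (intro exI conjI allI)
    show "degree p \<le> Suc a" using F by (simp add: decomposes_def)
    have "(\<Sum>j<n. y (j + 2) * H i j) \<in> Sdeg a" for i
    proof (cases "a = 0")
      case False
      then have "y (j + 2) * H i j \<in> Sdeg a" if "j < n" for j
        using y_times_Sdeg[of "j + 2" "H i j" "a - 1"] F that by (simp add: decomposes_def)
      then show ?thesis by (intro Sdeg_sum) auto
    qed (use F in \<open>simp add: decomposes_def\<close>)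
    then show "hh a (q i) + (\<Sum>j<n. y (j + 2) * H i j) \<in> Sdeg a" for i by (intro Sdeg_add) auto
    show "F = hh (Suc a) p + (\<Sum>i<n. y (i + 2) * (hh a (q i) + (\<Sum>j<n. y (j + 2) * H i j)))"
      using F by (simp add: decomposes_def distrib_left sum.distrib sum_distrib_left mult.assoc)
  qed
qed

end

section \<open>The line spanned by the scheme\<close>

lemma poly_zeroI:
  fixes p :: "'k::field poly"
  assumes "infinite (UNIV :: 'k set)" "\<And>x. poly p x = 0"
  shows "p = 0"
  using assms poly_roots_finite[of p] by auto

text \<open>The power of x + c' divides the first summand. At -c' the factors other than
  \<open>h\<close> do not vanish, so a nonzero \<open>h\<close> would have order at least
  \<open>N\<close> there, above its degree.\<close>

lemma pencil_coprime:
  fixes q :: "'k::field poly"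
  assumes q: "q \<noteq> 0" "q' \<noteq> 0" "poly q (- c') \<noteq> 0" "c \<noteq> c'" "degree h < N"
    and eq: "h * ([:c, 1:] ^ N * q) + h' * ([:c', 1:] ^ N * q') = 0"
  shows "h = 0 \<and> h' = 0"
proof -
  have "h = 0"
  proof (rule ccontr)
    assume h: "h \<noteq> 0"
    have nz: "h * ([:c, 1:] ^ N * q) \<noteq> 0" using h q by simp
    have "h * ([:c, 1:] ^ N * q) = [:c', 1:] ^ N * (- (h' * q'))"
      using eq by (simp add: add_eq_0_iff algebra_simps)
    then have "[:- (- c'), 1:] ^ N dvd h * ([:c, 1:] ^ N * q)" by simp
    then have "N \<le> order (- c') (h * ([:c, 1:] ^ N * q))" using nz unfolding order_divides by simp
    also have "\<dots> = order (- c') h"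
    proof -
      have "poly ([:c, 1:] ^ N * q) (- c') \<noteq> 0" using q by (simp add: poly_power)
      then have "order (- c') ([:c, 1:] ^ N * q) = 0" by (rule order_0I)
      then show ?thesis using order_mult[OF nz] by simp
    qed
    also have "\<dots> \<le> degree h" by (rule order_degree[OF h])
    finally show False using q by simp
  qed
  moreover from this have "h' * ([:c', 1:] ^ N * q') = 0" using eq by simp
  then have "h' = 0" using q by simp
  ultimately show ?thesis by simp
qed

context coords
begin

lemma hh_eval_line:
  assumes "degree p \<le> a"
  shows "eval (hh a p) (pt (\<lambda>j. if j = 0 then 1 else if j = 1 then s else 0)) = poly p s"
  by (subst eval_hz) (use assms in auto)

lemma hh_inj:
  assumes "infinite (UNIV :: 'k set)" "degree p \<le> a" "hh a p = 0"
  shows "p = 0"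
  by (rule poly_zeroI[OF assms(1)]) (use hh_eval_line[OF assms(2)] assms(3) in simp)

text \<open>The a + 1 monomials in \<open>y 0\<close>, \<open>y 1\<close> restrict to distinct
  powers on the line; over an infinite field they are independent as functions.\<close>

lemma vdim_Sdeg_ge:
  assumes "infinite (UNIV :: 'k set)"
  shows "Suc a \<le> vdim (Sdeg a :: ('n, 'k) mpoly set)"
proof (rule indep_le_vdim[OF subsp_Sdeg subset_refl])
  show "indep_mod {0} (\<lambda>k. hh a (monom 1 k)) (Suc a)"
    unfolding indep_mod_def
  proof (intro allI impI)
    fix c u assume c: "(\<Sum>u<Suc a. scale (c u) (hh a (monom 1 u))) \<in> {0}" and u: "u < Suc a"
    have "hh a (\<Sum>u<Suc a. monom (c u) u) = 0"
      using c by (simp add: hz_sum hz_add flip: hz_smult smult_monom del: sum.lessThan_Suc)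
        (simp add: smult_monom)
    moreover have "degree (\<Sum>u<Suc a. monom (c u) u) \<le> a"
      by (rule degree_sum_le) (auto intro: order_trans[OF degree_monom_le])
    ultimately have "(\<Sum>u<Suc a. monom (c u) u) = 0" by (intro hh_inj[OF assms])
    then have "coeff (\<Sum>u<Suc a. monom (c u) u) u = 0" by simp
    then show "c u = 0" using u by (simp add: coeff_sum sum.delta del: sum.lessThan_Suc)
  qed
qed simp

lemma z_power: "(scale b (y 0) + y 1) ^ j * y 0 ^ k = hh (j + k) ([:b, 1:] ^ j)"
proof -
  have deg: "degree ([:b, 1:] ^ j) \<le> j" for j
    using degree_power_le[of "[:b, 1:]" j] by simp
  have z: "scale b (y 0) + y 1 = hh 1 [:b, 1:]" by (simp add: hz_def)
  have "(scale b (y 0) + y 1) ^ j = hh j ([:b, 1:] ^ j)"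
  proof (induction j)
    case (Suc j)
    then show ?case using hz_mult[of "[:b, 1:]" 1 "[:b, 1:] ^ j" j "y 0" "y 1"] deg[of j] z by simp
  qed (simp add: hz_one)
  then show ?thesis using hz_times_z0_power[OF deg[of j], where ?z0.0 = "y 0" and b = k and ?z1.0 = "y 1"] by (simp add: mult.commute)
qed

text \<open>In x = y 1 / y 0 the new coordinates are x + b and 1. A polynomial of degree at most
  \<open>m\<close> homogenized in degree \<open>D\<close> therefore leaves the factor (x + b)^(D -
  m).\<close>

lemma hz_change:
  assumes "degree p \<le> m" "m \<le> D"
  shows "hz (scale b (y 0) + y 1) (y 0) D p =
    hh D ([:b, 1:] ^ (D - m) * (\<Sum>k\<le>m. smult (coeff p k) ([:b, 1:] ^ (m - k))))"
proof -
  have "hz (scale b (y 0) + y 1) (y 0) D p = (\<Sum>k\<le>m. scale (coeff p k) ((scale b (y 0) + y 1) ^ (D - k) * y 0 ^ k))"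
    unfolding hz_def by (rule sum.mono_neutral_right) (use assms in \<open>auto simp: coeff_eq_0\<close>)
  also have "\<dots> = (\<Sum>k\<le>m. hh D (smult (coeff p k) ([:b, 1:] ^ (D - m) * [:b, 1:] ^ (m - k))))"
  proof (intro sum.cong refl)
    fix k assume "k \<in> {..m}"
    then have "D - k + k = D" "D - m + (m - k) = D - k" using assms by auto
    then show "scale (coeff p k) ((scale b (y 0) + y 1) ^ (D - k) * y 0 ^ k)
      = hh D (smult (coeff p k) ([:b, 1:] ^ (D - m) * [:b, 1:] ^ (m - k)))"
      by (simp only: z_power hz_smult flip: power_add)
  qed
  also have "\<dots> = hh D ([:b, 1:] ^ (D - m) * (\<Sum>k\<le>m. smult (coeff p k) ([:b, 1:] ^ (m - k))))"
    unfolding hz_sum[symmetric] sum_distrib_left by (simp only: mult_smult_right)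
  finally show ?thesis .
qed

end

locale hilb_ideal =
  fixes I :: "('n::finite, 'k::field) mpoly set" and r :: nat
  assumes homog: "homog_ideal I"
    and codim: "vdim (Sdeg a :: ('n, 'k) mpoly set) - vdim (comp_deg I a) = min (vdim (Sdeg a :: ('n, 'k) mpoly set)) r"
    and inf: "infinite (UNIV :: 'k set)"
begin

lemma ideal: "is_ideal I"
  using homog by (simp add: homog_ideal_def)

lemma sat_ideal: "is_ideal (saturation I)"
  using is_ideal_saturation[OF ideal] .

lemma I_sub: "f \<in> I \<Longrightarrow> f \<in> saturation I"
  using saturation_superset[OF ideal] by blast

text \<open>The scheme does not meet z0 = 0. The bound is on the degree of the polynomial, not of
  the form: if fewer than r points, with multiplicity, lay in the chart z0 = 1, their equation times
  a power of z0 would violate it.\<close>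

definition good :: "('n, 'k) mpoly \<Rightarrow> ('n, 'k) mpoly \<Rightarrow> bool" where
  "good z0 z1 \<longleftrightarrow> (\<forall>a p. degree p < r \<longrightarrow> degree p \<le> a \<longrightarrow> hz z0 z1 a p \<in> saturation I \<longrightarrow> p = 0)"

end

locale line_coords = coords y n c + hilb_ideal I r
  for y :: "nat \<Rightarrow> ('n::finite, 'k::field) mpoly" and n c and I :: "('n, 'k) mpoly set" and r +
  assumes y_sat: "i < n \<Longrightarrow> y (i + 2) \<in> saturation I" and r_pos: "1 \<le> r"
begin

lemma line_sat: "(\<Sum>i<n. y (i + 2) * H i) \<in> saturation I"
  by (intro is_idealD(6)[OF sat_ideal] is_idealD(4)[OF sat_ideal] y_sat) simp

text \<open>Each equation of the line has its own exponent from the saturation; their sum serves all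
  of them. The congruence is modulo \<open>I\<close> itself, not merely its saturation.\<close>

lemma eventually_line:
  "\<exists>k. \<forall>D\<ge>k. \<forall>F\<in>Sdeg D. \<exists>p. degree p \<le> D \<and> F - hh D p \<in> I"
proof -
  have "\<forall>i. \<exists>k. i < n \<longrightarrow> (\<forall>b\<ge>k. \<forall>F\<in>Sdeg b. F * y (i + 2) \<in> I)"
    using y_sat unfolding saturation_iff[OF ideal] by blast
  from choice[OF this] obtain k where k: "\<forall>i. i < n \<longrightarrow> (\<forall>b\<ge>k i. \<forall>F\<in>Sdeg b. F * y (i + 2) \<in> I)" ..
  have "\<exists>p. degree p \<le> D \<and> F - hh D p \<in> I" if D: "Suc (\<Sum>i<n. k i) \<le> D" and F: "F \<in> Sdeg D" for D F
  proof -
    obtain b where b: "D = Suc b" using D by (cases D) auto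
    obtain p H where p: "degree p \<le> Suc b" "\<forall>i. H i \<in> Sdeg b" "F = hh (Suc b) p + (\<Sum>i<n. y (i + 2) * H i)"
      using decomposition_line F unfolding b by blast
    have "y (i + 2) * H i \<in> I" if "i < n" for i
    proof -
      have "k i \<le> (\<Sum>i<n. k i)" using that by (intro member_le_sum) auto
      then have "k i \<le> b" using D b by simp
      then have "H i * y (i + 2) \<in> I" using k that p(2) by blast
      then show ?thesis by (simp only: mult.commute)
    qed
    then have "(\<Sum>i<n. y (i + 2) * H i) \<in> I" by (intro is_idealD(6)[OF ideal]) simp
    then show ?thesis using p b by auto
  qed
  then show ?thesis by blast
qed

text \<open>A violation \<open>p\<close> of goodness is multiplied by powers of the new z0 until it
  enters \<open>I\<close>. In the old coordinate this gives a growing power of x + b times a fixed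
  \<open>q\<close> of bounded degree.\<close>

lemma bad_form:
  assumes "\<not> good (scale b (y 0) + y 1) (y 0)"
  shows "\<exists>q N0. q \<noteq> 0 \<and> degree q \<le> r - 1 \<and> (\<forall>N\<ge>N0. hh (N + (r - 1)) ([:b, 1:] ^ N * q) \<in> I)"
proof -
  let ?z = "scale b (y 0) + y 1"
  obtain a p where p: "degree p < r" "degree p \<le> a" "hz ?z (y 0) a p \<in> saturation I" "p \<noteq> 0"
    using assms unfolding good_def by blast
  obtain k where k: "\<And>b F. k \<le> b \<Longrightarrow> F \<in> Sdeg b \<Longrightarrow> F * hz ?z (y 0) a p \<in> I"
    using p(3) unfolding saturation_iff[OF ideal] by blast
  have z1: "?z \<in> Sdeg 1" by (intro Sdeg_add Sdeg_scale) auto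
  define q where "q = (\<Sum>k\<le>r - 1. smult (coeff p k) ([:b, 1:] ^ (r - 1 - k)))"
  have dp: "degree p \<le> r - 1" using p by simp
  have "q \<noteq> 0"
  proof
    assume "q = 0"
    then have h0: "hz ?z (y 0) (r - 1) p = 0"
      using hz_change[OF dp order_refl, of b] by (simp add: q_def)
    have "poly p s = 0" for s
    proof -
      \<comment> \<open>At this point the new z0 equals 1 and the new z1 equals \<open>s\<close>, so
        evaluation returns the value of \<open>p\<close> at \<open>s\<close>.\<close>
      let ?x = "pt (\<lambda>j. if j = 0 then s else if j = 1 then 1 - b * s else 0)"
      have "eval (hz ?z (y 0) (r - 1) p) ?x = poly p (eval (y 0) ?x)"
        by (rule eval_hz[OF _ dp]) simp
      then show ?thesis using h0 by simp
    qed
    then show False using poly_zeroI[OF inf] p(4) by blast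
  qed
  moreover have "degree q \<le> r - 1"
    unfolding q_def
  proof (rule degree_sum_le)
    fix k
    have "degree ([:b, 1:] ^ (r - 1 - k)) \<le> r - 1" using degree_power_le[of "[:b, 1:]" "r - 1 - k"] by simp
    then show "degree (smult (coeff p k) ([:b, 1:] ^ (r - 1 - k))) \<le> r - 1"
      using degree_smult_le order_trans by blast
  qed simp
  moreover have "hh (N + (r - 1)) ([:b, 1:] ^ N * q) \<in> I" if "a + k \<le> N" for N
  proof -
    have "?z ^ (N + (r - 1) - a) * hz ?z (y 0) a p \<in> I"
      by (rule k[OF _ Sdeg_power[OF z1]]) (use that in simp)
    then have "hz ?z (y 0) (N + (r - 1)) p \<in> I"
      using hz_times_z0_power[OF p(2), of ?z "N + (r - 1) - a" "y 0"] that by simp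
    then show ?thesis using hz_change[OF dp, of "N + (r - 1)" b] by (simp add: q_def)
  qed
  ultimately show ?thesis by blast
qed

text \<open>If z_0 = x + c were bad for two values c of x, the multiples of (x + c)^N q_c by the
  x^i with i < N would give 2 N elements of a space of binary forms of dimension 2 N - 1, and a
  linear relation between them contradicts coprimality.\<close>

lemma good_exists: "\<exists>b. good (scale b (y 0) + y 1) (y 0)"
proof (rule ccontr)
  assume "\<not> ?thesis"
  then have bad: "\<And>b. \<not> good (scale b (y 0) + y 1) (y 0)" by blast
  obtain q N0 where q: "q \<noteq> 0" "degree q \<le> r - 1" "\<forall>N\<ge>N0. hh (N + (r - 1)) ([:0, 1:] ^ N * q) \<in> I"
    using bad_form[OF bad] by blast
  have "finite (insert 0 (uminus ` {x. poly q x = 0}))" using poly_roots_finite[OF q(1)] by simp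
  \<comment> \<open>\<open>b\<close> must differ from the first value 0, and -b must not be a root
    of the first \<open>q\<close>; both are needed for coprimality.\<close>
  then obtain b where b: "b \<notin> insert 0 (uminus ` {x. poly q x = 0})" using inf ex_new_if_finite by blast
  have b': "poly q (- b) \<noteq> 0" "0 \<noteq> b" using b by (auto simp: image_iff)
  obtain q' N1 where q': "q' \<noteq> 0" "degree q' \<le> r - 1" "\<forall>N\<ge>N1. hh (N + (r - 1)) ([:b, 1:] ^ N * q') \<in> I"
    using bad_form[OF bad] by blast
  obtain k where k: "\<forall>D\<ge>k. \<forall>F\<in>Sdeg D. \<exists>p. degree p \<le> D \<and> F - hh D p \<in> I"
    using eventually_line by blast
  define N where "N = N0 + N1 + k + 1"
  \<comment> \<open>Multipliers have degree below \<open>N\<close>, the bad forms degree N + (r -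
    1). The binary forms of degree \<open>D\<close> then have dimension 2 N + r - 1.\<close>
  define D where "D = (N - 1) + (N + (r - 1))"
  define A A' where "A = [:0, 1:] ^ N * q" and "A' = [:b, 1:] ^ N * q'"
  have dA: "degree A \<le> N + (r - 1)" "degree A' \<le> N + (r - 1)"
    unfolding A_def A'_def
    by (rule order_trans[OF degree_mult_le] add_mono order_trans[OF degree_power_le] | use q q' in simp)+
  have IA: "hh (N + (r - 1)) A \<in> I" "hh (N + (r - 1)) A' \<in> I"
    unfolding A_def A'_def by (rule q(3)[rule_format], simp add: N_def, rule q'(3)[rule_format], simp add: N_def)
  have "vdim (Sdeg D :: ('n, 'k) mpoly set) \<ge> Suc D" by (rule vdim_Sdeg_ge[OF inf])
  then have cod: "vdim (Sdeg D :: ('n, 'k) mpoly set) - vdim (comp_deg I D) = r"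
    using codim[of D] by (simp add: D_def N_def)
  obtain G where G: "indep_mod (comp_deg I D) G r" "\<And>u. u < r \<Longrightarrow> G u \<in> Sdeg D"
    by (rule indep_mod_exists[OF subsp_comp_deg[OF ideal, of D] comp_deg_subset[of I D], unfolded cod])
      (rule that, assumption+)
  have "\<forall>u. \<exists>p. u < r \<longrightarrow> degree p \<le> D \<and> G u - hh D p \<in> I"
    using k G(2) by (simp add: D_def N_def)
  from choice[OF this] obtain g where g: "\<forall>u. u < r \<longrightarrow> degree (g u) \<le> D \<and> G u - hh D (g u) \<in> I" ..
  \<comment> \<open>Besides the 2 N multiples the list contains binary representatives of a basis
    modulo \<open>I\<close>. This makes 2 N + r elements, one more than the dimension, and encodes
    the codimension r without passing to a quotient.\<close>
  define W where "W u = (if u < N then monom 1 u * A else if u < N + N then monom 1 (u - N) * A' else g (u - (N + N)))" for u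
  have dm: "degree (monom 1 u * B) \<le> D" if "u < N" "degree B \<le> N + (r - 1)" for u and B :: "'k poly"
    by (rule order_trans[OF degree_mult_le], unfold D_def, rule add_mono)
      (use that degree_monom_le[of "1 :: 'k" u] in auto)
  have dW: "degree (W u) \<le> D" if "u < N + N + r" for u
    using that dm[OF _ dA(1), of u] dm[OF _ dA(2), of "u - N"] g by (auto simp: W_def)
  have "card {..D} < card {..<N + N + r}" using r_pos by (simp add: D_def N_def)
  from hom_system[OF _ _ this, of "\<lambda>k u. coeff (W u) k"]
  obtain e where e: "\<exists>u\<in>{..<N + N + r}. e u \<noteq> 0" "\<forall>k\<in>{..D}. (\<Sum>u\<in>{..<N + N + r}. coeff (W u) k * e u) = 0"
    by auto
  have W0: "(\<Sum>u<N + N + r. smult (e u) (W u)) = 0"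
  proof (rule poly_eqI)
    fix k
    show "coeff (\<Sum>u<N + N + r. smult (e u) (W u)) k = coeff 0 k"
    proof (cases "k \<le> D")
      case True
      then show ?thesis using e(2) by (simp add: coeff_sum mult.commute)
    next
      case False
      then have "coeff (W u) k = 0" if "u < N + N + r" for u
        using dW[OF that] by (simp add: coeff_eq_0)
      then show ?thesis by (simp add: coeff_sum)
    qed
  qed
  define h h' where "h = (\<Sum>u<N. monom (e u) u)" and "h' = (\<Sum>u<N. monom (e (N + u)) u)"
  have ch: "coeff h u = (if u < N then e u else 0)" "coeff h' u = (if u < N then e (N + u) else 0)" for u
    by (simp_all add: h_def h'_def coeff_sum sum.delta)
  have dh: "degree h < N" "degree h' < N"
    by (rule le_less_trans[OF degree_le[of "N - 1"]]; simp add: ch N_def)+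
  have W_split: "h * A + h' * A' + (\<Sum>u<r. smult (e (N + N + u)) (g u)) = 0"
  proof -
    have "h * A = (\<Sum>u<N. smult (e u) (W u))"
      unfolding h_def sum_distrib_right by (intro sum.cong) (auto simp: W_def smult_monom simp flip: mult_smult_left)
    moreover have "h' * A' = (\<Sum>u<N. smult (e (N + u)) (W (N + u)))"
      unfolding h'_def sum_distrib_right by (intro sum.cong) (auto simp: W_def smult_monom simp flip: mult_smult_left)
    moreover have "(\<Sum>u<r. smult (e (N + N + u)) (g u)) = (\<Sum>u<r. smult (e (N + N + u)) (W (N + N + u)))"
      by (simp add: W_def)
    ultimately show ?thesis using W0 by (simp add: sum_lessThan_add)
  qed
  have hA: "hh D (f * B) \<in> I" if "degree f < N" "degree B \<le> N + (r - 1)" "hh (N + (r - 1)) B \<in> I" for f B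
  proof -
    have "hh D (f * B) = hh (N - 1) f * hh (N + (r - 1)) B"
      unfolding D_def by (rule hz_mult[symmetric]) (use that in auto)
    then show ?thesis using is_idealD(3)[OF ideal that(3)] by simp
  qed
  \<comment> \<open>In the relation the multiples of \<open>A\<close> and \<open>A'\<close> lie in
    \<open>I\<close>, hence so does the part in the \<open>G u\<close>; its coefficients vanish,
    leaving a relation between \<open>A\<close> and \<open>A'\<close> alone.\<close>
  have "(\<Sum>u<r. scale (e (N + N + u)) (G u)) \<in> comp_deg I D"
  proof -
    have "(\<Sum>u<r. scale (e (N + N + u)) (G u)) = (\<Sum>u<r. scale (e (N + N + u)) (G u - hh D (g u)))
      + hh D (\<Sum>u<r. smult (e (N + N + u)) (g u))"
      by (simp add: mp.scale_right_diff_distrib sum_subtractf hz_sum hz_smult)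
    also have "(\<Sum>u<r. smult (e (N + N + u)) (g u)) = 0 - (h * A + h' * A')"
      by (simp only: minus_unique[OF W_split, symmetric] diff_0)
    also have "(\<Sum>u<r. scale (e (N + N + u)) (G u - hh D (g u))) + hh D (0 - (h * A + h' * A')) \<in> I"
    proof (rule is_idealD(2)[OF ideal])
      show "(\<Sum>u<r. scale (e (N + N + u)) (G u - hh D (g u))) \<in> I"
        by (rule is_idealD(6)[OF ideal], rule is_ideal_scale[OF ideal]) (use g in simp)
      have "hh D (h * A) \<in> I" "hh D (h' * A') \<in> I" using hA dh dA IA by auto
      then show "hh D (0 - (h * A + h' * A')) \<in> I"
        unfolding hz_diff hz_add hz_0 by (intro is_idealD(2,5)[OF ideal] is_idealD(1)[OF ideal])
    qed
    finally have "(\<Sum>u<r. scale (e (N + N + u)) (G u)) \<in> I" .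
    moreover have "(\<Sum>u<r. scale (e (N + N + u)) (G u)) \<in> Sdeg D"
      using G(2) by (intro Sdeg_sum Sdeg_scale) simp
    ultimately show ?thesis by (simp add: comp_deg_def)
  qed
  then have e3: "e (N + N + u) = 0" if "u < r" for u
    using indep_modD[OF G(1), of "\<lambda>u. e (N + N + u)"] that by blast
  then have "h * A + h' * A' = 0" using W_split by simp
  then have h0: "h = 0 \<and> h' = 0"
    unfolding A_def A'_def by (rule pencil_coprime[OF q(1) q'(1) b' dh(1)])
  obtain u where u: "u < N + N + r" "e u \<noteq> 0" using e(1) by auto
  have "e u = 0"
  proof (cases "u < N")
    case True
    then show ?thesis using ch(1)[of u] h0 by simp
  next
    case False
    show ?thesis
    proof (cases "u < N + N")
      case True
      then have "u - N < N" "N + (u - N) = u" using False by auto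
      then show ?thesis using ch(2)[of "u - N"] h0 by simp
    next
      case False
      then have "u - (N + N) < r" "N + N + (u - (N + N)) = u" using u(1) by auto
      then show ?thesis using e3[of "u - (N + N)"] by simp
    qed
  qed
  then show False using u(2) by simp
qed

end

section \<open>The ideal in an affine chart of the line\<close>

locale good_line = line_coords y n c I r
  for y :: "nat \<Rightarrow> ('n::finite, 'k::field) mpoly" and n c and I :: "('n, 'k) mpoly set" and r +
  assumes good: "good (y 0) (y 1)" and n_pos: "1 \<le> n" and r4: "4 \<le> r"
begin

lemma goodD: "degree p < r \<Longrightarrow> degree p \<le> a \<Longrightarrow> hh a p \<in> saturation I \<Longrightarrow> p = 0"
  using good unfolding good_def by blast

lemma hh_monom_sum: "(\<Sum>k<m. scale (b k) (hh a (monom 1 k))) = hh a (\<Sum>k<m. monom (b k) k)"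
  by (simp add: hz_sum smult_monom flip: hz_smult)

lemma degree_monom_sum: "m \<le> Suc a \<Longrightarrow> degree (\<Sum>k<m. monom (b k) k) \<le> a"
  by (rule degree_sum_le) (auto intro: order_trans[OF degree_monom_le])

lemma coeff_monom_sum: "coeff (\<Sum>k<m. monom (b k) k) j = (if j < m then b j else 0)"
  by (simp add: coeff_sum sum.delta)

lemma hh_indep_sat:
  assumes "m \<le> r" "m \<le> Suc a"
  shows "indep_mod (saturation I) (\<lambda>k. hh a (monom 1 k)) m"
  unfolding indep_mod_def hh_monom_sum
proof (intro allI impI)
  fix b u assume b: "hh a (\<Sum>k<m. monom (b k) k) \<in> saturation I" and u: "u < m"
  have "m \<le> Suc (r - 1)" using assms by simp
  then have "degree (\<Sum>k<m. monom (b k) k) < r"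
    using degree_monom_sum[of m "r - 1" b] r4 by simp
  then have "(\<Sum>k<m. monom (b k) k) = 0"
    using goodD[OF _ degree_monom_sum[OF assms(2)] b] by simp
  then show "b u = 0" using coeff_monom_sum[of b m u] u by simp
qed

lemma comp_deg_sat: "comp_deg I a \<subseteq> saturation I"
  using I_sub by (auto simp: comp_deg_def)

text \<open>Goodness makes 1, x, ..., x^(r - 1) independent modulo \<open>I\<close>, and the
  codimension of \<open>I\<close> is at most r. So they represent a basis, and every form has a
  remainder of degree below r.\<close>

lemma hh_rem:
  assumes "r \<le> Suc a" "F \<in> Sdeg a"
  obtains p where "degree p < r" "F - hh a p \<in> I"
proof -
  have "indep_mod (comp_deg I a) (\<lambda>k. hh a (monom 1 k)) r"
    using hh_indep_sat[OF order_refl assms(1)] comp_deg_sat by (rule indep_mod_mono)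
  then have "\<exists>b. F - (\<Sum>k<r. scale (b k) (hh a (monom 1 k))) \<in> comp_deg I a"
    by (rule indep_mod_span[OF subsp_comp_deg[OF ideal] comp_deg_subset])
      (use assms codim[of a] in auto)
  then obtain b where b: "F - hh a (\<Sum>k<r. monom (b k) k) \<in> I"
    unfolding hh_monom_sum by (auto simp: comp_deg_def)
  have "degree (\<Sum>k<r. monom (b k) k) < r"
    using degree_monom_sum[of r "r - 1" b] r4 by simp
  then show ?thesis using b by (rule that)
qed

text \<open>For an element of the saturation the remainder lies in the saturation too, so goodness
  kills it. Hence \<open>I\<close> is saturated from degree r - 1 on.\<close>

lemma sat_eq:
  assumes "r \<le> Suc a" "F \<in> Sdeg a" "F \<in> saturation I"
  shows "F \<in> I"
proof -
  obtain p where p: "degree p < r" "F - hh a p \<in> I" using hh_rem[OF assms(1,2)] .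
  have "F - (F - hh a p) \<in> saturation I" by (intro is_idealD(5)[OF sat_ideal] assms(3) I_sub p(2))
  then have "p = 0" using p(1) assms(1) by (intro goodD) auto
  then show ?thesis using p by simp
qed

text \<open>In degree r - 2 there are only r - 1 binary monomials; a form divisible by an equation
  of the line is the r-th independent element. So the prescribed value is r already there.\<close>

lemma vdim_ge_r:
  assumes "r \<le> a + 2"
  shows "r \<le> vdim (Sdeg a :: ('n, 'k) mpoly set)"
proof (cases "r \<le> Suc a")
  case True
  then show ?thesis using vdim_Sdeg_ge[OF inf, of a] by simp
next
  case False
  then have r: "r = Suc (Suc a)" using assms by simp
  obtain a' where a': "a = Suc a'" using r r4 by (cases a) auto
  define F where "F = y 2 * y 0 ^ a'"
  have F: "F \<in> Sdeg a" unfolding F_def a'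
    using n_pos by (intro y_times_Sdeg Sdeg_power) auto
  have "F \<in> saturation I" unfolding F_def using y_sat[of 0] n_pos
    by (intro is_idealD(4)[OF sat_ideal]) (simp add: numeral_2_eq_2)
  have "eval F (pt (\<lambda>j. 1)) = 1" unfolding F_def using n_pos by simp
  then have F0: "F \<noteq> 0" by auto
  have ind: "indep_mod {0} (\<lambda>k. hh a (monom 1 k)) (Suc a)"
    using hh_indep_sat[of "Suc a" a] r is_idealD(1)[OF sat_ideal] by (auto elim!: indep_mod_mono)
  have "indep_mod {0} ((\<lambda>k. hh a (monom 1 k))(Suc a := F)) (Suc (Suc a))"
  proof (rule indep_snoc[OF subsp_zero ind])
    fix b
    show "F - (\<Sum>j<Suc a. scale (b j) (hh a (monom 1 j))) \<notin> {0}"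
    proof
      assume "F - (\<Sum>j<Suc a. scale (b j) (hh a (monom 1 j))) \<in> {0}"
      then have eq: "F = hh a (\<Sum>k<Suc a. monom (b k) k)" unfolding hh_monom_sum by simp
      have "degree (\<Sum>k<Suc a. monom (b k) k) \<le> a" by (rule degree_monom_sum) simp
      then have "(\<Sum>k<Suc a. monom (b k) k) = 0"
        using \<open>F \<in> saturation I\<close> r unfolding eq by (intro goodD) auto
      then show False using F0 eq by simp
    qed
  qed
  from indep_le_vdim[OF subsp_Sdeg subset_refl this] F r show ?thesis by (auto simp: less_Suc_eq)
qed

end

section \<open>Determinants and Stiefel coordinates\<close>

lemma polyfun_sum: "(\<And>i. i \<in> A \<Longrightarrow> (\<lambda>M. f i M) \<in> polyfun) \<Longrightarrow> (\<lambda>M. \<Sum>i\<in>A. f i M) \<in> polyfun"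
  by (induction A rule: infinite_finite_induct) (auto intro: polyfun.intros)

lemma polyfun_prod: "(\<And>i. i \<in> A \<Longrightarrow> (\<lambda>M. f i M) \<in> polyfun) \<Longrightarrow> (\<lambda>M. \<Prod>i\<in>A. f i M) \<in> polyfun"
  by (induction A rule: infinite_finite_induct) (auto intro: polyfun.intros)

lemma polyfun_uminus: "f \<in> polyfun \<Longrightarrow> (\<lambda>M. - f M) \<in> polyfun"
  using pf_mult[OF pf_const[of "- 1"]] by force

lemma polyfun_diff: "f \<in> polyfun \<Longrightarrow> g \<in> polyfun \<Longrightarrow> (\<lambda>M. f M - g M) \<in> polyfun"
  using pf_add[OF _ polyfun_uminus, of f g] by simp

lemma polyfun_det:
  assumes "\<And>i j. i < n \<Longrightarrow> j < n \<Longrightarrow> (\<lambda>M. A M i j) \<in> polyfun"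
  shows "(\<lambda>M. det (mat n n (\<lambda>(i, j). A M i j))) \<in> polyfun"
proof -
  have "det (mat n n (\<lambda>(i, j). A M i j)) = (\<Sum>p\<in>{p. p permutes {0..<n}}. signof p * (\<Prod>i=0..<n. A M i (p i)))" for M
  proof (subst det_def')
    show "(\<Sum>p\<in>{p. p permutes {0..<n}}. signof p * (\<Prod>i=0..<n. mat n n (\<lambda>(i, j). A M i j) $$ (i, p i)))
      = (\<Sum>p\<in>{p. p permutes {0..<n}}. signof p * (\<Prod>i=0..<n. A M i (p i)))"
    proof (intro sum.cong refl arg_cong2[where f = "(*)"] prod.cong)
      fix p i assume "p \<in> {p. p permutes {0..<n}}" "i \<in> {0..<n}"
      then have "p i < n" "i < n" using permutes_in_image[of p "{0..<n}" i] by auto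
      then show "mat n n (\<lambda>(i, j). A M i j) $$ (i, p i) = A M i (p i)" by simp
    qed
  qed simp
  then show ?thesis
    using permutes_in_image
    by (simp only:) (intro polyfun_sum polyfun.intros polyfun_prod assms; fastforce)
qed

lemma polyfun_on_curve:
  fixes f :: "('v \<Rightarrow> 'k::comm_ring_1) \<Rightarrow> 'k"
  assumes "f \<in> polyfun" "\<And>v. \<exists>p. \<forall>t. M t v = poly p t"
  shows "\<exists>p. \<forall>t. f (M t) = poly p t"
  using assms(1)
proof induction
  case (pf_const c)
  show ?case by (rule exI[of _ "[:c:]"]) simp
next
  case (pf_var v)
  show ?case by (rule assms(2))
next
  case (pf_add f g)
  then obtain p q where "\<forall>t. f (M t) = poly p t" "\<forall>t. g (M t) = poly q t" by blast
  then show ?case by (intro exI[of _ "p + q"]) simp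
next
  case (pf_mult f g)
  then obtain p q where "\<forall>t. f (M t) = poly p t" "\<forall>t. g (M t) = poly q t" by blast
  then show ?case by (intro exI[of _ "p * q"]) simp
qed

section \<open>Determinants of families of forms\<close>

lemma lk_sum_scale: "lk (\<Sum>j\<in>A. scale (b j) (w j)) m = (\<Sum>j\<in>A. lk (w j) m * b j)"
  by (simp add: lookup_sum mult.commute)

lemma vdim_Sdeg: "vdim (Sdeg a :: ('n::finite, 'k::field) mpoly set) = card {m :: 'n \<Rightarrow>\<^sub>0 nat. mdeg m = a}"
proof -
  let ?M = "{m :: 'n \<Rightarrow>\<^sub>0 nat. mdeg m = a}"
  obtain h where h: "bij_betw h {..<card ?M} ?M"
    using ex_bij_betw_nat_finite[OF finite_mdeg] by (auto simp: atLeast0LessThan)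
  define w :: "nat \<Rightarrow> ('n, 'k) mpoly" where "w u = Poly_Mapping.single (h u) 1" for u
  have lkw: "lk (\<Sum>u<card ?M. scale (b u) (w u)) (h v) = b v" if "v < card ?M" for b v
  proof -
    have "lk (\<Sum>u<card ?M. scale (b u) (w u)) (h v) = (\<Sum>u<card ?M. if u = v then b u else 0)"
      using that h unfolding lk_sum_scale w_def
      by (intro sum.cong) (auto simp: lookup_single when_def bij_betw_def dest: inj_onD)
    then show ?thesis using that by (simp add: sum.delta)
  qed
  have wS: "w u \<in> Sdeg a" if "u < card ?M" for u
    using h that by (auto simp: w_def bij_betw_def intro!: Sdeg_single)
  have "card ?M \<le> vdim (Sdeg a :: ('n, 'k) mpoly set)"
  proof (rule indep_le_vdim[OF subsp_Sdeg subset_refl _ wS])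
    show "indep_mod {0} w (card ?M)"
      unfolding indep_mod_def
    proof (intro allI impI)
      fix b u assume "(\<Sum>u<card ?M. scale (b u) (w u)) \<in> {0}" "u < card ?M"
      then show "b u = 0" using lkw[of u b] by simp
    qed
  qed
  moreover have "vdim (Sdeg a :: ('n, 'k) mpoly set) \<le> card ?M"
  proof (rule vdim_le_span[OF subsp_Sdeg subset_refl])
    fix F :: "('n, 'k) mpoly" assume F: "F \<in> Sdeg a"
    have "F = (\<Sum>u<card ?M. scale (lk F (h u)) (w u))" (is "F = ?G")
    proof (rule poly_mapping_eqI)
      fix m
      have G: "?G \<in> Sdeg a" by (intro Sdeg_sum Sdeg_scale wS) simp
      show "lk F m = lk ?G m"
      proof (cases "mdeg m = a")
        case True
        then have "m \<in> h ` {..<card ?M}" using h by (simp add: bij_betw_def)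
        then obtain v where v: "v < card ?M" "m = h v" by auto
        show ?thesis unfolding v(2) lkw[OF v(1), of "\<lambda>u. lk F (h u)"] ..
      next
        case False
        then have "lk F m = 0" "lk ?G m = 0" using F G unfolding Sdeg_iff by blast+
        then show ?thesis by (simp only:)
      qed
    qed
    then show "\<exists>c. F = (\<Sum>j<card ?M. scale (c j) (w j))"
      by (rule exI[of _ "\<lambda>u. lk F (h u)"])
  qed
  ultimately show ?thesis by simp
qed

definition mon :: "nat \<Rightarrow> nat \<Rightarrow> 'n::finite \<Rightarrow>\<^sub>0 nat" where
  "mon a = (SOME h. bij_betw h {..<card {m :: 'n \<Rightarrow>\<^sub>0 nat. mdeg m = a}} {m. mdeg m = a})"

lemma bij_mon: "bij_betw (mon a) {..<card {m :: 'n::finite \<Rightarrow>\<^sub>0 nat. mdeg m = a}} {m :: 'n \<Rightarrow>\<^sub>0 nat. mdeg m = a}"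
proof -
  have "\<exists>h. bij_betw h {..<card {m :: 'n \<Rightarrow>\<^sub>0 nat. mdeg m = a}} {m :: 'n \<Rightarrow>\<^sub>0 nat. mdeg m = a}"
    using ex_bij_betw_nat_finite[OF finite_mdeg[of a, where 'n = 'n]] by (simp add: atLeast0LessThan)
  then show ?thesis unfolding mon_def by (rule someI_ex)
qed

definition fdet :: "nat \<Rightarrow> (nat \<Rightarrow> ('n::finite, 'k::field) mpoly) \<Rightarrow> 'k" where
  "fdet a w = det (mat (vdim (Sdeg a :: ('n, 'k) mpoly set)) (vdim (Sdeg a :: ('n, 'k) mpoly set))
     (\<lambda>(i, j). lk (w j) (mon a i)))"

lemma polyfun_fdet:
  fixes w :: "('v \<Rightarrow> 'k::field) \<Rightarrow> nat \<Rightarrow> ('n::finite, 'k) mpoly"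
  assumes "\<And>j m. (\<lambda>M. lk (w M j) m) \<in> polyfun"
  shows "(\<lambda>M. fdet a (w M)) \<in> polyfun"
  unfolding fdet_def by (rule polyfun_det) (rule assms)

lemma fdet_mult_vec:
  fixes w :: "nat \<Rightarrow> ('n::finite, 'k::field) mpoly" and a :: nat
  defines "s \<equiv> vdim (Sdeg a :: ('n, 'k) mpoly set)"
  shows "mat s s (\<lambda>(i, j). lk (w j) (mon a i)) *\<^sub>v vec s b
    = vec s (\<lambda>i. lk (\<Sum>j<s. scale (b j) (w j)) (mon a i))"
  by (rule eq_vecI) (auto simp: scalar_prod_def lk_sum_scale atLeast0LessThan)

text \<open>Cramer's rule: the quotient of the two determinants is the coordinate of
  \<open>F\<close> at \<open>w k\<close>. This turns coordinates into polynomial functions after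
  clearing the denominator.\<close>

lemma fdet_cramer:
  fixes w :: "nat \<Rightarrow> ('n::finite, 'k::field) mpoly"
  assumes "F = (\<Sum>j<vdim (Sdeg a :: ('n, 'k) mpoly set). scale (b j) (w j))"
    "k < vdim (Sdeg a :: ('n, 'k) mpoly set)"
  shows "fdet a (w(k := F)) = b k * fdet a w"
proof -
  let ?s = "vdim (Sdeg a :: ('n, 'k) mpoly set)"
  let ?A = "mat ?s ?s (\<lambda>(i, j). lk (w j) (mon a i))"
  have "det (replace_col ?A (?A *\<^sub>v vec ?s b) k) = vec ?s b $ k * det ?A"
    by (rule cramer_lemma_mat) (use assms in auto)
  moreover have "replace_col ?A (?A *\<^sub>v vec ?s b) k = mat ?s ?s (\<lambda>(i, j). lk ((w(k := F)) j) (mon a i))"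
    unfolding fdet_mult_vec assms(1)[symmetric] replace_col_def
    by (rule eq_matI) auto
  ultimately show ?thesis using assms(2) by (simp add: fdet_def)
qed

text \<open>The kernel of the coordinate matrix consists exactly of the linear relations of the
  family.\<close>

lemma fdet_nonzero_iff:
  fixes w :: "nat \<Rightarrow> ('n::finite, 'k::field) mpoly"
  assumes "\<And>j. j < vdim (Sdeg a :: ('n, 'k) mpoly set) \<Longrightarrow> w j \<in> Sdeg a"
  shows "fdet a w \<noteq> 0 \<longleftrightarrow> indep_mod {0} w (vdim (Sdeg a :: ('n, 'k) mpoly set))"
proof -
  let ?s = "vdim (Sdeg a :: ('n, 'k) mpoly set)"
  let ?A = "mat ?s ?s (\<lambda>(i, j). lk (w j) (mon a i))"
  have zero: "?A *\<^sub>v vec ?s b = 0\<^sub>v ?s \<longleftrightarrow> (\<Sum>j<?s. scale (b j) (w j)) = 0" for b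
  proof
    assume "?A *\<^sub>v vec ?s b = 0\<^sub>v ?s"
    then have "vec ?s (\<lambda>i. lk (\<Sum>j<?s. scale (b j) (w j)) (mon a i)) = 0\<^sub>v ?s"
      unfolding fdet_mult_vec .
    then have z: "lk (\<Sum>j<?s. scale (b j) (w j)) (mon a i) = 0" if "i < ?s" for i
    proof -
      have "vec ?s (\<lambda>i. lk (\<Sum>j<?s. scale (b j) (w j)) (mon a i)) $ i = 0\<^sub>v ?s $ i"
        using \<open>vec ?s _ = _\<close> by (rule arg_cong)
      then show ?thesis using that by simp
    qed
    have S: "(\<Sum>j<?s. scale (b j) (w j)) \<in> Sdeg a" by (intro Sdeg_sum Sdeg_scale assms) simp
    show "(\<Sum>j<?s. scale (b j) (w j)) = 0"
    proof (rule poly_mapping_eqI)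
      fix m
      show "lk (\<Sum>j<?s. scale (b j) (w j)) m = lk 0 m"
      proof (cases "mdeg m = a")
        case True
        then have "m \<in> mon a ` {..<?s}" using bij_mon[of a, where 'n = 'n] unfolding vdim_Sdeg bij_betw_def by auto
        then show ?thesis using z by auto
      next
        case False
        then show ?thesis using S by (auto simp: Sdeg_iff)
      qed
    qed
  next
    assume "(\<Sum>j<?s. scale (b j) (w j)) = 0"
    then show "?A *\<^sub>v vec ?s b = 0\<^sub>v ?s" unfolding fdet_mult_vec by (intro eq_vecI) auto
  qed
  have "fdet a w = 0 \<longleftrightarrow> (\<exists>v. v \<in> carrier_vec ?s \<and> v \<noteq> 0\<^sub>v ?s \<and> ?A *\<^sub>v v = 0\<^sub>v ?s)"
    unfolding fdet_def by (rule det_0_iff_vec_prod_zero_field) simp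
  also have "\<dots> \<longleftrightarrow> (\<exists>b. (\<exists>j<?s. b j \<noteq> 0) \<and> (\<Sum>j<?s. scale (b j) (w j)) = 0)"
  proof
    assume "\<exists>v. v \<in> carrier_vec ?s \<and> v \<noteq> 0\<^sub>v ?s \<and> ?A *\<^sub>v v = 0\<^sub>v ?s"
    then obtain v where v: "v \<in> carrier_vec ?s" "v \<noteq> 0\<^sub>v ?s" "?A *\<^sub>v v = 0\<^sub>v ?s" by blast
    have "vec ?s (($) v) = v" using v(1) by (intro eq_vecI) auto
    then have "(\<Sum>j<?s. scale (v $ j) (w j)) = 0" using zero[of "($) v"] v(3) by simp
    moreover have "\<exists>j<?s. v $ j \<noteq> 0"
    proof (rule ccontr)
      assume "\<not> ?thesis"
      then have "v = 0\<^sub>v ?s" using v(1) by (intro eq_vecI) auto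
      then show False using v(2) by contradiction
    qed
    ultimately show "\<exists>b. (\<exists>j<?s. b j \<noteq> 0) \<and> (\<Sum>j<?s. scale (b j) (w j)) = 0" by (intro exI[of _ "($) v"]) simp
  next
    assume "\<exists>b. (\<exists>j<?s. b j \<noteq> 0) \<and> (\<Sum>j<?s. scale (b j) (w j)) = 0"
    then obtain b j where b: "j < ?s" "b j \<noteq> 0" "(\<Sum>j<?s. scale (b j) (w j)) = 0" by blast
    have "vec ?s b \<noteq> 0\<^sub>v ?s"
    proof
      assume "vec ?s b = 0\<^sub>v ?s"
      then have "vec ?s b $ j = 0\<^sub>v ?s $ j" by (rule arg_cong)
      then show False using b(1,2) by simp
    qed
    then show "\<exists>v. v \<in> carrier_vec ?s \<and> v \<noteq> 0\<^sub>v ?s \<and> ?A *\<^sub>v v = 0\<^sub>v ?s"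
      using zero[of b] b(3) by (intro exI[of _ "vec ?s b"]) simp
  qed
  finally show ?thesis unfolding indep_mod_def by auto
qed

section \<open>Stiefel coordinates of an ideal\<close>

lemma lk_row: "lk (Defs.row M a j) m = (if mdeg m = a then M (a, j, m) else 0)"
  by (auto simp: row_def lookup_sum lookup_single when_def sum.delta)

lemma row_Sdeg: "Defs.row M a j \<in> Sdeg a"
  by (auto simp: Sdeg_iff lk_row)

lemma polyfun_lk_row: "(\<lambda>M. lk (Defs.row M a j) m) \<in> polyfun"
  by (cases "mdeg m = a") (auto simp: lk_row intro: polyfun.intros)

lemma stiefel_rows:
  assumes "stiefel_rep N I M" "a < N"
  shows "indep_mod {0} (Defs.row M a) (vdim (comp_deg I a))"
    "F \<in> comp_deg I a \<longleftrightarrow> (\<exists>c. F = (\<Sum>j<vdim (comp_deg I a). scale (c j) (Defs.row M a j)))"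
proof -
  note st = assms(1)[unfolded stiefel_rep_def, THEN conjunct2, THEN spec, THEN mp, OF assms(2)]
  show "indep_mod {0} (Defs.row M a) (vdim (comp_deg I a))"
    using st[THEN conjunct1] unfolding indep_mod_def by blast
  show "F \<in> comp_deg I a \<longleftrightarrow> (\<exists>c. F = (\<Sum>j<vdim (comp_deg I a). scale (c j) (Defs.row M a j)))"
    using eqset_imp_iff[OF st[THEN conjunct2], of F] by blast
qed

lemma stiefel_row_mem:
  assumes "stiefel_rep N I M" "a < N" "j < vdim (comp_deg I a)"
  shows "Defs.row M a j \<in> comp_deg I a"
proof -
  have "Defs.row M a j = (\<Sum>i<vdim (comp_deg I a). scale (if i = j then 1 else 0) (Defs.row M a i))"
    using assms(3) by (simp add: if_distrib[of "\<lambda>c. scale c _"] sum.delta' cong: if_cong)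
  then show ?thesis
    unfolding stiefel_rows(2)[OF assms(1,2)] by (rule exI[of _ "\<lambda>i. if i = j then 1 else 0"])
qed

lemma stiefel_repI:
  fixes v :: "nat \<Rightarrow> nat \<Rightarrow> ('n::finite, 'k::field) mpoly"
  assumes I: "is_ideal I"
    and M: "\<And>a j m. M (a, j, m) = (if a < N \<and> j < vdim (comp_deg I a) \<and> mdeg m = a then lk (v a j) m else 0)"
    and v: "\<And>a. a < N \<Longrightarrow> indep_mod {0} (v a) (vdim (comp_deg I a))"
      "\<And>a j. a < N \<Longrightarrow> j < vdim (comp_deg I a) \<Longrightarrow> v a j \<in> comp_deg I a"
  shows "stiefel_rep N I M"
proof -
  have row: "Defs.row M a j = v a j" if "a < N" "j < vdim (comp_deg I a)" for a j
  proof (rule poly_mapping_eqI)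
    fix m
    show "lk (Defs.row M a j) m = lk (v a j) m"
      using v(2)[OF that] that by (auto simp: lk_row M comp_deg_def Sdeg_iff)
  qed
  have sum_row: "(\<Sum>j<vdim (comp_deg I a). scale (c j) (Defs.row M a j)) = (\<Sum>j<vdim (comp_deg I a). scale (c j) (v a j))"
    if "a < N" for a c
    by (intro sum.cong refl) (simp add: row[OF that])
  have eq: "comp_deg I a = {\<Sum>j<vdim (comp_deg I a). scale (c j) (Defs.row M a j) |c. True}" if a: "a < N" for a
    unfolding sum_row[OF a]
  proof (intro equalityI subsetI)
    fix F assume "F \<in> comp_deg I a"
    from indep_span[OF subsp_comp_deg[OF I] comp_deg_subset v(1)[OF a] v(2)[OF a] this]
    show "F \<in> {\<Sum>j<vdim (comp_deg I a). scale (c j) (v a j) |c. True}" by blast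
  next
    fix F assume "F \<in> {\<Sum>j<vdim (comp_deg I a). scale (c j) (v a j) |c. True}"
    then obtain c where F: "F = (\<Sum>j<vdim (comp_deg I a). scale (c j) (v a j))" by blast
    show "F \<in> comp_deg I a"
      unfolding F by (intro subspD(4,5)[OF subsp_comp_deg[OF I]] v(2)[OF a]) simp
  qed
  have ind: "\<forall>c. (\<Sum>j<vdim (comp_deg I a). scale (c j) (Defs.row M a j)) = 0 \<longrightarrow> (\<forall>j<vdim (comp_deg I a). c j = 0)"
    if "a < N" for a
    using v(1)[OF that] unfolding sum_row[OF that] indep_mod_def by blast
  have zero: "\<forall>a j m. N \<le> a \<or> vdim (comp_deg I a) \<le> j \<or> mdeg m \<noteq> a \<longrightarrow> M (a, j, m) = 0"
    by (auto simp: M)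
  show ?thesis
    unfolding stiefel_rep_def using zero ind eq by blast
qed

lemma stiefel_exists:
  assumes "is_ideal (I :: ('n::finite, 'k::field) mpoly set)"
  shows "\<exists>M. stiefel_rep N I M"
proof -
  have "\<forall>a. \<exists>v. indep_mod {0} v (vdim (comp_deg I a)) \<and> (\<forall>j<vdim (comp_deg I a). v j \<in> comp_deg I a)"
  proof
    fix a
    show "\<exists>v. indep_mod {0} v (vdim (comp_deg I a)) \<and> (\<forall>j<vdim (comp_deg I a). v j \<in> comp_deg I a)"
      by (rule basis_family[OF subsp_comp_deg[OF assms, of a] comp_deg_subset[of I a]]) blast
  qed
  from choice[OF this] obtain v where v: "\<forall>a. indep_mod {0} (v a) (vdim (comp_deg I a)) \<and>
    (\<forall>j<vdim (comp_deg I a). v a j \<in> comp_deg I a)" ..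
  show ?thesis
    by (rule exI, rule stiefel_repI[OF assms, where v = v and
      M = "\<lambda>(a, j, m). if a < N \<and> j < vdim (comp_deg I a) \<and> mdeg m = a then lk (v a j) m else 0"])
      (use v in auto)
qed

section \<open>The residue functional of a monic polynomial\<close>

text \<open>For monic \<open>g\<close> this is the sum of the residues of f/g; with distinct roots
  it is the sum of f(xi)/g'(xi), the linear relation between the values at the roots that all
  polynomials of degree at most r - 2 satisfy.\<close>

definition lam :: "'k::field poly \<Rightarrow> 'k poly \<Rightarrow> 'k" where
  "lam g f = coeff (f mod g) (degree g - 1)"

lemma lam_add: "lam g (p + q) = lam g p + lam g q"
  by (simp add: lam_def poly_mod_add_left)

lemma lam_smult: "lam g (smult c p) = c * lam g p"
  by (simp add: lam_def mod_smult_left)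

lemma lam_0 [simp]: "lam g 0 = 0"
  by (simp add: lam_def)

lemma lam_sum: "lam g (sum f A) = (\<Sum>i\<in>A. lam g (f i))"
  by (induction A rule: infinite_finite_induct) (auto simp: lam_add)

lemma lam_mod_eq: "p mod g = q mod g \<Longrightarrow> lam g p = lam g q"
  by (simp add: lam_def)

lemma lam_low: "degree p < degree g \<Longrightarrow> lam g p = coeff p (degree g - 1)"
  by (simp add: lam_def mod_poly_less)

lemma lam_monom_mult: "lam g (monom c b * f) = c * lam g (monom 1 b * f)"
proof -
  have "monom c b * f = smult c (monom 1 b * f)" by (simp add: smult_monom flip: mult_smult_left)
  then show ?thesis by (simp only: lam_smult)
qed

text \<open>The tails of g form, up to order, the basis dual to the monomials for the
  pairing (p, q) \<mapsto> lam g (p * q).\<close>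

lemma lam_tail_monom:
  fixes g :: "'k::field poly"
  assumes g: "degree g = r" "coeff g r = 1" and "k < r" "i < r"
  shows "lam g ((\<Sum>b\<le>r - 1 - k. monom (coeff g (k + 1 + b)) b) * monom 1 i) = (if i = k then 1 else 0)"
proof -
  define T where "T = (\<Sum>b\<le>r - 1 - k. monom (coeff g (k + 1 + b)) b)"
  have cT: "coeff T b = (if b \<le> r - 1 - k then coeff g (k + 1 + b) else 0)" for b
    by (simp add: T_def coeff_sum sum.delta)
  have dT: "degree T \<le> r - 1 - k" by (rule degree_le) (simp add: cT)
  have "lam g (T * monom 1 i) = (if i = k then 1 else 0)"
  proof (cases "i \<le> k")
    case True
    have "degree (T * monom 1 i) \<le> (r - 1 - k) + i"
      by (rule order_trans[OF degree_mult_le] add_mono dT degree_monom_le)+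
    then have "degree (T * monom 1 i) < degree g" using True assms by simp
    then have "lam g (T * monom 1 i) = coeff T (r - 1 - i)"
      using assms by (simp add: lam_low mult.commute[of T] coeff_monom_mult)
    also have "\<dots> = (if i = k then 1 else 0)"
      using True assms by (auto simp: cT)
    finally show ?thesis .
  next
    case False
    \<comment> \<open>The tail times x^(k + 1) is \<open>g\<close> minus its lower part. For i > k
      the product is therefore congruent to a polynomial of degree below r - 1, on which the
      functional vanishes.\<close>
    define low where "low = (\<Sum>j\<le>k. monom (coeff g j) j)"
    have clow: "coeff low j = (if j \<le> k then coeff g j else 0)" for j
      by (simp add: low_def coeff_sum sum.delta)
    have "g = T * monom 1 (k + 1) + low"
    proof (rule poly_eqI)
      fix j
      show "coeff g j = coeff (T * monom 1 (k + 1) + low) j"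
        using assms by (auto simp: mult.commute[of T] coeff_monom_mult cT clow coeff_eq_0)
    qed
    moreover have "monom 1 i = monom 1 (k + 1) * monom (1 :: 'k) (i - k - 1)"
      using False by (simp add: mult_monom)
    ultimately have "T * monom 1 i = g * monom 1 (i - k - 1) - low * monom 1 (i - k - 1)"
      by (simp add: algebra_simps)
    then have "(T * monom 1 i) mod g = (- (low * monom 1 (i - k - 1))) mod g"
      by (simp add: poly_mod_diff_left)
    then have "lam g (T * monom 1 i) = lam g (- (low * monom 1 (i - k - 1)))" by (rule lam_mod_eq)
    moreover have dl: "degree low \<le> k" by (rule degree_le) (simp add: clow)
    have "degree (low * monom 1 (i - k - 1)) \<le> k + (i - k - 1)"
      by (rule order_trans[OF degree_mult_le] add_mono dl degree_monom_le)+
    then have "degree (low * monom 1 (i - k - 1)) < r - 1" using False assms by simp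
    then have "lam g (- (low * monom 1 (i - k - 1))) = 0"
      using assms by (subst lam_low) (auto simp: coeff_eq_0)
    ultimately show ?thesis using False by simp
  qed
  then show ?thesis by (simp add: T_def)
qed

lemma poly_as_monom_sum: "degree f < r \<Longrightarrow> f = (\<Sum>i<r. monom (coeff f i) i)"
  by (rule poly_eqI) (auto simp: coeff_sum sum.delta coeff_eq_0)

text \<open>Pairing with the tail of \<open>g\<close> after position \<open>k\<close> extracts the
  coefficient at \<open>k\<close>; expanding the tail gives the formula.\<close>

lemma coeff_eq_lam:
  fixes g :: "'k::field poly"
  assumes g: "degree g = r" "coeff g r = 1" and "k < r" "degree f < r"
  shows "coeff f k = (\<Sum>b\<le>r - 1 - k. coeff g (k + 1 + b) * lam g (monom 1 b * f))"
proof -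
  define T where "T = (\<Sum>b\<le>r - 1 - k. monom (coeff g (k + 1 + b)) b)"
  have "lam g (T * f) = (\<Sum>b\<le>r - 1 - k. coeff g (k + 1 + b) * lam g (monom 1 b * f))"
    unfolding T_def sum_distrib_right lam_sum lam_monom_mult[of g "coeff g _"] ..
  moreover have "lam g (T * f) = coeff f k"
  proof -
  have "lam g (T * f) = (\<Sum>i<r. lam g (monom (coeff f i) i * T))"
    by (subst poly_as_monom_sum[OF assms(4)]) (simp add: sum_distrib_left lam_sum mult.commute)
  also have "\<dots> = (\<Sum>i<r. coeff f i * (if i = k then 1 else 0))"
  proof (intro sum.cong refl)
    fix i assume "i \<in> {..<r}"
    then have "lam g (T * monom 1 i) = (if i = k then 1 else 0)"
      unfolding T_def by (intro lam_tail_monom[OF g assms(3)]) simp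
    then show "lam g (monom (coeff f i) i * T) = coeff f i * (if i = k then 1 else 0)"
      by (simp only: lam_monom_mult[of g "coeff f i"] mult.commute[of "monom 1 i"])
  qed
  also have "\<dots> = coeff f k" using assms(3) by (simp add: if_distrib[of "(*) _"] sum.delta cong: if_cong)
  finally show ?thesis .
  qed
  ultimately show ?thesis by simp
qed

text \<open>Only the coefficients with k >= 2 are rewritten. Then b <= r - 3, so x^b P is the trace
  of a form of degree r - 2 when \<open>P\<close> is the trace of a linear form.\<close>

lemma lam_product:
  fixes g :: "'k::field poly"
  assumes g: "degree g = r" "coeff g r = 1" and "degree P < r" "2 \<le> r"
  shows "lam g (P * Q) = coeff P 0 * lam g Q + coeff P 1 * lam g (monom 1 1 * Q) +
    (\<Sum>k=2..<r. \<Sum>b\<le>r - 1 - k. coeff g (k + 1 + b) * lam g (monom 1 b * P) * lam g (monom 1 k * Q))"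
proof -
  have "lam g (P * Q) = (\<Sum>k<r. coeff P k * lam g (monom 1 k * Q))"
    by (subst poly_as_monom_sum[OF assms(3)]) (simp add: sum_distrib_right lam_sum lam_monom_mult[of g "coeff P _"])
  also have "{..<r} = {0, 1} \<union> {2..<r}" using assms(4) by auto
  also have "(\<Sum>k\<in>{0, 1} \<union> {2..<r}. coeff P k * lam g (monom 1 k * Q))
    = coeff P 0 * lam g (monom 1 0 * Q) + coeff P 1 * lam g (monom 1 1 * Q) + (\<Sum>k=2..<r. coeff P k * lam g (monom 1 k * Q))"
    by (subst sum.union_disjoint) auto
  also have "(\<Sum>k=2..<r. coeff P k * lam g (monom 1 k * Q))
    = (\<Sum>k=2..<r. \<Sum>b\<le>r - 1 - k. coeff g (k + 1 + b) * lam g (monom 1 b * P) * lam g (monom 1 k * Q))"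
    by (intro sum.cong refl) (simp add: coeff_eq_lam[OF g _ assms(3)] sum_distrib_right)
  finally show ?thesis by (simp add: monom_0 one_pCons[symmetric])
qed

section \<open>The necessary condition\<close>

text \<open>Stated over domains because it is applied twice: over the field to the points of a set,
  and over k[t] to nodes moving with t.\<close>

lemma prod_linear_dvd:
  fixes f :: "'a::idom poly"
  assumes "finite X" "inj_on \<xi> X" "\<And>x. x \<in> X \<Longrightarrow> poly f (\<xi> x) = 0"
  shows "(\<Prod>x\<in>X. [:- \<xi> x, 1:]) dvd f"
  using assms
proof (induction X arbitrary: f rule: finite_induct)
  case (insert x X)
  obtain f' where f': "f = [:- \<xi> x, 1:] * f'" using insert.prems(2)[of x] by (auto simp: poly_eq_0_iff_dvd dvd_def)
  have "poly f' (\<xi> x') = 0" if "x' \<in> X" for x'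
  proof -
    have "\<xi> x' \<noteq> \<xi> x" using insert that by (auto simp: inj_on_def)
    then show ?thesis using insert.prems(2)[of x'] that unfolding f' by simp
  qed
  then have "(\<Prod>x\<in>X. [:- \<xi> x, 1:]) dvd f'" using insert by (intro insert.IH) auto
  then have "[:- \<xi> x, 1:] * (\<Prod>x\<in>X. [:- \<xi> x, 1:]) dvd [:- \<xi> x, 1:] * f'" by (rule mult_dvd_mono[OF dvd_refl])
  then show ?case using insert by (simp add: f')
qed simp

lemma degree_prod_linear:
  fixes \<xi> :: "'b \<Rightarrow> 'a::idom"
  shows "degree (\<Prod>x\<in>X. [:- \<xi> x, 1:]) = card X" "lead_coeff (\<Prod>x\<in>X. [:- \<xi> x, 1:]) = 1"
proof -
  show "degree (\<Prod>x\<in>X. [:- \<xi> x, 1:]) = card X"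
    by (cases "finite X") (simp_all add: degree_prod_eq_sum_degree)
  show "lead_coeff (\<Prod>x\<in>X. [:- \<xi> x, 1:]) = 1"
    by (simp add: lead_coeff_prod)
qed

lemma poly_prod_linear_eq_0:
  fixes \<xi> :: "'b \<Rightarrow> 'a::idom"
  shows "finite X \<Longrightarrow> x \<in> X \<Longrightarrow> poly (\<Prod>x\<in>X. [:- \<xi> x, 1:]) (\<xi> x) = 0"
  by (auto simp: poly_prod)

context coords
begin

text \<open>For a = r - 2 the last entry homogenizes x^(r - 1) and is 0 by truncation. That slot is
  then free: \<open>Ecoef r (r - 2) (r - 1) F\<close> puts \<open>F\<close> there, next to the rows
  and the r - 1 binary monomials, and so tests membership in their span.\<close>

definition zrows :: "nat \<Rightarrow> nat \<Rightarrow> (nat \<times> nat \<times> ('n \<Rightarrow>\<^sub>0 nat) \<Rightarrow> 'k) \<Rightarrow> nat \<Rightarrow> ('n, 'k) mpoly" where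
  "zrows r a M j = (let d = vdim (Sdeg a :: ('n, 'k) mpoly set) - r
    in if j < d then Defs.row M a j else hh a (monom 1 (j - d)))"

text \<open>By Cramer's rule, the quotient of Ecoef r a k F and Edet r a is the coefficient of F at
  z_0^(a - k) z_1^k modulo the ideal represented by M.\<close>

definition Edet :: "nat \<Rightarrow> nat \<Rightarrow> (nat \<times> nat \<times> ('n \<Rightarrow>\<^sub>0 nat) \<Rightarrow> 'k) \<Rightarrow> 'k" where
  "Edet r a M = fdet a (zrows r a M)"

definition Ecoef :: "nat \<Rightarrow> nat \<Rightarrow> nat \<Rightarrow> ('n, 'k) mpoly \<Rightarrow> (nat \<times> nat \<times> ('n \<Rightarrow>\<^sub>0 nat) \<Rightarrow> 'k) \<Rightarrow> 'k" where
  "Ecoef r a k F M = fdet a ((zrows r a M)(vdim (Sdeg a :: ('n, 'k) mpoly set) - r + k := F))"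

lemma zrows_Sdeg: "zrows r a M j \<in> Sdeg a"
  by (simp add: zrows_def Let_def row_Sdeg)

lemma polyfun_lk_zrows: "(\<lambda>M. lk (zrows r a M j) m) \<in> polyfun"
  by (cases "j < vdim (Sdeg a :: ('n, 'k) mpoly set) - r")
    (simp_all add: zrows_def Let_def polyfun_lk_row pf_const)

lemma polyfun_Edet: "(\<lambda>M. Edet r a M) \<in> polyfun"
  unfolding Edet_def by (rule polyfun_fdet) (rule polyfun_lk_zrows)

lemma polyfun_Ecoef: "(\<lambda>M. Ecoef r a k F M) \<in> polyfun"
  unfolding Ecoef_def
proof (rule polyfun_fdet)
  fix j m
  show "(\<lambda>M. lk (((zrows r a M)(vdim (Sdeg a :: ('n, 'k) mpoly set) - r + k := F)) j) m) \<in> polyfun"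
    by (cases "j = vdim (Sdeg a :: ('n, 'k) mpoly set) - r + k") (simp_all add: polyfun_lk_zrows pf_const)
qed

lemma zrows_sum:
  assumes "r \<le> vdim (Sdeg a :: ('n, 'k) mpoly set)"
  defines "d \<equiv> vdim (Sdeg a :: ('n, 'k) mpoly set) - r"
  shows "(\<Sum>j<vdim (Sdeg a :: ('n, 'k) mpoly set). scale (b j) (zrows r a M j))
    = (\<Sum>j<d. scale (b j) (Defs.row M a j)) + hh a (\<Sum>k<r. monom (b (d + k)) k)"
proof -
  have s: "vdim (Sdeg a :: ('n, 'k) mpoly set) = d + r" using assms by simp
  have "(\<Sum>j<d + r. scale (b j) (zrows r a M j)) = (\<Sum>j<d. scale (b j) (zrows r a M j)) + (\<Sum>k<r. scale (b (d + k)) (zrows r a M (d + k)))"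
    by (rule sum_lessThan_add)
  also have "(\<Sum>j<d. scale (b j) (zrows r a M j)) = (\<Sum>j<d. scale (b j) (Defs.row M a j))"
    by (intro sum.cong refl) (simp add: zrows_def d_def)
  also have "(\<Sum>k<r. scale (b (d + k)) (zrows r a M (d + k))) = (\<Sum>k<r. hh a (monom (b (d + k)) k))"
    by (intro sum.cong refl) (simp add: zrows_def d_def[symmetric] smult_monom flip: hz_smult)
  finally show ?thesis unfolding s hz_sum .
qed

text \<open>A combination is split into rows, binary part and the form in the last slot; this is the
  shape needed in degree r - 2.\<close>

lemma zrows_upd_sum:
  fixes e :: "nat \<Rightarrow> 'k"
  assumes "1 \<le> r" "r \<le> vdim (Sdeg a :: ('n, 'k) mpoly set)"
  defines "d \<equiv> vdim (Sdeg a :: ('n, 'k) mpoly set) - r"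
  shows "(\<Sum>j<vdim (Sdeg a :: ('n, 'k) mpoly set). scale (e j) (((zrows r a M)(d + (r - 1) := F0)) j))
    = (\<Sum>j<d. scale (e j) (Defs.row M a j)) + hh a (\<Sum>k<r - 1. monom (e (d + k)) k) + scale (e (d + (r - 1))) F0"
proof -
  let ?s = "vdim (Sdeg a :: ('n, 'k) mpoly set)"
  obtain r' where r': "r = Suc r'" using assms(1) by (cases r) auto
  have s: "?s = Suc (d + r')" using assms r' by simp
  define e' where "e' = e(d + r' := 0)"
  have e': "e' j = e j" if "j < d + r'" for j unfolding e'_def by (rule fun_upd_other) (rule less_imp_neq[OF that])
  have e'L: "e' (d + r') = 0" by (simp only: e'_def fun_upd_same)
  have "(\<Sum>j<?s. scale (e j) (((zrows r a M)(d + r' := F0)) j))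
    = (\<Sum>j<d + r'. scale (e j) (zrows r a M j)) + scale (e (d + r')) F0"
    unfolding s by simp
  also have "(\<Sum>j<d + r'. scale (e j) (zrows r a M j)) = (\<Sum>j<?s. scale (e' j) (zrows r a M j))"
    unfolding s using e' e'L by simp
  also have "\<dots> = (\<Sum>j<d. scale (e' j) (Defs.row M a j)) + hh a (\<Sum>k<Suc r'. monom (e' (d + k)) k)"
    using zrows_sum[OF assms(2), of e' M] unfolding d_def[symmetric] by (simp only: r')
  also have "\<dots> = (\<Sum>j<d. scale (e j) (Defs.row M a j)) + hh a (\<Sum>k<r'. monom (e (d + k)) k)"
    using e' e'L by simp
  finally show ?thesis by (simp only: r' diff_Suc_1)
qed

text \<open>Where z0 = 0 only the pure power of z1 survives, and a polynomial of degree below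
  \<open>a\<close> has coefficient 0 there.\<close>

lemma eval_hz_at_infinity:
  assumes "eval z0 x = 0" "degree p < a"
  shows "eval (hz z0 z1 a p) x = 0"
proof -
  have "eval (scale (coeff p k) (z0 ^ (a - k) * z1 ^ k)) x = 0" if "k \<le> a" for k
    using that assms by (cases "k = a") (simp_all add: coeff_eq_0)
  then show ?thesis unfolding hz_def eval_sum by (intro sum.neutral) simp
qed

end

text \<open>A point set in the open chart around I. Nonvanishing of \<open>Edet\<close> in the large
  degree \<open>D\<close> says that 1, x, ..., x^(r - 1) represent a basis modulo the ideal of the
  points, so that the points form a graph over r distinct values of x. \<open>s_ge\<close> is
  supplied from the geometry of I.\<close>

locale point_chart = coords y n c
  for y :: "nat \<Rightarrow> ('n::finite, 'k::field) mpoly" and n c +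
  fixes X :: "('n \<Rightarrow> 'k) set" and r D N :: nat and M :: "nat \<times> nat \<times> ('n \<Rightarrow>\<^sub>0 nat) \<Rightarrow> 'k"
  assumes X: "distinct_proj_points r X"
    and codimX: "vdim (Sdeg a :: ('n, 'k) mpoly set) - vdim (comp_deg (points_ideal X) a) = min (vdim (Sdeg a :: ('n, 'k) mpoly set)) r"
    and st: "stiefel_rep N (points_ideal X) M"
    and D: "2 * r \<le> D" "D < N" and r4: "4 \<le> r"
    and s_ge: "r \<le> a + 2 \<Longrightarrow> r \<le> vdim (Sdeg a :: ('n, 'k) mpoly set)"
    and E_nz: "Edet r D M \<noteq> 0"
begin

lemma finX: "finite X" and cardX: "card X = r"
  using X by (auto simp: distinct_proj_points_def)

lemma vdim_J:
  assumes "r \<le> a + 2"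
  shows "vdim (comp_deg (points_ideal X) a) = vdim (Sdeg a :: ('n, 'k) mpoly set) - r"
proof -
  have "is_ideal (points_ideal X)" by (simp add: points_ideal_def is_ideal_ideal_gen)
  then have "vdim (comp_deg (points_ideal X) a) \<le> vdim (Sdeg a :: ('n, 'k) mpoly set)"
    by (intro vdim_le[OF subsp_comp_deg subsp_Sdeg comp_deg_subset subset_refl])
  then show ?thesis using codimX[of a] s_ge[OF assms] by simp
qed

lemma row_vanish:
  assumes "r \<le> a + 2" "a < N" "j < vdim (Sdeg a :: ('n, 'k) mpoly set) - r" "x \<in> X"
  shows "eval (Defs.row M a j) x = 0"
proof -
  have "Defs.row M a j \<in> comp_deg (points_ideal X) a"
    by (rule stiefel_row_mem[OF st assms(2)]) (use assms(3) vdim_J[OF assms(1)] in simp)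
  then show ?thesis using assms(4) unfolding comp_deg_points_ideal by blast
qed

lemma vanish_span:
  assumes "r \<le> a + 2" "a < N" "F \<in> Sdeg a" "\<And>x. x \<in> X \<Longrightarrow> eval F x = 0"
  shows "\<exists>b. F = (\<Sum>j<vdim (Sdeg a :: ('n, 'k) mpoly set) - r. scale (b j) (Defs.row M a j))"
proof -
  have "F \<in> comp_deg (points_ideal X) a" using assms by (simp add: comp_deg_points_ideal)
  then show ?thesis using stiefel_rows(2)[OF st assms(2)] vdim_J[OF assms(1)] by simp
qed

lemma zrows_indep: "indep_mod {0} (zrows r D M) (vdim (Sdeg D :: ('n, 'k) mpoly set))"
  using E_nz fdet_nonzero_iff[of D "zrows r D M"] zrows_Sdeg by (simp add: Edet_def)

lemma rD: "r \<le> D + 2" "r \<le> vdim (Sdeg D :: ('n, 'k) mpoly set)"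
  using D s_ge[of D] by auto

lemma degree_tail: "degree (\<Sum>k<r. monom (b k) k :: 'k poly) < r"
  by (rule le_less_trans[OF degree_sum_le[of _ _ "r - 1"]])
    (use r4 in \<open>auto intro: order_trans[OF degree_monom_le]\<close>)

lemma zrows_span:
  assumes "F \<in> Sdeg D"
  obtains b p where "degree p < r" "F = (\<Sum>j<vdim (Sdeg D :: ('n, 'k) mpoly set) - r. scale (b j) (Defs.row M D j)) + hh D p"
proof -
  have "\<exists>b. F = (\<Sum>j<vdim (Sdeg D :: ('n, 'k) mpoly set). scale (b j) (zrows r D M j))"
    by (rule indep_span[OF subsp_Sdeg subset_refl zrows_indep zrows_Sdeg assms])
  then obtain b where b: "F = (\<Sum>j<vdim (Sdeg D :: ('n, 'k) mpoly set). scale (b j) (zrows r D M j))" ..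
  show ?thesis
    by (rule that[OF degree_tail]) (rule b[unfolded zrows_sum[OF rD(2)]])
qed

lemma eval_row_sum:
  "x \<in> X \<Longrightarrow> eval (\<Sum>j<vdim (Sdeg D :: ('n, 'k) mpoly set) - r. scale (b j) (Defs.row M D j)) x = 0"
  using row_vanish[OF rD(1) D(2)] by (simp add: eval_sum)

text \<open>At a point with z0 = 0 the rows and all the binary forms of the basis vanish, hence
  every form of degree \<open>D\<close>, including the power of a nonzero coordinate.\<close>

lemma z0_nz:
  assumes "x \<in> X"
  shows "eval (y 0) x \<noteq> 0"
proof
  assume z: "eval (y 0) x = 0"
  obtain i where i: "x i \<noteq> 0" using X assms by (auto simp: distinct_proj_points_def)
  obtain b p where p: "degree p < r" "var i ^ D = (\<Sum>j<vdim (Sdeg D :: ('n, 'k) mpoly set) - r. scale (b j) (Defs.row M D j)) + hh D p"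
    by (rule zrows_span[OF Sdeg_power[OF Sdeg_var]])
  have "eval (hh D p) x = 0" by (rule eval_hz_at_infinity[OF z]) (use p D in simp)
  then have "eval (var i ^ D) x = 0" unfolding p(2) using eval_row_sum[OF assms] by simp
  then show False using i by simp
qed

definition \<xi> :: "('n \<Rightarrow> 'k) \<Rightarrow> 'k" where "\<xi> x = eval (y 1) x / eval (y 0) x"

definition g :: "'k poly" where "g = (\<Prod>x\<in>X. [:- \<xi> x, 1:])"

text \<open>\<open>q\<close> is the trace of \<open>F\<close> in the affine coordinate. A relation
  rather than a function, because \<open>q\<close> is determined only modulo
  \<open>g\<close>.\<close>

definition rep :: "nat \<Rightarrow> ('n, 'k) mpoly \<Rightarrow> 'k poly \<Rightarrow> bool" where
  "rep a F q \<longleftrightarrow> (\<forall>x\<in>X. eval F x = eval (y 0) x ^ a * poly q (\<xi> x))"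

lemma g_degree: "degree g = r" "coeff g r = 1" "g \<noteq> 0"
  using degree_prod_linear[of \<xi> X] cardX r4 by (auto simp: g_def)

lemma poly_g: "x \<in> X \<Longrightarrow> poly g (\<xi> x) = 0"
  unfolding g_def by (rule poly_prod_linear_eq_0[OF finX])

lemma rep_hh:
  assumes "degree p \<le> a"
  shows "rep a (hh a p) p"
  unfolding rep_def
proof
  fix x assume x: "x \<in> X"
  have "poly p (\<xi> x) = (\<Sum>k\<le>a. coeff p k * \<xi> x ^ k)"
    unfolding poly_altdef by (rule sum.mono_neutral_left) (use assms in \<open>auto simp: coeff_eq_0\<close>)
  moreover have "eval (hh a p) x = (\<Sum>k\<le>a. eval (y 0) x ^ a * (coeff p k * \<xi> x ^ k))"
    unfolding hz_def eval_sum
    by (intro sum.cong refl) (use z0_nz[OF x] in \<open>simp add: \<xi>_def power_divide power_diff\<close>)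
  ultimately show "eval (hh a p) x = eval (y 0) x ^ a * poly p (\<xi> x)" by (simp add: sum_distrib_left)
qed

lemma rep_mult: "rep a F q \<Longrightarrow> rep b G q' \<Longrightarrow> rep (a + b) (F * G) (q * q')"
  by (auto simp: rep_def power_add)

lemma rep_shift: "rep a F q \<Longrightarrow> a + i + j = b \<Longrightarrow> rep b (F * (y 0 ^ i * y 1 ^ j)) (monom 1 j * q)"
  using z0_nz by (auto simp: rep_def power_add poly_monom \<xi>_def power_divide)

lemma rep_add: "rep a F q \<Longrightarrow> rep a G q' \<Longrightarrow> rep a (F + G) (q + q')"
  by (auto simp: rep_def distrib_left)

lemma rep_diff: "rep a F q \<Longrightarrow> rep a G q' \<Longrightarrow> rep a (F - G) (q - q')"
  by (auto simp: rep_def right_diff_distrib)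

lemma rep_scale: "rep a F q \<Longrightarrow> rep a (scale b F) (smult b q)"
  by (auto simp: rep_def)

lemma rep_mod: "rep a F q \<Longrightarrow> rep a F (q mod g)"
proof -
  have "poly q (\<xi> x) = poly (q mod g) (\<xi> x)" if "x \<in> X" for x
    using poly_g[OF that] div_mult_mod_eq[of q g] by (metis add_0 mult_zero_right poly_add poly_mult)
  then show "rep a F q \<Longrightarrow> rep a F (q mod g)" by (simp add: rep_def)
qed

lemma degree_mod_g: "degree (q mod g) < r"
  using degree_mod_less[OF g_degree(3), of q] g_degree(1) r4 by auto

text \<open>If two values coincided, a nonzero polynomial of degree below r would vanish at all of
  them. Its homogenization would be a combination of rows, against the independence of
  \<open>zrows\<close>.\<close>

lemma inj_\<xi>: "inj_on \<xi> X"
proof (rule eq_card_imp_inj_on[OF finX], rule ccontr)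
  assume "card (\<xi> ` X) \<noteq> card X"
  then have lt: "card (\<xi> ` X) < r" using card_image_le[OF finX, of \<xi>] cardX by simp
  define p where "p = (\<Prod>t\<in>\<xi> ` X. [:- t, 1:])"
  have p: "degree p < r" "p \<noteq> 0"
    using degree_prod_linear[of "\<lambda>t. t" "\<xi> ` X"] lt by (auto simp: p_def)
  have "eval (hh D p) x = 0" if "x \<in> X" for x
  proof -
    have "poly p (\<xi> x) = 0" unfolding p_def
      using poly_prod_linear_eq_0[of "\<xi> ` X" "\<xi> x" "\<lambda>t. t"] finX that by simp
    then show ?thesis using rep_hh[of p D] p(1) D that by (simp add: rep_def)
  qed
  from vanish_span[OF rD(1) D(2) hh_Sdeg(1) this]
  obtain b where b: "hh D p = (\<Sum>j<vdim (Sdeg D :: ('n, 'k) mpoly set) - r. scale (b j) (Defs.row M D j))" by blast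
  let ?d = "vdim (Sdeg D :: ('n, 'k) mpoly set) - r"
  define e where "e j = (if j < ?d then b j else - coeff p (j - ?d))" for j
  have "(\<Sum>k<r. monom (e (?d + k)) k) = - p"
    using poly_as_monom_sum[of "- p" r] p(1) by (simp add: e_def)
  then have "(\<Sum>j<vdim (Sdeg D :: ('n, 'k) mpoly set). scale (e j) (zrows r D M j)) = hh D p + hh D (- p)"
    unfolding zrows_sum[OF rD(2)] b by (simp add: e_def)
  also have "\<dots> = 0" by (simp flip: hz_add)
  finally have "e (?d + k) = 0" if "k < r" for k
    using indep_modD[OF zrows_indep, of e "?d + k"] rD(2) that by simp
  then have "coeff p k = 0" if "k < r" for k using that by (fastforce simp: e_def)
  then have "p = 0" using p(1) by (metis leading_coeff_0_iff)
  then show False using p(2) by contradiction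
qed

lemma rep_unique:
  assumes "rep a F q" "rep a F q'"
  shows "q mod g = q' mod g"
proof -
  have "poly (q - q') (\<xi> x) = 0" if "x \<in> X" for x
    using assms that z0_nz[OF that] by (auto simp: rep_def)
  then have "g dvd q - q'" unfolding g_def by (rule prod_linear_dvd[OF finX inj_\<xi>])
  then show ?thesis by (simp add: mod_eq_dvd_iff)
qed

text \<open>The form is raised to degree \<open>D\<close> by a power of z0, reduced there, and the
  power is cancelled at each point.\<close>

lemma rep_exists:
  assumes "F \<in> Sdeg a" "a \<le> D"
  shows "\<exists>q. rep a F q"
proof -
  have "y 0 ^ (D - a) * F \<in> Sdeg ((D - a) + a)" by (intro Sdeg_mult Sdeg_power assms) simp
  then have "y 0 ^ (D - a) * F \<in> Sdeg D" using assms(2) by simp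
  then obtain b p where p: "degree p < r" "y 0 ^ (D - a) * F = (\<Sum>j<vdim (Sdeg D :: ('n, 'k) mpoly set) - r. scale (b j) (Defs.row M D j)) + hh D p"
    by (rule zrows_span)
  have "rep a F p"
    unfolding rep_def
  proof
    fix x assume x: "x \<in> X"
    have "eval (y 0) x ^ (D - a) * eval F x = eval (y 0 ^ (D - a) * F) x" by simp
    also have "\<dots> = eval (y 0) x ^ D * poly p (\<xi> x)"
      unfolding p(2) using eval_row_sum[OF x] rep_hh[of p D] p(1) D x by (simp add: rep_def)
    also have "eval (y 0) x ^ D = eval (y 0) x ^ (D - a) * eval (y 0) x ^ a"
      using assms(2) by (simp flip: power_add)
    finally show "eval F x = eval (y 0) x ^ a * poly p (\<xi> x)" using z0_nz[OF x] by simp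
  qed
  then show ?thesis ..
qed

lemma Ecoef_rep:
  assumes "F \<in> Sdeg D" "rep D F q" "k < r"
  shows "Ecoef r D k F M = coeff (q mod g) k * Edet r D M"
proof -
  let ?s = "vdim (Sdeg D :: ('n, 'k) mpoly set)"
  have dq: "degree (q mod g) < r" by (rule degree_mod_g)
  have "rep D (F - hh D (q mod g)) (q mod g - q mod g)"
    by (intro rep_diff rep_mod assms rep_hh) (use dq D in simp)
  then have "\<And>x. x \<in> X \<Longrightarrow> eval (F - hh D (q mod g)) x = 0" by (simp add: rep_def)
  from vanish_span[OF rD(1) D(2) Sdeg_diff[OF assms(1) hh_Sdeg(1)] this]
  obtain b where b: "F - hh D (q mod g) = (\<Sum>j<?s - r. scale (b j) (Defs.row M D j))" by blast
  define e where "e j = (if j < ?s - r then b j else coeff (q mod g) (j - (?s - r)))" for j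
  have "(\<Sum>k<r. monom (e (?s - r + k)) k) = q mod g"
    using poly_as_monom_sum[OF dq] by (simp add: e_def)
  then have "F = (\<Sum>j<?s. scale (e j) (zrows r D M j))"
    unfolding zrows_sum[OF rD(2)] using b by (simp add: e_def diff_eq_eq)
  from fdet_cramer[OF this, of "?s - r + k"] assms(3) rD(2)
  show ?thesis by (simp add: Ecoef_def Edet_def e_def)
qed

text \<open>Both functionals vanish on the ideal of the points and on the binary forms of degree r -
  2. If the determinant is not identically 0, these span a hyperplane, so the two are proportional.
  The factor depends on the chosen rows but not on \<open>F\<close>; it is 0 in the degenerate
  case.\<close>

lemma Ecoef_lam:
  "\<exists>\<kappa>. \<forall>F\<in>Sdeg (r - 2). \<forall>q. rep (r - 2) F q \<longrightarrow> Ecoef r (r - 2) (r - 1) F M = \<kappa> * lam g q"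
proof (cases "\<forall>F\<in>Sdeg (r - 2). Ecoef r (r - 2) (r - 1) F M = 0")
  case True
  then show ?thesis by (intro exI[of _ 0]) simp
next
  case False
  let ?a = "r - 2" let ?s = "vdim (Sdeg (r - 2) :: ('n, 'k) mpoly set)"
  have ra: "r \<le> ?a + 2" "r \<le> ?s" "?a < N" "?a \<le> D" using s_ge[of ?a] r4 D by auto
  let ?L = "?s - r + (r - 1)"
  have L: "?L < ?s" "?s = Suc ?L" using ra r4 by auto
  obtain F0 where F0: "F0 \<in> Sdeg ?a" "Ecoef r ?a (r - 1) F0 M \<noteq> 0" using False by blast
  define w where "w = (zrows r ?a M)(?L := F0)"
  have wS: "w j \<in> Sdeg ?a" for j by (simp add: w_def F0 zrows_Sdeg)
  have fw: "fdet ?a w \<noteq> 0" using F0(2) by (simp add: Ecoef_def w_def)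
  then have ind: "indep_mod {0} w ?s" using fdet_nonzero_iff[of ?a w] wS by blast
  have wsum: "(\<Sum>j<?s. scale (e j) (w j)) = (\<Sum>j<?s - r. scale (e j) (Defs.row M ?a j)) + hh ?a (\<Sum>k<r - 1. monom (e (?s - r + k)) k) + scale (e ?L) F0" for e
    unfolding w_def by (rule zrows_upd_sum) (use ra r4 in auto)
  have row0: "rep ?a (\<Sum>j<?s - r. scale (b j) (Defs.row M ?a j)) 0" for b
    using row_vanish[OF ra(1,3)] by (auto simp: rep_def eval_sum)
  have deg: "degree (\<Sum>k<r - 1. monom (b k) k :: 'k poly) \<le> ?a" for b
    by (rule degree_sum_le) (auto intro: order_trans[OF degree_monom_le])
  obtain q0 where q0: "rep ?a F0 q0" using rep_exists[OF F0(1) ra(4)] ..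
  \<comment> \<open>Otherwise the trace of \<open>F0\<close> would reduce to degree at most r - 2,
    and \<open>F0\<close> would be a combination of the other members of the basis
    \<open>w\<close>.\<close>
  have lam0: "lam g q0 \<noteq> 0"
  proof
    assume l0: "lam g q0 = 0"
    have "coeff (q0 mod g) (r - 1) = 0" using l0 by (simp add: lam_def g_degree)
    have dq: "degree (q0 mod g) \<le> ?a"
    proof (rule degree_le, intro allI impI)
      fix i assume "?a < i"
      then consider "i = r - 1" | "r \<le> i" by linarith
      then show "coeff (q0 mod g) i = 0"
        using \<open>coeff (q0 mod g) (r - 1) = 0\<close> degree_mod_g[of q0] by cases (auto simp: coeff_eq_0)
    qed
    have "rep ?a (F0 - hh ?a (q0 mod g)) (q0 mod g - q0 mod g)"
      by (intro rep_diff rep_mod q0 rep_hh dq)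
    then have "\<And>x. x \<in> X \<Longrightarrow> eval (F0 - hh ?a (q0 mod g)) x = 0" by (simp add: rep_def)
    from vanish_span[OF ra(1,3) Sdeg_diff[OF F0(1) hh_Sdeg(1)] this]
    obtain b where b: "F0 - hh ?a (q0 mod g) = (\<Sum>j<?s - r. scale (b j) (Defs.row M ?a j))" by blast
    define e where "e j = (if j < ?s - r then b j else if j - (?s - r) = r - 1 then - 1 else coeff (q0 mod g) (j - (?s - r)))" for j
    have "degree (q0 mod g) < r - 1" using dq r4 by simp
    from poly_as_monom_sum[OF this]
    have tail: "(\<Sum>k<r - 1. monom (e (?s - r + k)) k) = q0 mod g" by (simp add: e_def)
    have "(\<Sum>j<?s. scale (e j) (w j)) = (F0 - hh ?a (q0 mod g)) + hh ?a (q0 mod g) + scale (- 1) F0"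
      unfolding wsum b tail by (simp add: e_def)
    also have "\<dots> = 0" by simp
    finally have "e ?L = 0" using indep_modD[OF ind, of e ?L] L by simp
    then show False by (simp add: e_def)
  qed
  show ?thesis
  proof (intro exI ballI allI impI)
    fix F q assume F: "F \<in> Sdeg ?a" and q: "rep ?a F q"
    have "\<exists>e. F = (\<Sum>j<?s. scale (e j) (w j))"
      by (rule indep_span[OF subsp_Sdeg subset_refl ind wS F])
    then obtain e where e: "F = (\<Sum>j<?s. scale (e j) (w j))" ..
    have "fdet ?a (w(?L := F)) = e ?L * fdet ?a w" by (rule fdet_cramer[OF e L(1)])
    then have 1: "Ecoef r ?a (r - 1) F M = e ?L * Ecoef r ?a (r - 1) F0 M"
      by (simp add: Ecoef_def w_def)
    let ?p = "\<Sum>k<r - 1. monom (e (?s - r + k)) k"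
    have "rep ?a F (0 + ?p + smult (e ?L) q0)"
      unfolding e wsum by (intro rep_add row0 rep_scale q0 rep_hh deg)
    from rep_unique[OF q this] have "lam g q = lam g ?p + e ?L * lam g q0"
      by (subst lam_mod_eq) (auto simp: lam_add lam_smult)
    moreover have "lam g ?p = 0"
      using deg[of "\<lambda>k. e (?s - r + k)"] r4 by (subst lam_low) (auto simp: g_degree coeff_eq_0)
    ultimately show "Ecoef r ?a (r - 1) F M = (Ecoef r ?a (r - 1) F0 M / lam g q0) * lam g q"
      using 1 lam0 by simp
  qed
qed

text \<open>This is \<open>lam_product\<close> for the traces of \<open>l\<close> and
  \<open>v\<close>, multiplied by kappa and the square of \<open>Edet\<close>. Every term contains
  one determinant of degree r - 2, which absorbs kappa. \<open>Et m\<close> stands for minus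
  \<open>Edet\<close> times the coefficient of \<open>g\<close> at \<open>m\<close>; the leading one
  is treated apart since \<open>Ecoef\<close> reads remainders only below r.\<close>

lemma chart_identity:
  assumes l: "l \<in> Sdeg 1" and v: "v \<in> Sdeg (r - 3)"
  defines "Et \<equiv> \<lambda>m. if m = r then - Edet r D M else Ecoef r D m (1 * (y 0 ^ (D - r) * y 1 ^ r)) M"
  shows "(Edet r D M)\<^sup>2 * Ecoef r (r - 2) (r - 1) (l * v) M =
    Edet r D M * Ecoef r D 0 (l * (y 0 ^ (D - 1) * y 1 ^ 0)) M * Ecoef r (r - 2) (r - 1) (v * (y 0 ^ 1 * y 1 ^ 0)) M +
    Edet r D M * Ecoef r D 1 (l * (y 0 ^ (D - 1) * y 1 ^ 0)) M * Ecoef r (r - 2) (r - 1) (v * (y 0 ^ 0 * y 1 ^ 1)) M -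
    (\<Sum>k=2..<r. \<Sum>b\<le>r - 1 - k. Et (k + 1 + b) * Ecoef r (r - 2) (r - 1) (l * (y 0 ^ (r - 3 - b) * y 1 ^ b)) M *
       Ecoef r D (r - 1) (v * (y 0 ^ (D - (r - 3) - k) * y 1 ^ k)) M)"
proof -
  define E where "E = Edet r D M"
  have Sd: "F * (y 0 ^ i * y 1 ^ j) \<in> Sdeg b" if "F \<in> Sdeg a" "a + i + j = b" for F a i j b
    using Sdeg_mult[OF that(1) Sdeg_mult[OF Sdeg_power[OF y01_Sdeg(1), of i] Sdeg_power[OF y01_Sdeg(2), of j]]]
    unfolding that(2)[symmetric] by (simp add: add.assoc)
  obtain \<kappa> where \<kappa>: "\<And>F q. F \<in> Sdeg (r - 2) \<Longrightarrow> rep (r - 2) F q \<Longrightarrow> Ecoef r (r - 2) (r - 1) F M = \<kappa> * lam g q"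
    using Ecoef_lam by blast
  have D1: "1 \<le> D" "r - 3 \<le> D" using D r4 by auto
  obtain P0 where P0: "rep 1 l P0" using rep_exists[OF l D1(1)] ..
  define P where "P = P0 mod g"
  have P: "rep 1 l P" "degree P < r" using rep_mod[OF P0] degree_mod_g by (auto simp: P_def)
  obtain Q where Q: "rep (r - 3) v Q" using rep_exists[OF v D1(2)] ..
  have c0: "Ecoef r D k (l * (y 0 ^ (D - 1) * y 1 ^ 0)) M = coeff P k * E" if "k < r" for k
  proof -
    have a: "1 + (D - 1) + 0 = D" using D r4 by simp
    show ?thesis
      using Ecoef_rep[OF Sd[OF l a] rep_shift[OF P(1) a] that] P(2) g_degree
      by (simp add: E_def monom_0 mod_poly_less flip: one_pCons)
  qed
  have c1: "Ecoef r D (r - 1) (v * (y 0 ^ (D - (r - 3) - k) * y 1 ^ k)) M = lam g (monom 1 k * Q) * E" if "k < r" for k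
  proof -
    have a: "(r - 3) + (D - (r - 3) - k) + k = D" using D r4 that by simp
    show ?thesis
      using Ecoef_rep[OF Sd[OF v a] rep_shift[OF Q a], of "r - 1"] r4 g_degree by (simp add: E_def lam_def)
  qed
  have c2: "Et m = - coeff g m * E" if "m \<le> r" for m
  proof (cases "m = r")
    case False
    have a: "0 + (D - r) + r = D" using D by simp
    have rep1: "rep 0 1 1" by (simp add: rep_def)
    \<comment> \<open>The coefficients of \<open>g\<close> below r are those of the remainder of
      x^r, up to sign.\<close>
    have eq: "monom 1 r mod g = (monom 1 r - g) mod g" by simp
    have deg: "degree (monom 1 r - g) < degree g"
    proof (rule degree_lessI)
      show "\<forall>k\<ge>degree g. coeff (monom 1 r - g) k = 0" using g_degree by (auto simp: coeff_eq_0)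
    qed (use g_degree r4 in auto)
    have "monom 1 r mod g = monom 1 r - g" by (rule trans[OF eq mod_poly_less[OF deg]])
    then have "coeff (monom 1 r mod g) m = - coeff g m" using False by simp
    moreover have "Ecoef r D m (1 * (y 0 ^ (D - r) * y 1 ^ r)) M = coeff ((monom 1 r * 1) mod g) m * Edet r D M"
      by (rule Ecoef_rep[OF Sd[OF Sdeg_one a] rep_shift[OF rep1 a]]) (use that False in simp)
    ultimately show ?thesis using False by (simp add: Et_def E_def)
  qed (simp add: Et_def E_def g_degree)
  have d0: "Ecoef r (r - 2) (r - 1) (l * v) M = \<kappa> * lam g (P * Q)"
  proof (rule \<kappa>)
    have "r - 2 = 1 + (r - 3)" using r4 by simp
    then show "l * v \<in> Sdeg (r - 2)" "rep (r - 2) (l * v) (P * Q)"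
      using Sdeg_mult[OF l v] rep_mult[OF P(1) Q] by simp_all
  qed
  have d1: "Ecoef r (r - 2) (r - 1) (v * (y 0 ^ i * y 1 ^ j)) M = \<kappa> * lam g (monom 1 j * Q)" if "i + j = 1" for i j
  proof -
    have a: "(r - 3) + i + j = r - 2" using that r4 by simp
    show ?thesis by (rule \<kappa>[OF Sd[OF v a] rep_shift[OF Q a]])
  qed
  have d2: "Ecoef r (r - 2) (r - 1) (l * (y 0 ^ (r - 3 - b) * y 1 ^ b)) M = \<kappa> * lam g (monom 1 b * P)" if "b \<le> r - 3" for b
  proof -
    have a: "1 + (r - 3 - b) + b = r - 2" using that r4 by simp
    show ?thesis by (rule \<kappa>[OF Sd[OF l a] rep_shift[OF P(1) a]])
  qed
  have S: "(\<Sum>k=2..<r. \<Sum>b\<le>r - 1 - k. Et (k + 1 + b) * Ecoef r (r - 2) (r - 1) (l * (y 0 ^ (r - 3 - b) * y 1 ^ b)) M *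
       Ecoef r D (r - 1) (v * (y 0 ^ (D - (r - 3) - k) * y 1 ^ k)) M)
    = - (E\<^sup>2 * \<kappa> * (\<Sum>k=2..<r. \<Sum>b\<le>r - 1 - k. coeff g (k + 1 + b) * lam g (monom 1 b * P) * lam g (monom 1 k * Q)))"
    unfolding sum_distrib_left sum_negf[symmetric]
  proof (intro sum.cong refl)
    fix k b assume "k \<in> {2..<r}" "b \<in> {..r - 1 - k}"
    then have kb: "k + 1 + b \<le> r" "b \<le> r - 3" "k < r" by auto
    show "Et (k + 1 + b) * Ecoef r (r - 2) (r - 1) (l * (y 0 ^ (r - 3 - b) * y 1 ^ b)) M *
       Ecoef r D (r - 1) (v * (y 0 ^ (D - (r - 3) - k) * y 1 ^ k)) M
      = - (E\<^sup>2 * \<kappa> * (coeff g (k + 1 + b) * lam g (monom 1 b * P) * lam g (monom 1 k * Q)))"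
      unfolding c2[OF kb(1)] d2[OF kb(2)] c1[OF kb(3)] by (simp add: power2_eq_square)
  qed
  have r01: "0 < r" "1 < r" "2 \<le> r" using r4 by auto
  have one: "(1 :: nat) + 0 = 1" "(0 :: nat) + 1 = 1" by auto
  have m0: "monom 1 0 * Q = Q" by (simp add: monom_0 flip: one_pCons)
  show ?thesis
    unfolding S d0 c0[OF r01(1)] c0[OF r01(2)] d1[OF one(1)] d1[OF one(2)] m0
      lam_product[OF g_degree(1,2) P(2) r01(3)] E_def[symmetric]
    by (simp add: power2_eq_square algebra_simps)
qed

end

lemma hilb_fun_codim:
  fixes J :: "('n::finite, 'k::field) mpoly set"
  shows "J \<in> Hilb (h_rn TYPE('n) TYPE('k) r) \<Longrightarrow>
    vdim (Sdeg a :: ('n, 'k) mpoly set) - vdim (comp_deg J a) = min (vdim (Sdeg a :: ('n, 'k) mpoly set)) r"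
  by (auto simp: Hilb_def hilb_fun_def h_rn_def fun_eq_iff)

section \<open>Specialization of the identity at I\<close>

context good_line
begin

lemma vdim_comp_deg:
  assumes "r \<le> a + 2"
  shows "vdim (comp_deg I a) = vdim (Sdeg a :: ('n, 'k) mpoly set) - r"
proof -
  have "vdim (comp_deg I a) \<le> vdim (Sdeg a :: ('n, 'k) mpoly set)"
    by (rule vdim_le[OF subsp_comp_deg[OF ideal] subsp_Sdeg comp_deg_subset subset_refl])
  then show ?thesis using codim[of a] vdim_ge_r[OF assms] by simp
qed

lemma row_sum_mem:
  assumes "stiefel_rep N I M" "a < N" "r \<le> a + 2"
  shows "(\<Sum>j<vdim (Sdeg a :: ('n, 'k) mpoly set) - r. scale (b j) (Defs.row M a j)) \<in> I"
proof (intro is_idealD(6)[OF ideal] is_ideal_scale[OF ideal])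
  fix j assume "j \<in> {..<vdim (Sdeg a :: ('n, 'k) mpoly set) - r}"
  then have "Defs.row M a j \<in> comp_deg I a"
    using stiefel_row_mem[OF assms(1,2)] vdim_comp_deg[OF assms(3)] by simp
  then show "Defs.row M a j \<in> I" by (simp add: comp_deg_def)
qed

text \<open>I lies in the chart: a relation would put a binary form of polynomial degree below r
  into the saturation, and the rows alone are independent.\<close>

lemma Edet_nonzero:
  assumes st: "stiefel_rep N I M" "D < N" and D: "r \<le> D"
  shows "Edet r D M \<noteq> 0"
proof -
  let ?s = "vdim (Sdeg D :: ('n, 'k) mpoly set)"
  have rD: "r \<le> D + 2" "r \<le> ?s" using D vdim_ge_r[of D] by auto
  have "indep_mod {0} (zrows r D M) ?s"
    unfolding indep_mod_def
  proof (intro allI impI)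
    fix e u assume "(\<Sum>u<?s. scale (e u) (zrows r D M u)) \<in> {0}" and u: "u < ?s"
    then have 0: "(\<Sum>j<?s - r. scale (e j) (Defs.row M D j)) + hh D (\<Sum>k<r. monom (e (?s - r + k)) k) = 0"
      unfolding zrows_sum[OF rD(2)] by simp
    have "hh D (\<Sum>k<r. monom (e (?s - r + k)) k) = 0 - (\<Sum>j<?s - r. scale (e j) (Defs.row M D j))"
      unfolding diff_0 by (rule minus_unique[OF 0, symmetric])
    also have "\<dots> \<in> saturation I"
      by (intro I_sub is_idealD(5)[OF ideal] is_idealD(1)[OF ideal] row_sum_mem[OF st rD(1)])
    finally have "(\<Sum>k<r. monom (e (?s - r + k)) k) = 0"
      using degree_monom_sum[of r "r - 1" "\<lambda>k. e (?s - r + k)"] D r4 by (intro goodD) auto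
    then have e2: "e (?s - r + k) = 0" if "k < r" for k
      using coeff_monom_sum[of "\<lambda>k. e (?s - r + k)" r k] that by simp
    have "(\<Sum>j<?s - r. scale (e j) (Defs.row M D j)) \<in> {0}"
      using 0 \<open>(\<Sum>k<r. monom (e (?s - r + k)) k) = 0\<close> by simp
    then have e1: "e j = 0" if "j < ?s - r" for j
      using indep_modD[OF stiefel_rows(1)[OF st], of e j] that vdim_comp_deg[OF rD(1)] by simp
    show "e u = 0"
    proof (cases "u < ?s - r")
      case False
      then have "?s - r + (u - (?s - r)) = u" "u - (?s - r) < r" using u rD by auto
      then show ?thesis using e2[of "u - (?s - r)"] by simp
    qed (rule e1)
  qed
  then show ?thesis unfolding Edet_def using fdet_nonzero_iff[of D "zrows r D M"] zrows_Sdeg by blast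
qed

lemma Ecoef_zero:
  assumes st: "stiefel_rep N I M" "D < N" and D: "r \<le> D" and F: "F \<in> I" "F \<in> Sdeg D" and k: "k < r"
  shows "Ecoef r D k F M = 0"
proof -
  let ?s = "vdim (Sdeg D :: ('n, 'k) mpoly set)"
  have rD: "r \<le> D + 2" "r \<le> ?s" using D vdim_ge_r[of D] by auto
  have "F \<in> comp_deg I D" using F by (simp add: comp_deg_def)
  then obtain b where b: "F = (\<Sum>j<?s - r. scale (b j) (Defs.row M D j))"
    unfolding stiefel_rows(2)[OF st] vdim_comp_deg[OF rD(1)] by blast
  define e where "e j = (if j < ?s - r then b j else 0)" for j
  have "F = (\<Sum>j<?s. scale (e j) (zrows r D M j))"
    unfolding zrows_sum[OF rD(2)] b by (simp add: e_def)
  from fdet_cramer[OF this, of "?s - r + k"] k rD(2)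
  show ?thesis by (simp add: Ecoef_def e_def)
qed

lemma necessary_condition:
  assumes slip: "I \<in> Slip TYPE('n) TYPE('k) r"
    and l: "l \<in> Sdeg 1" "l \<in> saturation I" and v: "v \<in> Sdeg (r - 3)" "v \<in> saturation I"
  shows "l * v \<in> I"
proof -
  obtain k1 where k1: "\<And>b F. k1 \<le> b \<Longrightarrow> F \<in> Sdeg b \<Longrightarrow> F * l \<in> I"
    using l(2) unfolding saturation_iff[OF ideal] by blast
  obtain k2 where k2: "\<And>b F. k2 \<le> b \<Longrightarrow> F \<in> Sdeg b \<Longrightarrow> F * v \<in> I"
    using v(2) unfolding saturation_iff[OF ideal] by blast
  \<comment> \<open>Large enough for \<open>chart_identity\<close>, and such that the multiples of
    \<open>l\<close> and \<open>v\<close> of degree \<open>D\<close> occurring there lie in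
    \<open>I\<close>.\<close>
  define D where "D = 2 * r + k1 + k2"
  define Et where "Et M m = (if m = r then - Edet r D M else Ecoef r D m (1 * (y 0 ^ (D - r) * y 1 ^ r)) M)" for M m
  define R where "R M =
    Edet r D M * Ecoef r D 0 (l * (y 0 ^ (D - 1) * y 1 ^ 0)) M * Ecoef r (r - 2) (r - 1) (v * (y 0 ^ 1 * y 1 ^ 0)) M +
    Edet r D M * Ecoef r D 1 (l * (y 0 ^ (D - 1) * y 1 ^ 0)) M * Ecoef r (r - 2) (r - 1) (v * (y 0 ^ 0 * y 1 ^ 1)) M -
    (\<Sum>k=2..<r. \<Sum>b\<le>r - 1 - k. Et M (k + 1 + b) * Ecoef r (r - 2) (r - 1) (l * (y 0 ^ (r - 3 - b) * y 1 ^ b)) M *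
       Ecoef r D (r - 1) (v * (y 0 ^ (D - (r - 3) - k) * y 1 ^ k)) M)" for M
  define f where "f M = Edet r D M * (Edet r D M * Edet r D M * Ecoef r (r - 2) (r - 1) (l * v) M - R M)" for M
  have Et: "(\<lambda>M. Et M m) \<in> polyfun" for m
    by (cases "m = r") (simp_all add: Et_def polyfun_uminus polyfun_Edet polyfun_Ecoef)
  have "(\<lambda>M. R M) \<in> polyfun"
    unfolding R_def
    by (intro polyfun_diff polyfun_sum pf_add pf_mult polyfun_Edet polyfun_Ecoef Et)
  then have "(\<lambda>M. f M) \<in> polyfun"
    unfolding f_def by (intro polyfun_diff pf_mult polyfun_Edet polyfun_Ecoef)
  then have f: "f \<in> polyfun" by simp
  have van: "f M = 0" if X: "distinct_proj_points r X" and H: "points_ideal X \<in> Hilb (h_rn TYPE('n) TYPE('k) r)"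
    and st: "stiefel_rep (Suc D) (points_ideal X) M" for X M
  proof (cases "Edet r D M = 0")
    case False
    have D: "2 * r \<le> D" "D < Suc D" by (auto simp: D_def)
    interpret ch: point_chart y n c X r D "Suc D" M
      by unfold_locales (use X hilb_fun_codim[OF H] st D r4 False vdim_ge_r in blast)+
    show ?thesis
      using ch.chart_identity[OF l(1) v(1)] unfolding f_def R_def Et_def by (simp only: power2_eq_square) simp
  qed (simp add: f_def)
  have closure: "\<And>N f. f \<in> polyfun \<Longrightarrow> (\<forall>J\<in>{points_ideal X |X. distinct_proj_points r X} \<inter> Hilb (h_rn TYPE('n) TYPE('k) r).
      \<forall>M. stiefel_rep N J M \<longrightarrow> f M = 0) \<Longrightarrow> \<forall>M. stiefel_rep N I M \<longrightarrow> f M = 0"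
    using slip unfolding Slip_def hilb_closure_def by blast
  have "\<forall>M. stiefel_rep (Suc D) I M \<longrightarrow> f M = 0"
    by (rule closure[OF f]) (use van in blast)
  moreover obtain M where st: "stiefel_rep (Suc D) I M" using stiefel_exists[OF ideal] by blast
  ultimately have f0: "f M = 0" by blast
  have D: "r \<le> D" "D < Suc D" "r - 2 < Suc D" by (auto simp: D_def)
  have E: "Edet r D M \<noteq> 0" by (rule Edet_nonzero[OF st D(2,1)])
  have Fl: "l * (y 0 ^ (D - 1) * y 1 ^ 0) \<in> I" "l * (y 0 ^ (D - 1) * y 1 ^ 0) \<in> Sdeg D"
    using k1[of "D - 1" "y 0 ^ (D - 1)"] Sdeg_mult[OF l(1) Sdeg_power[OF y01_Sdeg(1)], of "D - 1"] r4
    by (simp_all add: D_def Sdeg_power mult.commute)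
  have Fv: "v * (y 0 ^ (D - (r - 3) - k) * y 1 ^ k) \<in> I" "v * (y 0 ^ (D - (r - 3) - k) * y 1 ^ k) \<in> Sdeg D" if "k < r" for k
  proof -
    have "(D - (r - 3) - k) + k = D - (r - 3)" "(r - 3) + (D - (r - 3)) = D" "k2 \<le> D - (r - 3)"
      using that by (auto simp: D_def)
    moreover have Z: "y 0 ^ (D - (r - 3) - k) * y 1 ^ k \<in> Sdeg ((D - (r - 3) - k) + k)"
      by (intro Sdeg_mult Sdeg_power) auto
    ultimately show "v * (y 0 ^ (D - (r - 3) - k) * y 1 ^ k) \<in> I" "v * (y 0 ^ (D - (r - 3) - k) * y 1 ^ k) \<in> Sdeg D"
      using k2[of "D - (r - 3)"] Sdeg_mult[OF v(1) Z] by (simp_all add: mult.commute[of v])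
  qed
  have z: "Ecoef r D 0 (l * (y 0 ^ (D - 1) * y 1 ^ 0)) M = 0" "Ecoef r D 1 (l * (y 0 ^ (D - 1) * y 1 ^ 0)) M = 0"
    using Ecoef_zero[OF st D(2,1) Fl] r4 by simp_all
  have zv: "Ecoef r D (r - 1) (v * (y 0 ^ (D - (r - 3) - k) * y 1 ^ k)) M = 0" if "k \<in> {2..<r}" for k
    by (rule Ecoef_zero[OF st D(2,1) Fv]) (use that r4 in auto)
  \<comment> \<open>Every term of the right side has a factor read off in degree \<open>D\<close>
    from a multiple of \<open>l\<close> or \<open>v\<close>, and these factors vanish at
    \<open>I\<close>.\<close>
  have "(\<Sum>k=2..<r. \<Sum>b\<le>r - 1 - k. Et M (k + 1 + b) * Ecoef r (r - 2) (r - 1) (l * (y 0 ^ (r - 3 - b) * y 1 ^ b)) M *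
       Ecoef r D (r - 1) (v * (y 0 ^ (D - (r - 3) - k) * y 1 ^ k)) M) = 0"
    by (intro sum.neutral ballI) (simp only: zv mult_zero_right)
  then have "R M = 0" unfolding R_def by (simp only: z mult_zero_right mult_zero_left add_0 diff_self)
  then have \<Delta>: "Ecoef r (r - 2) (r - 1) (l * v) M = 0" using f0 E by (simp add: f_def)
  let ?s = "vdim (Sdeg (r - 2) :: ('n, 'k) mpoly set)" let ?d = "?s - r"
  have rs: "r \<le> (r - 2) + 2" "r \<le> ?s" "1 \<le> r" using vdim_ge_r[of "r - 2"] r4 by auto
  define w where "w = (zrows r (r - 2) M)(?d + (r - 1) := l * v)"
  have "1 + (r - 3) = r - 2" using r4 by simp
  then have lvS: "l * v \<in> Sdeg (r - 2)" using Sdeg_mult[OF l(1) v(1)] by simp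
  have wS: "w j \<in> Sdeg (r - 2)" for j using lvS by (simp add: w_def zrows_Sdeg)
  have "fdet (r - 2) w = 0" using \<Delta> by (simp add: Ecoef_def w_def)
  then have "\<not> indep_mod {0} w ?s" using fdet_nonzero_iff[of "r - 2" w] wS by blast
  then obtain e u where e: "(\<Sum>j<?s. scale (e j) (w j)) = 0" "u < ?s" "e u \<noteq> 0" unfolding indep_mod_def by blast
  have lvsat: "l * v \<in> saturation I" by (rule is_idealD(3)[OF sat_ideal v(2)])
  let ?rows = "\<Sum>j<?d. scale (e j) (Defs.row M (r - 2) j)" let ?p = "\<Sum>k<r - 1. monom (e (?d + k)) k"
  have sum0: "?rows + hh (r - 2) ?p + scale (e (?d + (r - 1))) (l * v) = 0"
    using e(1) unfolding w_def zrows_upd_sum[OF rs(3,2)] .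
  have rowsI: "?rows \<in> I" by (rule row_sum_mem[OF st D(3) rs(1)])
  have dp: "degree ?p \<le> r - 2" by (rule degree_monom_sum) simp
  have "hh (r - 2) ?p = 0 - ?rows - scale (e (?d + (r - 1))) (l * v)"
    using sum0 by (simp add: algebra_simps eq_neg_iff_add_eq_0)
  also have "\<dots> \<in> saturation I"
    by (intro is_idealD(5)[OF sat_ideal] is_idealD(1)[OF sat_ideal] I_sub[OF rowsI] is_ideal_scale[OF sat_ideal] lvsat)
  \<comment> \<open>The vanishing determinant yields a relation between rows, binary forms and
    \<open>l * v\<close>. Goodness removes the binary part, and independence of the rows forces a
    nonzero coefficient at \<open>l * v\<close>.\<close>
  finally have p0: "?p = 0" using dp r4 by (intro goodD) auto
  then have e2: "e (?d + k) = 0" if "k < r - 1" for k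
    using coeff_monom_sum[of "\<lambda>k. e (?d + k)" "r - 1" k] that by simp
  have sum0': "?rows + scale (e (?d + (r - 1))) (l * v) = 0" using sum0 unfolding p0 by simp
  have eL: "e (?d + (r - 1)) \<noteq> 0"
  proof
    assume eL: "e (?d + (r - 1)) = 0"
    then have "?rows \<in> {0}" using sum0' by simp
    then have e1: "e j = 0" if "j < ?d" for j
      using indep_modD[OF stiefel_rows(1)[OF st D(3)], of e j] that vdim_comp_deg[OF rs(1)] by simp
    consider "u < ?d" | "?d \<le> u" "u - ?d < r - 1" | "u - ?d = r - 1" "?d \<le> u" using e(2) rs by linarith
    then have "e u = 0"
    proof cases
      case 2
      then show ?thesis using e2[OF 2(2)] by simp
    next
      case 3
      then have "u = ?d + (r - 1)" by linarith
      then show ?thesis using eL by (simp only:)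
    qed (rule e1)
    then show False using e(3) by contradiction
  qed
  have "scale (e (?d + (r - 1))) (l * v) = 0 - ?rows"
    unfolding diff_0 by (rule minus_unique[OF sum0', symmetric])
  also have "\<dots> \<in> I" by (rule is_idealD(5)[OF ideal is_idealD(1)[OF ideal] rowsI])
  finally have "scale (1 / e (?d + (r - 1))) (scale (e (?d + (r - 1))) (l * v)) \<in> I"
    by (rule is_ideal_scale[OF ideal])
  then show ?thesis using eL by simp
qed

end

section \<open>Limits of ideals along an arc of point configurations\<close>

lemma pconst_0 [simp]: "pconst 0 = 0"
  by (simp add: pconst_def)

lemma pconst_power: "pconst t ^ i = pconst (t ^ i)"
  by (induction i) (simp_all add: pconst_def mult_single flip: single_one)

lemma poly_pconst:
  fixes F :: "('n, 'k::field) mpoly poly"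
  shows "poly F (pconst t) = (\<Sum>i\<le>degree F. scale (t ^ i) (coeff F i))"
  by (simp add: poly_altdef pconst_power scale_def mult.commute)

lemma poly_pconst_Sdeg:
  fixes F :: "('n::finite, 'k::field) mpoly poly"
  shows "(\<And>i. coeff F i \<in> Sdeg a) \<Longrightarrow> poly F (pconst t) \<in> Sdeg a"
  unfolding poly_pconst by (intro Sdeg_sum Sdeg_scale)

lemma polyfun_poly: "f \<in> polyfun \<Longrightarrow> (\<lambda>M. poly p (f M)) \<in> polyfun"
  by (induction p) (auto intro: polyfun.intros)

lemma polyfun_eval: "(\<lambda>x. eval G x) \<in> polyfun"
proof -
  have pow: "(\<lambda>x. x i ^ k) \<in> polyfun" for i :: 'a and k
    by (induction k) (auto intro: polyfun.intros)
  show ?thesis unfolding eval_def by (intro polyfun_sum polyfun_prod pf_mult pf_const pow)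
qed

lemma lk_poly_pconst:
  fixes F :: "('n, 'k::field) mpoly poly"
  shows "\<exists>p. \<forall>t. lk (poly F (pconst t)) m = poly p t"
  by (rule exI[of _ "\<Sum>i\<le>degree F. monom (lk (coeff F i) m) i"])
    (simp add: poly_pconst lookup_sum poly_sum poly_monom mult.commute)

lemma indep_mod_subfamily: "indep_mod V w s \<Longrightarrow> d \<le> s \<Longrightarrow> indep_mod V w d"
proof -
  assume w: "indep_mod V w s" and d: "d \<le> s"
  show ?thesis unfolding indep_mod_def
  proof (intro allI impI)
    fix b u assume b: "(\<Sum>u<d. scale (b u) (w u)) \<in> V" and u: "u < d"
    have "(\<Sum>u<s. scale (if u < d then b u else 0) (w u)) = (\<Sum>u<d. scale (if u < d then b u else 0) (w u))"
      by (rule sum.mono_neutral_right) (use d in auto)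
    also have "\<dots> = (\<Sum>u<d. scale (b u) (w u))" by simp
    finally have "(\<Sum>u<s. scale (if u < d then b u else 0) (w u)) \<in> V" using b by simp
    from indep_modD[OF w this, of u] u d show "b u = 0" by simp
  qed
qed

lemma indep_mod_cong: "(\<And>u. u < m \<Longrightarrow> G u = G' u) \<Longrightarrow> indep_mod V G m \<longleftrightarrow> indep_mod V G' m"
  unfolding indep_mod_def by (metis (no_types, lifting) lessThan_iff sum.cong)

text \<open>Completing the family at t = 0 to a basis by constant vectors gives a determinant that
  is polynomial in t and nonzero at 0.\<close>

lemma generic_indep:
  fixes v :: "nat \<Rightarrow> ('n::finite, 'k::field) mpoly poly"
  assumes S: "\<And>j i. j < d \<Longrightarrow> coeff (v j) i \<in> Sdeg a"
    and ind: "indep_mod {0} (\<lambda>j. poly (v j) 0) d"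
  shows "finite {t. \<not> indep_mod {0} (\<lambda>j. poly (v j) (pconst t)) d}"
proof -
  let ?s = "vdim (Sdeg a :: ('n, 'k) mpoly set)"
  have v0: "poly (v j) 0 \<in> Sdeg a" if "j < d" for j using S[OF that] by (simp add: poly_0_coeff_0)
  have "\<exists>w. indep_mod {0} w ?s \<and> (\<forall>j<d. w j = poly (v j) 0) \<and> (\<forall>j<?s. w j \<in> (Sdeg a :: ('n, 'k) mpoly set))"
    by (rule indep_extend[OF ind v0])
  then obtain w where w: "indep_mod {0} w ?s" "\<forall>j<d. w j = poly (v j) 0" "\<forall>j<?s. w j \<in> Sdeg a"
    by blast
  have ds: "d \<le> ?s" by (rule indep_le_vdim[OF subsp_Sdeg subset_refl ind v0])
  define W where "W t j = (if j < d then poly (v j) (pconst t) else w j)" for t j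
  have WS: "W t j \<in> Sdeg a" if "j < ?s" for t j
    using that w(3) S by (auto simp: W_def intro: poly_pconst_Sdeg)
  have "\<forall>j m. \<exists>p. \<forall>t. lk (W t j) m = poly p t"
  proof (intro allI)
    fix j m
    show "\<exists>p. \<forall>t. lk (W t j) m = poly p t"
      by (cases "j < d") (auto simp: W_def lk_poly_pconst intro: exI[of _ "[:lk (w j) m:]"])
  qed
  then obtain p where p: "\<And>j m t. lk (W t j) m = poly (p j m) t" by metis
  define W' where "W' x = W (x ())" for x
  have "(\<lambda>x. fdet a (W' x)) \<in> polyfun"
    by (rule polyfun_fdet) (unfold W'_def p, rule polyfun_poly, rule pf_var)
  from polyfun_on_curve[OF this, of "\<lambda>t _. t"]
  obtain q where q: "\<And>t. fdet a (W t) = poly q t"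
    by (metis (no_types, lifting) W'_def poly_pCons poly_0 mult_1_right add_0 mult_zero_right add.right_neutral)
  have "indep_mod {0} (W 0) ?s"
    by (rule iffD1[OF indep_mod_cong w(1)]) (use w(2) in \<open>simp add: W_def\<close>)
  then have "poly q 0 \<noteq> 0" using fdet_nonzero_iff[of a "W 0"] WS q by metis
  then have "q \<noteq> 0" by auto
  moreover have "indep_mod {0} (\<lambda>j. poly (v j) (pconst t)) d" if "poly q t \<noteq> 0" for t
  proof -
    have "indep_mod {0} (W t) ?s" using that fdet_nonzero_iff[of a "W t"] WS q[of t] by simp
    then have "indep_mod {0} (W t) d" by (rule indep_mod_subfamily[OF _ ds])
    then show ?thesis by (rule iffD1[OF indep_mod_cong, rotated]) (simp add: W_def)
  qed
  ultimately show ?thesis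
    by (intro finite_subset[OF _ poly_roots_finite[of q]]) auto
qed

locale limit_arc =
  fixes xp :: "nat \<Rightarrow> 'k::field \<Rightarrow> 'n::finite \<Rightarrow> 'k" and r :: nat
  assumes arc: "\<exists>p. \<forall>t. xp j t i = poly p t"
    and inf: "infinite (UNIV :: 'k set)"
    and generic: "finite {t. \<not> (distinct_proj_points r ((\<lambda>j. xp j t) ` {..<r}) \<and>
      points_ideal ((\<lambda>j. xp j t) ` {..<r}) \<in> Hilb (h_rn TYPE('n) TYPE('k) r))}"
begin

definition Xt :: "'k \<Rightarrow> ('n \<Rightarrow> 'k) set" where "Xt t = (\<lambda>j. xp j t) ` {..<r}"

text \<open>A form with coefficients polynomial in t, written as a polynomial in t over the form
  ring, that vanishes at the moving points for every t, including exceptional ones.\<close>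

definition fam :: "nat \<Rightarrow> ('n, 'k) mpoly poly \<Rightarrow> bool" where
  "fam a F \<longleftrightarrow> (\<forall>i. coeff F i \<in> Sdeg a) \<and> (\<forall>t. \<forall>j<r. eval (poly F (pconst t)) (xp j t) = 0)"

text \<open>The flat limit in degree \<open>a\<close>. Values at 0 suffice, since a family divisible
  by t can be divided by it and remains a family.\<close>

definition Jh :: "nat \<Rightarrow> ('n, 'k) mpoly set" where
  "Jh a = {poly F 0 |F. fam a F}"

definition J :: "('n, 'k) mpoly set" where
  "J = {f. \<forall>a. hcomp a f \<in> Jh a}"

lemma Jh_subset: "Jh a \<subseteq> Sdeg a"
  by (auto simp: Jh_def fam_def poly_0_coeff_0)

lemma subsp_Jh: "mp.subspace (Jh a)"
  unfolding mp.subspace_def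
proof (intro conjI ballI allI)
  have "fam a 0" by (simp add: fam_def)
  then show "0 \<in> Jh a" unfolding Jh_def by force
next
  fix f g assume "f \<in> Jh a" "g \<in> Jh a"
  then obtain F G where "fam a F" "f = poly F 0" "fam a G" "g = poly G 0" by (auto simp: Jh_def)
  then have "fam a (F + G)" "f + g = poly (F + G) 0" by (auto simp: fam_def intro: Sdeg_add)
  then show "f + g \<in> Jh a" unfolding Jh_def by blast
next
  fix c f assume "f \<in> Jh a"
  then obtain F where "fam a F" "f = poly F 0" by (auto simp: Jh_def)
  then have "fam a (smult (pconst c) F)" "scale c f = poly (smult (pconst c) F) 0"
    by (auto simp: fam_def scale_def[symmetric] intro: Sdeg_scale)
  then show "scale c f \<in> Jh a" unfolding Jh_def by blast
qed

lemma Jh_mult: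
  assumes "s \<in> Sdeg b" "f \<in> Jh a"
  shows "s * f \<in> Jh (b + a)"
proof -
  obtain F where "fam a F" "f = poly F 0" using assms(2) by (auto simp: Jh_def)
  then have "fam (b + a) (smult s F)" "s * f = poly (smult s F) 0"
    using assms(1) by (auto simp: fam_def intro: Sdeg_mult)
  then show ?thesis unfolding Jh_def by blast
qed

lemma is_ideal_J: "is_ideal J"
  unfolding is_ideal_def
proof (intro conjI ballI allI)
  show "0 \<in> J" by (simp add: J_def subspD(1)[OF subsp_Jh])
  show "p + q \<in> J" if "p \<in> J" "q \<in> J" for p q
    using that by (simp add: J_def hcomp_add subspD(2)[OF subsp_Jh])
  show "s * p \<in> J" if p: "p \<in> J" for s p
    unfolding J_def mem_Collect_eq hcomp_mult
  proof (intro allI subspD(5)[OF subsp_Jh])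
    fix a b :: nat assume "b \<in> {..a}"
    moreover have "hcomp b s * hcomp (a - b) p \<in> Jh (b + (a - b))"
      by (rule Jh_mult) (use p in \<open>simp_all add: J_def\<close>)
    ultimately show "hcomp b s * hcomp (a - b) p \<in> Jh a" by simp
  qed
qed

lemma comp_deg_J: "comp_deg J a = Jh a"
proof (intro equalityI subsetI)
  fix f assume "f \<in> comp_deg J a"
  then have "f \<in> Sdeg a" "hcomp a f \<in> Jh a" by (auto simp: comp_deg_def J_def)
  then show "f \<in> Jh a" by (simp add: hcomp_same)
next
  fix f assume f: "f \<in> Jh a"
  then have "f \<in> Sdeg a" using Jh_subset by blast
  then show "f \<in> comp_deg J a"
    using f subspD(1)[OF subsp_Jh] by (auto simp: comp_deg_def J_def hcomp_Sdeg_if)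
qed

lemma homog_ideal_J: "homog_ideal J"
  unfolding homog_ideal_iff
proof (intro conjI ballI allI is_ideal_J)
  fix f a assume "f \<in> J"
  then have "hcomp a f \<in> comp_deg J a" unfolding comp_deg_J by (simp add: J_def)
  then show "hcomp a f \<in> J" by (simp add: comp_deg_def)
qed

definition bad :: "'k set" where
  "bad = {t. \<not> (distinct_proj_points r (Xt t) \<and> points_ideal (Xt t) \<in> Hilb (h_rn TYPE('n) TYPE('k) r))}"

lemma finite_bad: "finite bad"
  using generic by (simp add: bad_def Xt_def)

lemma vdim_points:
  assumes "t \<notin> bad"
  shows "vdim (comp_deg (points_ideal (Xt t)) a) =
    vdim (Sdeg a :: ('n, 'k) mpoly set) - min (vdim (Sdeg a :: ('n, 'k) mpoly set)) r"
proof -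
  have "is_ideal (points_ideal (Xt t))" by (simp add: points_ideal_def is_ideal_ideal_gen)
  then have "vdim (comp_deg (points_ideal (Xt t)) a) \<le> vdim (Sdeg a :: ('n, 'k) mpoly set)"
    by (intro vdim_le[OF subsp_comp_deg subsp_Sdeg comp_deg_subset subset_refl])
  then show ?thesis using hilb_fun_codim[of "points_ideal (Xt t)" r a] assms by (auto simp: bad_def)
qed

lemma fam_points: "fam a F \<Longrightarrow> poly F (pconst t) \<in> comp_deg (points_ideal (Xt t)) a"
  unfolding comp_deg_points_ideal
  by (auto simp: fam_def Xt_def intro: poly_pconst_Sdeg)

lemma Jh_lift:
  assumes "\<And>j. j < d \<Longrightarrow> v j \<in> Jh a"
  shows "\<exists>F. \<forall>j<d. fam a (F j) \<and> v j = poly (F j) 0"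
proof -
  have "\<forall>j. \<exists>F. j < d \<longrightarrow> fam a F \<and> v j = poly F 0" using assms by (auto simp: Jh_def)
  from choice[OF this] show ?thesis by blast
qed

text \<open>Lifts of a basis stay independent for all but finitely many t, and there they lie in the
  ideal of a point set with the prescribed Hilbert function.\<close>

lemma vdim_Jh_le:
  "vdim (Jh a) \<le> vdim (Sdeg a :: ('n, 'k) mpoly set) - min (vdim (Sdeg a :: ('n, 'k) mpoly set)) r"
proof -
  let ?d = "vdim (Jh a)"
  obtain v where v: "indep_mod {0} v ?d" "\<And>j. j < ?d \<Longrightarrow> v j \<in> Jh a"
    by (rule basis_family[OF subsp_Jh Jh_subset]) (rule that, assumption+)
  have "\<exists>F. \<forall>j<?d. fam a (F j) \<and> v j = poly (F j) 0" by (rule Jh_lift) (rule v(2))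
  then obtain F where F: "\<forall>j<?d. fam a (F j) \<and> v j = poly (F j) 0" ..
  have "indep_mod {0} (\<lambda>j. poly (F j) 0) ?d"
    by (rule iffD1[OF indep_mod_cong v(1)]) (use F in simp)
  then have "finite {t. \<not> indep_mod {0} (\<lambda>j. poly (F j) (pconst t)) ?d}"
    by (rule generic_indep[of _ _ a, rotated]) (use F in \<open>simp add: fam_def\<close>)
  then have "finite ({t. \<not> indep_mod {0} (\<lambda>j. poly (F j) (pconst t)) ?d} \<union> bad)" using finite_bad by simp
  then obtain t where t: "indep_mod {0} (\<lambda>j. poly (F j) (pconst t)) ?d" "t \<notin> bad"
    using inf ex_new_if_finite by blast
  have id: "is_ideal (points_ideal (Xt t))" by (simp add: points_ideal_def is_ideal_ideal_gen)
  have "?d \<le> vdim (comp_deg (points_ideal (Xt t)) a)"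
    by (rule indep_le_vdim[OF subsp_comp_deg[OF id] comp_deg_subset t(1)]) (use F fam_points in blast)
  then show ?thesis using vdim_points[OF t(2)] by simp
qed

text \<open>Families of degree at most D in t have (D + 1) s coefficients, and vanishing along the r arcs
  imposes at most r (D + 1 + c) conditions. If the dimension d of Jh a were less than s - r, one could
  for large D also impose that the d coordinates of every coefficient along Jh a vanish; but the lowest
  nonzero coefficient of a solution lies in Jh a.\<close>

lemma vdim_Jh_ge: "vdim (Sdeg a :: ('n, 'k) mpoly set) \<le> r + vdim (Jh a)"
proof (rule ccontr)
  assume neg: "\<not> ?thesis"
  let ?s = "vdim (Sdeg a :: ('n, 'k) mpoly set)" let ?d = "vdim (Jh a)"
  let ?Mn = "{m :: 'n \<Rightarrow>\<^sub>0 nat. mdeg m = a}"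
  have lt: "r + ?d < ?s" using neg by simp
  obtain v where v: "indep_mod {0} v ?d" "\<And>j. j < ?d \<Longrightarrow> v j \<in> Jh a"
    "\<And>F. F \<in> Jh a \<Longrightarrow> \<exists>c. F = (\<Sum>j<?d. scale (c j) (v j))"
    by (rule basis_family[OF subsp_Jh Jh_subset]) (rule that, assumption+)
  have "\<exists>w. indep_mod {0} w ?s \<and> (\<forall>j<?d. w j = v j) \<and> (\<forall>j<?s. w j \<in> (Sdeg a :: ('n, 'k) mpoly set))"
    by (rule indep_extend[OF v(1)]) (rule subsetD[OF Jh_subset v(2)])
  then obtain w where w: "indep_mod {0} w ?s" "\<forall>j<?d. w j = v j" "\<forall>j<?s. w j \<in> (Sdeg a :: ('n, 'k) mpoly set)"
    by blast
  have "\<forall>m. \<exists>b. mdeg m = a \<longrightarrow> Poly_Mapping.single m 1 = (\<Sum>j<?s. scale (b j) (w j))"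
    using indep_span[OF subsp_Sdeg subset_refl w(1) w(3)[rule_format]] Sdeg_single by blast
  \<comment> \<open>Through \<open>B\<close> the coordinates along the basis \<open>w\<close> become
    linear in the monomial coefficients, so their vanishing can be imposed in the linear
    system.\<close>
  from choice[OF this] obtain B where B: "\<forall>m. mdeg m = a \<longrightarrow> Poly_Mapping.single m 1 = (\<Sum>j<?s. scale (B m j) (w j))" ..
  have coords: "F = (\<Sum>j<?s. scale (\<Sum>m\<in>?Mn. lk F m * B m j) (w j))" if F: "F \<in> Sdeg a" for F
  proof -
    have "F = (\<Sum>m\<in>?Mn. scale (lk F m) (Poly_Mapping.single m 1))"
      by (rule poly_mapping_eqI) (use F in \<open>auto simp: lookup_sum lookup_single when_def sum.delta Sdeg_iff if_distrib[of "(*) _"] cong: if_cong\<close>)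
    also have "\<dots> = (\<Sum>m\<in>?Mn. \<Sum>j<?s. scale (lk F m * B m j) (w j))"
      by (intro sum.cong refl) (use B in \<open>simp add: mp.scale_sum_right\<close>)
    also have "\<dots> = (\<Sum>j<?s. scale (\<Sum>m\<in>?Mn. lk F m * B m j) (w j))"
      by (subst sum.swap) (simp add: mp.scale_sum_left)
    finally show ?thesis .
  qed
  have detect: "F = 0" if F: "F \<in> Jh a" and z: "\<And>j. j < ?d \<Longrightarrow> (\<Sum>m\<in>?Mn. lk F m * B m j) = 0" for F
  proof -
    obtain b where b: "F = (\<Sum>j<?d. scale (b j) (v j))" using v(3)[OF F] ..
    define e where "e j = (\<Sum>m\<in>?Mn. lk F m * B m j) - (if j < ?d then b j else 0)" for j
    have "(\<Sum>j<?s. scale (if j < ?d then b j else 0) (w j)) = (\<Sum>j<?d. scale (if j < ?d then b j else 0) (w j))"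
      by (rule sum.mono_neutral_right) (use lt in auto)
    also have "\<dots> = F" unfolding b by (intro sum.cong refl) (use w(2) in simp)
    finally have "(\<Sum>j<?s. scale (e j) (w j)) = F - F"
      unfolding e_def mp.scale_left_diff_distrib sum_subtractf
      using coords[OF subsetD[OF Jh_subset F]] by simp
    then have "(\<Sum>j<?s. scale (e j) (w j)) \<in> {0}" by simp
    then have "e j = 0" if "j < ?d" for j using indep_modD[OF w(1), of e j] that lt by simp
    then have "b j = 0" if "j < ?d" for j using that z by (simp add: e_def)
    then show ?thesis unfolding b by simp
  qed
  have "\<forall>j m. \<exists>p. \<forall>t. monv (xp j t) m = poly p t"
  proof (intro allI)
    fix j and m :: "'n \<Rightarrow>\<^sub>0 nat"
    show "\<exists>p. \<forall>t. monv (xp j t) m = poly p t"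
      using polyfun_on_curve[OF polyfun_eval[of "Poly_Mapping.single m 1"], of "\<lambda>t. xp j t"] arc by simp
  qed
  then obtain e where e: "\<And>j m t. monv (xp j t) m = poly (e j m) t" by metis
  define c where "c = (\<Sum>j<r. \<Sum>m\<in>?Mn. degree (e j m))"
  have c: "degree (e j m) \<le> c" if "j < r" "m \<in> ?Mn" for j m
  proof -
    have "degree (e j m) \<le> (\<Sum>m\<in>?Mn. degree (e j m))" using that by (intro member_le_sum) auto
    also have "\<dots> \<le> c" unfolding c_def using that(1) by (intro member_le_sum[of j "{..<r}" "\<lambda>j. \<Sum>m\<in>?Mn. degree (e j m)"]) auto
    finally show ?thesis .
  qed
  \<comment> \<open>With this choice the excess r c of conditions is less than D + 1, while the gap
    in dimension yields at least D + 1 additional unknowns.\<close>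
  define D where "D = r * c"
  define A :: "(nat \<times> nat + nat \<times> nat) set" where
    "A = ({..<r} \<times> {..D + c}) <+> ({..D} \<times> {..<?d})"
  define U where "U = {..D} \<times> ?Mn"
  \<comment> \<open>\<open>Inl (j, x)\<close>: the coefficient of t^x along arc \<open>j\<close>
    vanishes. \<open>Inr (i, l)\<close>: the \<open>i\<close>-th coefficient of the family has
    coordinate 0 along the \<open>l\<close>-th basis vector of the limit.\<close>
  define Mat where "Mat q u = (case q of Inl (j, x) \<Rightarrow> coeff (monom 1 (fst u) * e j (snd u)) x
    | Inr (i, l) \<Rightarrow> (if fst u = i then B (snd u) l else 0))" for q u
  have finA: "finite A" "finite U" unfolding A_def U_def by auto
  have "card A = r * (D + c + 1) + (D + 1) * ?d" unfolding A_def by (simp add: card_Plus)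
  also have "\<dots> < (D + 1) * (r + ?d + 1)" by (simp add: D_def algebra_simps)
  also have "\<dots> \<le> (D + 1) * ?s" using lt by (intro mult_le_mono2) simp
  also have "\<dots> = card U" unfolding U_def by (simp add: vdim_Sdeg card_cartesian_product)
  finally have "card A < card U" .
  from hom_system[OF finA this, of Mat]
  obtain u where u: "\<exists>b\<in>U. u b \<noteq> 0" "\<forall>q\<in>A. (\<Sum>b\<in>U. Mat q b * u b) = 0" by blast
  define F where "F i = (\<Sum>m\<in>?Mn. Poly_Mapping.single m (u (i, m)))" for i
  have lkF: "lk (F i) m = (if m \<in> ?Mn then u (i, m) else 0)" for i m
    by (simp add: F_def lookup_sum lookup_single when_def sum.delta)
  have FS: "F i \<in> Sdeg a" for i by (auto simp: Sdeg_iff lkF)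
  have evF: "eval (F i) (xp j t) = poly (\<Sum>m\<in>?Mn. smult (u (i, m)) (e j m)) t" for i j t
    by (simp add: eval_Sdeg[OF FS] lkF e poly_sum)
  have E0: "(\<Sum>i\<le>D. monom 1 i * (\<Sum>m\<in>?Mn. smult (u (i, m)) (e j m))) = 0" if j: "j < r" for j
  proof (rule poly_eqI)
    fix x
    have eq: "coeff (\<Sum>i\<le>D. monom 1 i * (\<Sum>m\<in>?Mn. smult (u (i, m)) (e j m))) x
      = (\<Sum>b\<in>U. coeff (monom 1 (fst b) * e j (snd b)) x * u b)"
      unfolding U_def by (simp add: sum_distrib_left coeff_sum sum.cartesian_product case_prod_unfold mult.commute)
    show "coeff (\<Sum>i\<le>D. monom 1 i * (\<Sum>m\<in>?Mn. smult (u (i, m)) (e j m))) x = coeff 0 x"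
    proof (cases "x \<le> D + c")
      case True
      then have "Inl (j, x) \<in> A" using j unfolding A_def by (intro InlI) simp
      then have "(\<Sum>b\<in>U. Mat (Inl (j, x)) b * u b) = 0" using u(2) by blast
      then show ?thesis unfolding eq by (simp add: Mat_def)
    next
      case False
      have "coeff (monom 1 (fst b) * e j (snd b)) x = 0" if b: "b \<in> U" for b
      proof (rule coeff_eq_0)
        have "degree (monom 1 (fst b) * e j (snd b)) \<le> D + c"
          by (rule order_trans[OF degree_mult_le], rule add_mono)
            (use b c[OF j, of "snd b"] degree_monom_le[of "1 :: 'k" "fst b"] in \<open>auto simp: U_def\<close>)
        then show "degree (monom 1 (fst b) * e j (snd b)) < x" using False by simp
      qed
      then show ?thesis unfolding eq by simp
    qed
  qed
  have F0: "F k = 0" if "k \<le> D" for k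
    using that
  proof (induction k rule: less_induct)
    case (less k)
    \<comment> \<open>By induction the coefficients before \<open>k\<close> vanish, so the family
      can be divided by t^k; its value at 0 is then \<open>F k\<close>.\<close>
    define G where "G = (\<Sum>i\<in>{k..D}. monom (F i) (i - k))"
    have G0: "poly G 0 = F k"
    proof -
      have "poly G 0 = (\<Sum>i\<in>{k..D}. if i = k then F i else 0)"
        unfolding G_def poly_sum by (intro sum.cong refl) (auto simp: poly_monom power_0_left)
      then show ?thesis using less.prems by (simp add: sum.delta)
    qed
    have "fam a G"
      unfolding fam_def
    proof (intro conjI allI impI)
      show "coeff G i \<in> Sdeg a" for i
        unfolding G_def coeff_sum by (intro Sdeg_sum) (simp add: FS)
      fix t j assume j: "j < r"
      let ?E = "\<lambda>i. \<Sum>m\<in>?Mn. smult (u (i, m)) (e j m)"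
      have "eval (poly G (pconst t)) (xp j t) = (\<Sum>i\<in>{k..D}. t ^ (i - k) * eval (F i) (xp j t))"
        unfolding G_def poly_sum eval_sum
        by (intro sum.cong refl) (simp add: poly_monom pconst_power, simp add: pconst_def)
      also have "\<dots> = (\<Sum>i\<in>{k..D}. t ^ (i - k) * poly (?E i) t)" by (simp only: evF)
      also have "\<dots> = poly (\<Sum>i\<in>{k..D}. monom 1 (i - k) * ?E i) t"
        by (simp add: poly_sum poly_monom)
      also have "(\<Sum>i\<in>{k..D}. monom 1 (i - k) * ?E i) = 0"
      proof -
        have zero: "?E i = 0" if "i < k" for i
        proof -
          have "F i = 0" by (rule less.IH) (use that less.prems in auto)
          then have "u (i, m) = 0" if "m \<in> ?Mn" for m using lkF[of i m] that by simp
          then show ?thesis by (intro sum.neutral) auto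
        qed
        have "monom 1 k * (\<Sum>i\<in>{k..D}. monom 1 (i - k) * ?E i) = (\<Sum>i\<in>{k..D}. monom 1 i * ?E i)"
          unfolding sum_distrib_left by (intro sum.cong refl) (simp add: mult_monom flip: mult.assoc)
        also have "\<dots> = (\<Sum>i\<le>D. monom 1 i * ?E i)"
          by (rule sum.mono_neutral_left) (use zero in \<open>auto simp: not_le\<close>)
        also have "\<dots> = 0" by (rule E0[OF j])
        finally show ?thesis by (simp add: monom_eq_0_iff)
      qed
      finally show "eval (poly G (pconst t)) (xp j t) = 0" by simp
    qed
    then have "F k \<in> Jh a" unfolding Jh_def using G0 by (metis (mono_tags, lifting) mem_Collect_eq)
    moreover have "(\<Sum>m\<in>?Mn. lk (F k) m * B m l) = 0" if l: "l < ?d" for l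
    proof -
      have "Inr (k, l) \<in> A" using l less.prems unfolding A_def by (intro InrI) simp
      then have "(\<Sum>b\<in>U. Mat (Inr (k, l)) b * u b) = 0" using u(2) by blast
      also have "(\<Sum>b\<in>U. Mat (Inr (k, l)) b * u b) = (\<Sum>i\<le>D. \<Sum>m\<in>?Mn. if i = k then B m l * u (i, m) else 0)"
        unfolding U_def sum.cartesian_product by (intro sum.cong refl) (auto simp: Mat_def)
      also have "\<dots> = (\<Sum>i\<le>D. if i = k then \<Sum>m\<in>?Mn. B m l * u (i, m) else 0)"
        by (intro sum.cong refl) auto
      also have "\<dots> = (\<Sum>m\<in>?Mn. B m l * u (k, m))" using less.prems by (simp add: sum.delta)
      finally show ?thesis by (simp add: lkF mult.commute)
    qed
    ultimately show ?case by (rule detect)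
  qed
  obtain i m where "(i, m) \<in> U" "u (i, m) \<noteq> 0" using u(1) by auto
  then show False using F0[of i] lkF[of i m] by (auto simp: U_def)
qed

lemma vdim_Jh:
  "vdim (Jh a) = vdim (Sdeg a :: ('n, 'k) mpoly set) - min (vdim (Sdeg a :: ('n, 'k) mpoly set)) r"
  using vdim_Jh_le[of a] vdim_Jh_ge[of a] by linarith

lemma J_Hilb: "J \<in> Hilb (h_rn TYPE('n) TYPE('k) r)"
  unfolding Hilb_def
proof (intro CollectI conjI homog_ideal_J ext)
  fix a
  show "hilb_fun J a = h_rn TYPE('n) TYPE('k) r a"
    unfolding hilb_fun_def h_rn_def comp_deg_J vdim_Jh by simp
qed

text \<open>The rows of a Stiefel matrix of the limit are lifted to families. A polynomial function
  vanishing on point sets then becomes a polynomial in t with infinitely many zeros, so it vanishes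
  at t = 0 too.\<close>

lemma J_Slip: "J \<in> Slip TYPE('n) TYPE('k) r"
  unfolding Slip_def hilb_closure_def
proof (intro CollectI conjI J_Hilb allI ballI impI)
  fix N and f :: "(nat \<times> nat \<times> ('n \<Rightarrow>\<^sub>0 nat) \<Rightarrow> 'k) \<Rightarrow> 'k" and M
  assume f: "f \<in> polyfun"
    and van: "\<forall>J\<in>{points_ideal X |X. distinct_proj_points r X} \<inter> Hilb (h_rn TYPE('n) TYPE('k) r). \<forall>M. stiefel_rep N J M \<longrightarrow> f M = 0"
    and M: "stiefel_rep N J M"
  define d where "d a = vdim (Jh a)" for a
  have row: "\<And>j. j < d a \<Longrightarrow> Defs.row M a j \<in> Jh a" if "a < N" for a
    using stiefel_row_mem[OF M that] by (simp add: comp_deg_J d_def)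
  have "\<forall>a. \<exists>F. a < N \<longrightarrow> (\<forall>j<d a. fam a (F j) \<and> Defs.row M a j = poly (F j) 0)"
  proof
    fix a :: nat
    show "\<exists>F. a < N \<longrightarrow> (\<forall>j<d a. fam a (F j) \<and> Defs.row M a j = poly (F j) 0)"
    proof (cases "a < N")
      case True
      have "\<exists>F. \<forall>j<d a. fam a (F j) \<and> Defs.row M a j = poly (F j) 0"
        by (rule Jh_lift) (rule row[OF True])
      then show ?thesis by blast
    qed simp
  qed
  from choice[OF this] obtain F where F: "\<forall>a. a < N \<longrightarrow> (\<forall>j<d a. fam a (F a j) \<and> Defs.row M a j = poly (F a j) 0)" ..
  define Mt where "Mt t = (\<lambda>(a, j, m). if a < N \<and> j < d a \<and> mdeg m = a then lk (poly (F a j) (pconst t)) m else 0)" for t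
  have Mt: "\<exists>p. \<forall>t. Mt t v = poly p t" for v
  proof -
    obtain a j :: nat and m :: "'n \<Rightarrow>\<^sub>0 nat" where v: "v = (a, j, m)" by (cases v)
    show ?thesis
      using lk_poly_pconst[of "F a j" m] by (cases "a < N \<and> j < d a \<and> mdeg m = a") (auto simp: Mt_def v intro: exI[of _ 0])
  qed
  have "\<exists>p. \<forall>t. f (Mt t) = poly p t" by (rule polyfun_on_curve[OF f]) (rule Mt)
  then obtain p where p: "\<And>t. f (Mt t) = poly p t" by blast
  have M0: "Mt 0 = M"
  proof
    fix v
    obtain a j :: nat and m :: "'n \<Rightarrow>\<^sub>0 nat" where v: "v = (a, j, m)" by (cases v)
    have "M (a, j, m) = 0" if "\<not> (a < N \<and> j < d a \<and> mdeg m = a)"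
      using M that unfolding stiefel_rep_def comp_deg_J d_def by (metis not_le)
    moreover have "lk (poly (F a j) 0) m = M (a, j, m)" if "a < N" "j < d a" "mdeg m = a"
      using F that lk_row[of M a j m] by simp
    ultimately show "Mt 0 v = M v" by (auto simp: Mt_def v)
  qed
  \<comment> \<open>Outside these finitely many t the points have the right Hilbert function and the
    lifted rows are bases of their ideal in all degrees below \<open>N\<close>.\<close>
  define ex where "ex = bad \<union> (\<Union>a<N. {t. \<not> indep_mod {0} (\<lambda>j. poly (F a j) (pconst t)) (d a)})"
  have "finite {t. \<not> indep_mod {0} (\<lambda>j. poly (F a j) (pconst t)) (d a)}" if a: "a < N" for a
  proof (rule generic_indep[of _ _ a])
    show "coeff (F a j) i \<in> Sdeg a" if "j < d a" for j i using F a that by (simp add: fam_def)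
    have "indep_mod {0} (Defs.row M a) (d a)" using stiefel_rows(1)[OF M a] by (simp add: comp_deg_J d_def)
    then show "indep_mod {0} (\<lambda>j. poly (F a j) 0) (d a)"
      by (rule iffD1[OF indep_mod_cong, rotated]) (use F a in simp)
  qed
  then have "finite ex" unfolding ex_def using finite_bad by auto
  have "poly p t = 0" if t: "t \<notin> ex" for t
  proof -
    have tb: "t \<notin> bad" using t by (simp add: ex_def)
    have id: "is_ideal (points_ideal (Xt t))" by (simp add: points_ideal_def is_ideal_ideal_gen)
    have dd: "vdim (comp_deg (points_ideal (Xt t)) a) = d a" for a
      by (simp add: vdim_points[OF tb] d_def vdim_Jh)
    have "stiefel_rep N (points_ideal (Xt t)) (Mt t)"
    proof (rule stiefel_repI[OF id, where v = "\<lambda>a j. poly (F a j) (pconst t)"], unfold dd)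
      show "indep_mod {0} (\<lambda>j. poly (F a j) (pconst t)) (d a)" if "a < N" for a using t that by (auto simp: ex_def)
      show "poly (F a j) (pconst t) \<in> comp_deg (points_ideal (Xt t)) a" if "a < N" "j < d a" for a j
        using F that fam_points by blast
    qed (simp add: Mt_def)
    then have "f (Mt t) = 0" using van tb unfolding bad_def by blast
    then show ?thesis using p by simp
  qed
  then have "UNIV - ex \<subseteq> {t. poly p t = 0}" by auto
  moreover have "infinite (UNIV - ex)" using inf \<open>finite ex\<close> by (simp add: Diff_infinite_finite)
  ultimately have "p = 0" using poly_roots_finite[of p] finite_subset by blast
  then show "f M = 0" using p[of 0] M0 by simp
qed

end

section \<open>Points in general position\<close>

lemma digits_inj:
  fixes N :: nat
  assumes "\<And>i. i < k \<Longrightarrow> a i < N" "\<And>i. i < k \<Longrightarrow> b i < N"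
    "(\<Sum>i<k. a i * N ^ i) = (\<Sum>i<k. b i * N ^ i)" "i < k"
  shows "a i = b i"
  using assms
proof (induction k arbitrary: a b i)
  case (Suc k)
  have shift: "(\<Sum>i<Suc k. c i * N ^ i) = c 0 + N * (\<Sum>i<k. c (Suc i) * N ^ i)" for c :: "nat \<Rightarrow> nat"
    unfolding sum.lessThan_Suc_shift by (simp add: sum_distrib_left mult.left_commute)
  have eq: "a 0 + N * (\<Sum>i<k. a (Suc i) * N ^ i) = b 0 + N * (\<Sum>i<k. b (Suc i) * N ^ i)"
    using Suc.prems(3) unfolding shift .
  have ab: "a 0 < N" "b 0 < N" using Suc.prems(1,2)[of 0] by auto
  have "(a 0 + N * (\<Sum>i<k. a (Suc i) * N ^ i)) mod N = (b 0 + N * (\<Sum>i<k. b (Suc i) * N ^ i)) mod N"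
    by (simp only: eq)
  then have 0: "a 0 = b 0" using ab by (simp only: mod_mult_self2 mod_less)
  have "N * (\<Sum>i<k. a (Suc i) * N ^ i) = N * (\<Sum>i<k. b (Suc i) * N ^ i)"
    using eq unfolding 0 by (rule add_left_imp_eq)
  then have eq': "(\<Sum>i<k. a (Suc i) * N ^ i) = (\<Sum>i<k. b (Suc i) * N ^ i)" using ab by simp
  have "a (Suc i) = b (Suc i)" if "i < k" for i
    by (rule Suc.IH[OF _ _ eq' that]) (use Suc.prems(1,2) in blast)+
  then show ?case using 0 Suc.prems(4) by (cases i) auto
qed simp

text \<open>Kronecker substitution: on the curve with coordinates s ^ (N ^ i) distinct monomials of
  small degree restrict to distinct powers of s.\<close>

lemma common_nonzero:
  fixes Fs :: "('n::finite, 'k::field) mpoly set"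
  assumes inf: "infinite (UNIV :: 'k set)" and fin: "finite Fs" and nz: "0 \<notin> Fs"
  shows "\<exists>x. \<forall>F\<in>Fs. eval F x \<noteq> 0"
proof -
  \<comment> \<open>Exceeds every exponent that occurs, so exponent vectors can be read as digits to
    base \<open>N\<close>.\<close>
  define N where "N = Suc (\<Sum>F\<in>Fs. \<Sum>m\<in>Poly_Mapping.keys F. mdeg m)"
  have N: "lk m i < N" if "F \<in> Fs" "m \<in> Poly_Mapping.keys F" for F m i
  proof -
    have "lk m i \<le> mdeg m" unfolding mdeg_def by (rule member_le_sum) auto
    also have "\<dots> \<le> (\<Sum>m\<in>Poly_Mapping.keys F. mdeg m)" by (rule member_le_sum) (use that in auto)
    also have "\<dots> \<le> (\<Sum>F\<in>Fs. \<Sum>m\<in>Poly_Mapping.keys F. mdeg m)"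
      by (rule member_le_sum[of F Fs "\<lambda>F. \<Sum>m\<in>Poly_Mapping.keys F. mdeg m"]) (use that fin in auto)
    finally show ?thesis by (simp add: N_def)
  qed
  obtain h :: "'n \<Rightarrow> nat" where h: "bij_betw h UNIV {0..<CARD('n)}"
    using ex_bij_betw_finite_nat[of "UNIV :: 'n set"] by auto
  define w where "w m = (\<Sum>i\<in>UNIV. lk m i * N ^ h i)" for m :: "'n \<Rightarrow>\<^sub>0 nat"
  have w: "w m = (\<Sum>k<CARD('n). lk m (inv_into UNIV h k) * N ^ k)" for m
  proof -
    have "w m = (\<Sum>i\<in>UNIV. lk m (inv_into UNIV h (h i)) * N ^ h i)"
      unfolding w_def using h by (intro sum.cong refl) (simp add: bij_betw_def)
    also have "\<dots> = (\<Sum>k\<in>{0..<CARD('n)}. lk m (inv_into UNIV h k) * N ^ k)"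
      by (rule sum.reindex_bij_betw[OF h])
    finally show ?thesis by (simp add: atLeast0LessThan)
  qed
  have inj: "m = m'" if F: "F \<in> Fs" and m: "m \<in> Poly_Mapping.keys F" "m' \<in> Poly_Mapping.keys F" and eq: "w m = w m'" for F m m'
  proof (rule poly_mapping_eqI)
    fix i
    have hi: "h i < CARD('n)" "inv_into UNIV h (h i) = i" using h by (auto simp: bij_betw_def)
    have "lk m (inv_into UNIV h (h i)) = lk m' (inv_into UNIV h (h i))"
      by (rule digits_inj[of "CARD('n)" "\<lambda>k. lk m (inv_into UNIV h k)" N "\<lambda>k. lk m' (inv_into UNIV h k)"])
        (use N[OF F m(1)] N[OF F m(2)] eq hi(1) in \<open>simp_all add: w\<close>)
    then show "lk m i = lk m' i" by (simp only: hi(2))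
  qed
  define x where "x s i = s ^ (N ^ h i)" for s :: 'k and i
  define U where "U F = (\<Sum>m\<in>Poly_Mapping.keys F. monom (lk F m) (w m))" for F :: "('n, 'k) mpoly"
  have mx: "monv (x s) m = s ^ w m" for s m
    unfolding monv_def x_def w_def power_sum by (simp add: power_mult[symmetric] mult.commute)
  have ev: "eval F (x s) = poly (U F) s" for F s
    unfolding eval_superset[OF finite_keys order_refl] U_def by (simp add: poly_sum poly_monom mx)
  have U0: "U F \<noteq> 0" if F: "F \<in> Fs" for F
  proof -
    have "F \<noteq> 0" using F nz by blast
    then obtain m where m: "m \<in> Poly_Mapping.keys F"
      by (metis lookup_eq_zero_in_keys_contradict not_in_keys_iff_lookup_eq_zero poly_mapping_eqI lookup_zero)
    have "coeff (U F) (w m) = (\<Sum>m'\<in>Poly_Mapping.keys F. if m' = m then lk F m' else 0)"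
      unfolding U_def coeff_sum by (intro sum.cong refl) (use inj[OF F _ m] in auto)
    also have "\<dots> = lk F m" using m by (simp add: sum.delta)
    finally show ?thesis using m by (metis coeff_0 in_keys_iff)
  qed
  have "finite (\<Union>F\<in>Fs. {s. poly (U F) s = 0})" using fin U0 poly_roots_finite by blast
  then obtain s where "s \<notin> (\<Union>F\<in>Fs. {s. poly (U F) s = 0})" using inf ex_new_if_finite by blast
  then show ?thesis using ev by (intro exI[of _ "x s"]) auto
qed

lemma form_through_points:
  fixes x :: "nat \<Rightarrow> 'n::finite \<Rightarrow> 'k::field"
  assumes "m < vdim (Sdeg a :: ('n, 'k) mpoly set)"
  shows "\<exists>G\<in>Sdeg a. G \<noteq> 0 \<and> (\<forall>i<m. eval G (x i) = 0)"
proof -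
  let ?Mn = "{m :: 'n \<Rightarrow>\<^sub>0 nat. mdeg m = a}"
  have "card {..<m} < card ?Mn" using assms by (simp add: vdim_Sdeg)
  from hom_system[OF _ _ this, of "\<lambda>i m. monv (x i) m"]
  obtain u where u: "\<exists>b\<in>?Mn. u b \<noteq> 0" "\<forall>i\<in>{..<m}. (\<Sum>b\<in>?Mn. monv (x i) b * u b) = 0" by auto
  define G where "G = (\<Sum>m\<in>?Mn. Poly_Mapping.single m (u m))"
  have lkG: "lk G m = (if m \<in> ?Mn then u m else 0)" for m
    by (simp add: G_def lookup_sum lookup_single when_def sum.delta)
  have G: "G \<in> Sdeg a" by (auto simp: Sdeg_iff lkG)
  obtain b where "b \<in> ?Mn" "u b \<noteq> 0" using u(1) by blast
  then have "G \<noteq> 0" using lkG[of b] by auto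
  moreover have "eval G (x i) = 0" if "i < m" for i
    using u(2) that by (simp add: eval_Sdeg[OF G] lkG mult.commute)
  ultimately show ?thesis using G by blast
qed

text \<open>At \<open>t0\<close> the evaluation matrix is triangular with nonzero diagonal. Its
  determinant is a polynomial in t, so the rank drops for finitely many t only.\<close>

lemma generic_rank:
  fixes xp :: "nat \<Rightarrow> 'k::field \<Rightarrow> 'n::finite \<Rightarrow> 'k" and G :: "nat \<Rightarrow> ('n, 'k) mpoly"
  assumes arc: "\<And>j i. \<exists>p. \<forall>t. xp j t i = poly p t"
    and tri: "\<And>u v. u < \<rho> \<Longrightarrow> v < u \<Longrightarrow> eval (G u) (xp v t0) = 0" "\<And>u. u < \<rho> \<Longrightarrow> eval (G u) (xp u t0) \<noteq> 0"
  shows "finite {t. \<exists>b. (\<forall>v<\<rho>. (\<Sum>u<\<rho>. b u * eval (G u) (xp v t)) = 0) \<and> (\<exists>u<\<rho>. b u \<noteq> 0)}"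
proof -
  define B where "B t = mat \<rho> \<rho> (\<lambda>(v, u). eval (G u) (xp v t))" for t
  have "\<forall>u v. \<exists>p. \<forall>t. eval (G u) (xp v t) = poly p t"
    using polyfun_on_curve[OF polyfun_eval] arc by blast
  then obtain q where q: "\<And>u v t. eval (G u) (xp v t) = poly (q u v) t" by metis
  have "(\<lambda>x :: unit \<Rightarrow> 'k. det (mat \<rho> \<rho> (\<lambda>(v, u). poly (q u v) (x ())))) \<in> polyfun"
    by (rule polyfun_det) (rule polyfun_poly, rule pf_var)
  then have "\<exists>p. \<forall>t. det (mat \<rho> \<rho> (\<lambda>(v, u). poly (q u v) t)) = poly p t"
    by (rule polyfun_on_curve[of _ "\<lambda>t _. t"]) (auto intro: exI[of _ "[:0, 1:]"])
  then obtain p where p: "\<And>t. det (B t) = poly p t" unfolding B_def q by blast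
  have "det (B t0) = prod_list (diag_mat (B t0))"
    by (rule det_lower_triangular[of \<rho>]) (use tri(1) in \<open>auto simp: B_def\<close>)
  also have "\<dots> \<noteq> 0"
    using tri(2) by (auto simp: prod_list_zero_iff diag_mat_def B_def)
  finally have "p \<noteq> 0" using p by auto
  then have "finite {t. poly p t = 0}" by (rule poly_roots_finite)
  moreover have "poly p t = 0" if b: "\<forall>v<\<rho>. (\<Sum>u<\<rho>. b u * eval (G u) (xp v t)) = 0" "u < \<rho>" "b u \<noteq> 0" for t b u
  proof -
    have "B t *\<^sub>v vec \<rho> b = 0\<^sub>v \<rho>"
      by (rule eq_vecI) (use b(1) in \<open>auto simp: B_def scalar_prod_def atLeast0LessThan mult.commute\<close>)
    moreover have "vec \<rho> b \<noteq> 0\<^sub>v \<rho>"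
    proof
      assume "vec \<rho> b = 0\<^sub>v \<rho>"
      then have "vec \<rho> b $ u = 0\<^sub>v \<rho> $ u" by (rule arg_cong)
      then show False using b(2,3) by simp
    qed
    ultimately have "det (B t) = 0"
      by (intro det_0_iff_vec_prod_zero_field[THEN iffD2, of _ \<rho>] exI[of _ "vec \<rho> b"] conjI)
        (simp_all add: B_def)
    then show ?thesis using p by simp
  qed
  ultimately show ?thesis by (rule_tac finite_subset) auto
qed

lemma homog_ideal_points_ideal: "homog_ideal (points_ideal X)"
proof -
  have id: "is_ideal (points_ideal X)" by (simp add: points_ideal_def is_ideal_ideal_gen)
  have "points_ideal X \<subseteq> ideal_gen {p \<in> points_ideal X. \<exists>a. homog a p}"
    by (subst (1) points_ideal_def, rule ideal_gen_least[OF is_ideal_ideal_gen])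
      (auto intro!: ideal_gen_superset simp: points_ideal_def)
  then show ?thesis using id ideal_gen_least[OF id, of "{p \<in> points_ideal X. \<exists>a. homog a p}"]
    by (auto simp: homog_ideal_def)
qed

text \<open>The r points impose at most r conditions. Forms that are independent as functions on
  \<open>X\<close> remain independent modulo the ideal, which gives the lower bound.\<close>

lemma points_codim:
  fixes X :: "('n::finite \<Rightarrow> 'k::field) set" and G :: "nat \<Rightarrow> ('n, 'k) mpoly"
  defines "s \<equiv> \<lambda>a. vdim (Sdeg a :: ('n, 'k) mpoly set)"
  assumes X: "finite X" "card X = r"
    and G: "\<And>u. u < min (s a) r \<Longrightarrow> G u \<in> Sdeg a"
      "\<And>b u. (\<And>x. x \<in> X \<Longrightarrow> (\<Sum>u<min (s a) r. b u * eval (G u) x) = 0) \<Longrightarrow> u < min (s a) r \<Longrightarrow> b u = 0"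
  shows "s a - vdim (comp_deg (points_ideal X) a) = min (s a) r"
proof (rule antisym)
  let ?J = "comp_deg (points_ideal X) a"
  have id: "is_ideal (points_ideal X)" by (simp add: points_ideal_def is_ideal_ideal_gen)
  have "s a - vdim ?J \<le> r"
  proof (rule ccontr)
    assume "\<not> ?thesis"
    then have lt: "card X < card {..<s a - vdim ?J}" using X by simp
    obtain H where H: "indep_mod ?J H (s a - vdim ?J)" "\<And>u. u < s a - vdim ?J \<Longrightarrow> H u \<in> Sdeg a"
      unfolding s_def by (rule indep_mod_exists[OF subsp_comp_deg[OF id, of a] comp_deg_subset[of "points_ideal X" a]]) (rule that[unfolded s_def], assumption+)
    from hom_system[OF X(1) _ lt, of "\<lambda>x u. eval (H u) x"]
    obtain b where b: "\<exists>u\<in>{..<s a - vdim ?J}. b u \<noteq> 0" "\<forall>x\<in>X. (\<Sum>u\<in>{..<s a - vdim ?J}. eval (H u) x * b u) = 0" by auto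
    have "(\<Sum>u<s a - vdim ?J. scale (b u) (H u)) \<in> ?J"
    proof -
      have "(\<Sum>u<s a - vdim ?J. scale (b u) (H u)) \<in> Sdeg a" by (intro Sdeg_sum Sdeg_scale H(2)) simp
      moreover have "eval (\<Sum>u<s a - vdim ?J. scale (b u) (H u)) x = 0" if "x \<in> X" for x
        using b(2) that by (simp add: eval_sum mult.commute)
      ultimately show ?thesis unfolding comp_deg_points_ideal by blast
    qed
    then show False using b(1) indep_modD[OF H(1)] by blast
  qed
  then show "s a - vdim ?J \<le> min (s a) r" by simp
  have "indep_mod ?J G (min (s a) r)"
    unfolding indep_mod_def
  proof (intro allI impI)
    fix b u assume b: "(\<Sum>u<min (s a) r. scale (b u) (G u)) \<in> ?J" and u: "u < min (s a) r"
    show "b u = 0"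
    proof (rule G(2)[OF _ u])
      fix x assume "x \<in> X"
      then have "eval (\<Sum>u<min (s a) r. scale (b u) (G u)) x = 0" using b by (simp add: comp_deg_points_ideal)
      then show "(\<Sum>u<min (s a) r. b u * eval (G u) x) = 0" by (simp add: eval_sum)
    qed
  qed
  from indep_mod_le[OF subsp_comp_deg[OF id] comp_deg_subset this G(1)]
  show "min (s a) r \<le> s a - vdim ?J" by (simp add: s_def)
qed

section \<open>Arcs from general points to the line\<close>

context coords
begin

text \<open>The points are chosen one after another. The next avoids y 0 = 0, the loci with an
  already used value of y 1 / y 0, and, for each degree whose dimension is not exhausted, one form
  through all previous points. The resulting evaluation matrices are triangular.\<close>

lemma general_points:
  assumes inf: "infinite (UNIV :: 'k set)"
  shows "\<exists>x :: nat \<Rightarrow> 'n \<Rightarrow> 'k. \<forall>j<m. eval (y 0) (x j) \<noteq> 0 \<and>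
    (\<forall>i<j. eval (y 1) (x j) * eval (y 0) (x i) \<noteq> eval (y 1) (x i) * eval (y 0) (x j)) \<and>
    (\<forall>a\<le>R. j < vdim (Sdeg a :: ('n, 'k) mpoly set) \<longrightarrow>
      (\<exists>G\<in>Sdeg a. (\<forall>i<j. eval G (x i) = 0) \<and> eval G (x j) \<noteq> 0))"
proof (induction m)
  case (Suc m)
  define Q where "Q x j \<longleftrightarrow> eval (y 0) (x j) \<noteq> 0 \<and>
    (\<forall>i<j. eval (y 1) (x j) * eval (y 0) (x i) \<noteq> eval (y 1) (x i) * eval (y 0) (x j)) \<and>
    (\<forall>a\<le>R. j < vdim (Sdeg a :: ('n, 'k) mpoly set) \<longrightarrow>
      (\<exists>G\<in>Sdeg a. (\<forall>i<j. eval G (x i) = 0) \<and> eval G (x j) \<noteq> 0))" for x :: "nat \<Rightarrow> 'n \<Rightarrow> 'k" and j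
  obtain x where x: "\<forall>j<m. Q x j" using Suc.IH unfolding Q_def by blast
  have "\<forall>a. \<exists>G. m < vdim (Sdeg a :: ('n, 'k) mpoly set) \<longrightarrow>
      G \<in> Sdeg a \<and> G \<noteq> 0 \<and> (\<forall>i<m. eval G (x i) = 0)"
    using form_through_points by blast
  from choice[OF this] obtain G where G: "\<forall>a. m < vdim (Sdeg a :: ('n, 'k) mpoly set) \<longrightarrow>
      G a \<in> Sdeg a \<and> G a \<noteq> 0 \<and> (\<forall>i<m. eval (G a) (x i) = 0)" ..
  define L where "L i = scale (eval (y 0) (x i)) (y 1) - scale (eval (y 1) (x i)) (y 0)" for i
  define Fs where "Fs = insert (y 0) (L ` {..<m} \<union> G ` {a. a \<le> R \<and> m < vdim (Sdeg a :: ('n, 'k) mpoly set)})"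
  have "finite {a. a \<le> R \<and> m < vdim (Sdeg a :: ('n, 'k) mpoly set)}" by (rule finite_subset[of _ "{..R}"]) auto
  then have "finite Fs" by (simp add: Fs_def)
  moreover have "0 \<notin> Fs"
  proof -
    have "y 0 \<noteq> 0"
    proof
      assume "y 0 = 0"
      then have "eval (y 0) (pt (\<lambda>_. 1)) = 0" by (simp only: eval_0)
      then show False using eval_y_pt[of 0 "\<lambda>_. 1"] by simp
    qed
    moreover have "L i \<noteq> 0" if "i < m" for i
    proof -
      have "eval (L i) (pt (\<lambda>j. if j = 1 then 1 else 0)) = eval (y 0) (x i)"
        unfolding L_def using eval_y_pt[of 1] eval_y_pt[of 0] by simp
      then show ?thesis using x that unfolding Q_def by auto
    qed
    ultimately show ?thesis using G unfolding Fs_def by auto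
  qed
  ultimately obtain z where z: "\<forall>F\<in>Fs. eval F z \<noteq> 0" using common_nonzero[OF inf] by blast
  define x' where "x' = x(m := z)"
  have x'j: "x' i = x i" if "i < m" for i using that by (simp add: x'_def)
  have "Q x' j" if j: "j < m" for j
  proof -
    have xj: "x' j = x j" and xi: "\<And>i. i < j \<Longrightarrow> x' i = x i" using x'j j by simp_all
    have Qx: "Q x j" using x j by blast
    show ?thesis
      unfolding Q_def xj
    proof (intro conjI allI impI)
      show "eval (y 0) (x j) \<noteq> 0" using Qx unfolding Q_def by blast
      show "eval (y 1) (x j) * eval (y 0) (x' i) \<noteq> eval (y 1) (x' i) * eval (y 0) (x j)" if "i < j" for i
        using Qx that unfolding Q_def xi[OF that] by blast
      show "\<exists>G\<in>Sdeg a. (\<forall>i<j. eval G (x' i) = 0) \<and> eval G (x j) \<noteq> 0"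
        if aR: "a \<le> R" "j < vdim (Sdeg a :: ('n, 'k) mpoly set)" for a
      proof -
        obtain H where "H \<in> Sdeg a" "\<forall>i<j. eval H (x i) = 0" "eval H (x j) \<noteq> 0"
          using Qx aR unfolding Q_def by blast
        then show ?thesis using xi by (intro bexI[of _ H]) simp_all
      qed
    qed
  qed
  moreover have "Q x' m"
    unfolding Q_def
  proof (intro conjI allI impI)
    show "eval (y 0) (x' m) \<noteq> 0" using z by (simp add: x'_def Fs_def)
    show "eval (y 1) (x' m) * eval (y 0) (x' i) \<noteq> eval (y 1) (x' i) * eval (y 0) (x' m)" if "i < m" for i
    proof -
      have "eval (L i) z \<noteq> 0" using z that by (simp add: Fs_def)
      then show ?thesis using that by (simp add: x'_def L_def mult.commute)
    qed
    show "\<exists>G\<in>Sdeg a. (\<forall>i<m. eval G (x' i) = 0) \<and> eval G (x' m) \<noteq> 0"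
      if a: "a \<le> R" "m < vdim (Sdeg a :: ('n, 'k) mpoly set)" for a
    proof (intro bexI[of _ "G a"] conjI allI impI)
      show "eval (G a) (x' i) = 0" if "i < m" for i using G a(2) that by (simp add: x'_def)
      show "eval (G a) (x' m) \<noteq> 0" using z a by (simp add: x'_def Fs_def)
    qed (use G a in blast)
  qed
  ultimately show ?case unfolding Q_def[symmetric] by (intro exI[of _ x']) (auto simp: less_Suc_eq)
qed simp

text \<open>A family of curves parametrized by s. At t = 0 it is the line, \<open>P\<close> is the
  first-order displacement, and \<open>Q\<close> is a correction invisible to first order that
  adjusts the curve at t = 1.\<close>

definition cv :: "(nat \<Rightarrow> 'k poly) \<Rightarrow> (nat \<Rightarrow> 'k poly) \<Rightarrow> 'k \<Rightarrow> 'k \<Rightarrow> 'n \<Rightarrow> 'k" where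
  "cv P Q t s = pt (\<lambda>l. if l = 0 then 1 else if l = 1 then s else t * poly (P (l - 2)) s + t\<^sup>2 * poly (Q (l - 2)) s)"

lemma eval_cv [simp]:
  "eval (y 0) (cv P Q t s) = 1" "eval (y 1) (cv P Q t s) = s" "eval (y (Suc 0)) (cv P Q t s) = s"
  "i < n \<Longrightarrow> eval (y (i + 2)) (cv P Q t s) = t * poly (P i) s + t\<^sup>2 * poly (Q i) s"
  using eval_y_pt[of "i + 2"] eval_y_pt[of 0] eval_y_pt[of 1] by (simp_all add: cv_def)

lemma cv_arc: "\<exists>p. \<forall>t. cv P Q t (b + t * d) i = poly p t"
proof -
  define p where "p l = (if l = 0 then 1 else if l = 1 then [:b, d:]
    else [:0, 1:] * pcompose (P (l - 2)) [:b, d:] + [:0, 1:] ^ 2 * pcompose (Q (l - 2)) [:b, d:])" for l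
  have "cv P Q t (b + t * d) i = poly (\<Sum>j<n + 2. smult (c i j) (p j)) t" for t
    unfolding cv_def pt_def poly_sum poly_smult
    by (intro sum.cong refl) (simp add: p_def poly_pcompose power2_eq_square algebra_simps)
  then show ?thesis by blast
qed

lemma interpolation_poly:
  fixes \<eta> v :: "nat \<Rightarrow> 'a::field"
  assumes "inj_on \<eta> {..<m}"
  shows "\<exists>p. \<forall>j<m. poly p (\<eta> j) = v j"
  using assms
proof (induction m)
  case (Suc m)
  then obtain p where p: "\<forall>j<m. poly p (\<eta> j) = v j" by (auto simp: inj_on_def)
  define w where "w = (\<Prod>j<m. [:- \<eta> j, 1:])"
  have w0: "poly w (\<eta> j) = 0" if "j < m" for j using that by (auto simp: w_def poly_prod)
  have "\<eta> m \<noteq> \<eta> j" if "j < m" for j using inj_onD[OF Suc.prems, of m j] that by auto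
  then have w1: "poly w (\<eta> m) \<noteq> 0" by (auto simp: w_def poly_prod)
  show ?case
    by (rule exI[of _ "p + smult ((v m - poly p (\<eta> m)) / poly w (\<eta> m)) w"])
      (use p w0 w1 in \<open>auto simp: less_Suc_eq\<close>)
qed simp

lemma cv_distinct_points:
  assumes "inj_on s {..<r}"
  shows "distinct_proj_points r ((\<lambda>j. cv P Q t (s j)) ` {..<r})"
  unfolding distinct_proj_points_def
proof (intro conjI ballI impI)
  have "inj_on (\<lambda>j. cv P Q t (s j)) {..<r}"
  proof (rule inj_onI)
    fix i j assume ij: "i \<in> {..<r}" "j \<in> {..<r}" and "cv P Q t (s i) = cv P Q t (s j)"
    then have "eval (y 1) (cv P Q t (s i)) = eval (y 1) (cv P Q t (s j))" by simp
    then have "s i = s j" by (simp only: eval_cv)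
    then show "i = j" using assms ij by (auto dest: inj_onD)
  qed
  then show "card ((\<lambda>j. cv P Q t (s j)) ` {..<r}) = r" by (simp add: card_image)
  fix x assume "x \<in> (\<lambda>j. cv P Q t (s j)) ` {..<r}"
  then have x: "eval (y 0) x = 1" by auto
  show "\<exists>i. x i \<noteq> 0"
  proof (rule ccontr)
    assume "\<not> ?thesis"
    then have "x = (\<lambda>i. 0 * x i)" by auto
    then have "eval (y 0) x = 0 ^ 1 * eval (y 0) x" using eval_homog[OF y01_Sdeg(1), of 0 x] by metis
    then show False using x by simp
  qed
  fix x' assume "x' \<in> (\<lambda>j. cv P Q t (s j)) ` {..<r}"
  then have x': "eval (y 0) x' = 1" by auto
  assume "\<exists>b. x' = (\<lambda>i. b * x i)"
  then obtain b where b: "x' = (\<lambda>i. b * x i)" by blast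
  have "b = 1" using eval_homog[OF y01_Sdeg(1), of b x] x x' unfolding b by simp
  then show "x = x'" using b by simp
qed simp

text \<open>At t = 0 the nodes are the prescribed, possibly equal \<open>\<xi> j\<close>; at t = 1
  the arcs pass through points in general position. Distinctness and the Hilbert function are open
  conditions satisfied at t = 1, hence for all but finitely many t.\<close>

lemma arc_exists:
  assumes inf: "infinite (UNIV :: 'k set)"
  shows "\<exists>\<eta> Q. inj_on \<eta> {..<r} \<and> limit_arc (\<lambda>j t. cv P Q t (\<xi> j + t * (\<eta> j - \<xi> j))) r"
proof -
  obtain x :: "nat \<Rightarrow> 'n \<Rightarrow> 'k" where x: "\<forall>j<r. eval (y 0) (x j) \<noteq> 0 \<and>
    (\<forall>i<j. eval (y 1) (x j) * eval (y 0) (x i) \<noteq> eval (y 1) (x i) * eval (y 0) (x j)) \<and>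
    (\<forall>a\<le>r. j < vdim (Sdeg a :: ('n, 'k) mpoly set) \<longrightarrow>
      (\<exists>G\<in>Sdeg a. (\<forall>i<j. eval G (x i) = 0) \<and> eval G (x j) \<noteq> 0))"
    using general_points[OF inf, of r r] by blast
  define \<eta> where "\<eta> j = eval (y 1) (x j) / eval (y 0) (x j)" for j
  have ne: "\<eta> i \<noteq> \<eta> j" if "i < j" "j < r" for i j
  proof -
    have nz: "eval (y 0) (x j) \<noteq> 0" "eval (y 0) (x i) \<noteq> 0" using x that by auto
    have "eval (y 1) (x j) * eval (y 0) (x i) \<noteq> eval (y 1) (x i) * eval (y 0) (x j)" using x that by blast
    then show ?thesis using nz by (simp add: \<eta>_def frac_eq_eq)
  qed
  have inj: "inj_on \<eta> {..<r}"
  proof (rule inj_onI, rule ccontr)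
    fix i j assume ij: "i \<in> {..<r}" "j \<in> {..<r}" "\<eta> i = \<eta> j" "i \<noteq> j"
    then consider "i < j" | "j < i" by linarith
    then show False using ne[of i j] ne[of j i] ij by cases auto
  qed
  have "\<forall>i. \<exists>q. \<forall>j<r. poly q (\<eta> j) = eval (y (i + 2)) (x j) / eval (y 0) (x j) - poly (P i) (\<eta> j)"
    by (intro allI interpolation_poly[OF inj])
  \<comment> \<open>\<open>Q\<close> interpolates what \<open>P\<close> lacks at the distinct nodes,
    so that at t = 1 the curve passes through all the chosen points.\<close>
  from choice[OF this] obtain Q where Q: "\<forall>i. \<forall>j<r. poly (Q i) (\<eta> j) = eval (y (i + 2)) (x j) / eval (y 0) (x j) - poly (P i) (\<eta> j)" ..
  define xp where "xp j t = cv P Q t (\<xi> j + t * (\<eta> j - \<xi> j))" for j t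
  have x1: "xp j 1 = (\<lambda>i. (1 / eval (y 0) (x j)) * x j i)" if j: "j < r" for j
  proof -
    let ?x = "\<lambda>i. (1 / eval (y 0) (x j)) * x j i"
    have nz: "eval (y 0) (x j) \<noteq> 0" using x j by blast
    have ev: "eval (y l) ?x = eval (y l) (x j) / eval (y 0) (x j)" if "l < n + 2" for l
      using eval_homog[OF y_Sdeg[OF that], of "1 / eval (y 0) (x j)" "x j"] by simp
    have "pt (\<lambda>l. if l = 0 then 1 else if l = 1 then \<eta> j else poly (P (l - 2)) (\<eta> j) + poly (Q (l - 2)) (\<eta> j))
      = pt (\<lambda>l. eval (y l) ?x)"
      unfolding pt_def
    proof (intro ext sum.cong refl arg_cong2[where f = "(*)"])
      fix l assume l: "l \<in> {..<n + 2}"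
      have "poly (Q (l - 2)) (\<eta> j) = eval (y (l - 2 + 2)) (x j) / eval (y 0) (x j) - poly (P (l - 2)) (\<eta> j)"
        using Q j by blast
      moreover have "\<not> l < 2 \<Longrightarrow> l - 2 + 2 = l" by simp
      ultimately show "(if l = 0 then 1 else if l = 1 then \<eta> j else poly (P (l - 2)) (\<eta> j) + poly (Q (l - 2)) (\<eta> j)) = eval (y l) ?x"
        using ev[of l] l nz by (cases "l < 2") (auto simp: \<eta>_def less_2_cases_iff simp del: add_2_eq_Suc add_2_eq_Suc')
    qed
    then show ?thesis unfolding pt_eval by (simp add: xp_def cv_def cong: if_cong)
  qed
  have arc: "\<exists>p. \<forall>t. xp j t i = poly p t" for j i
    unfolding xp_def by (rule cv_arc)
  \<comment> \<open>Times at which two nodes meet. The linear polynomial is nonzero because its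
    value at t = 1 is the difference of two distinct \<open>\<eta>\<close>.\<close>
  define bad1 where "bad1 = (\<Union>i<r. \<Union>j<i. {t. poly [:\<xi> i - \<xi> j, (\<eta> i - \<xi> i) - (\<eta> j - \<xi> j):] t = 0})"
  have "finite bad1"
    unfolding bad1_def
  proof (intro finite_UN_I finite_lessThan poly_roots_finite notI)
    fix i j assume ij: "i \<in> {..<r}" "j \<in> {..<i}" "[:\<xi> i - \<xi> j, (\<eta> i - \<xi> i) - (\<eta> j - \<xi> j):] = 0"
    then have "\<eta> i = \<eta> j" by (auto simp: algebra_simps)
    then show False using ne[of j i] ij by auto
  qed
  have "\<forall>q. \<exists>G. fst q \<le> r \<and> snd q < min (vdim (Sdeg (fst q) :: ('n, 'k) mpoly set)) r \<longrightarrow>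
    G \<in> Sdeg (fst q) \<and> (\<forall>i<snd q. eval G (x i) = 0) \<and> eval G (x (snd q)) \<noteq> 0"
  proof
    fix q :: "nat \<times> nat"
    show "\<exists>G. fst q \<le> r \<and> snd q < min (vdim (Sdeg (fst q) :: ('n, 'k) mpoly set)) r \<longrightarrow>
      G \<in> Sdeg (fst q) \<and> (\<forall>i<snd q. eval G (x i) = 0) \<and> eval G (x (snd q)) \<noteq> 0"
    proof (cases "fst q \<le> r \<and> snd q < min (vdim (Sdeg (fst q) :: ('n, 'k) mpoly set)) r")
      case True
      then have "snd q < r" "fst q \<le> r" "snd q < vdim (Sdeg (fst q) :: ('n, 'k) mpoly set)" by auto
      then show ?thesis using x by blast
    qed blast
  qed
  from choice[OF this] obtain G' where G': "\<forall>q. fst q \<le> r \<and> snd q < min (vdim (Sdeg (fst q) :: ('n, 'k) mpoly set)) r \<longrightarrow>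
    G' q \<in> Sdeg (fst q) \<and> (\<forall>i<snd q. eval (G' q) (x i) = 0) \<and> eval (G' q) (x (snd q)) \<noteq> 0" ..
  define G where "G a u = G' (a, u)" for a u
  have G: "G a u \<in> Sdeg a \<and> (\<forall>i<u. eval (G a u) (x i) = 0) \<and> eval (G a u) (x u) \<noteq> 0"
    if "a \<le> r" "u < min (vdim (Sdeg a :: ('n, 'k) mpoly set)) r" for a u
    using G'[rule_format, of "(a, u)"] that unfolding G_def by simp
  define \<rho> where "\<rho> a = min (vdim (Sdeg a :: ('n, 'k) mpoly set)) r" for a
  define bad2 where "bad2 = (\<Union>a\<le>r. {t. \<exists>b. (\<forall>v<\<rho> a. (\<Sum>u<\<rho> a. b u * eval (G a u) (xp v t)) = 0) \<and> (\<exists>u<\<rho> a. b u \<noteq> 0)})"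
  have "finite bad2"
    unfolding bad2_def
  proof (intro finite_UN_I finite_atMost)
    fix a assume "a \<in> {..r}"
    then have a: "a \<le> r" by simp
    have hom: "eval (G a u) (xp v 1) = (1 / eval (y 0) (x v)) ^ a * eval (G a u) (x v)" if "u < \<rho> a" "v < r" for u v
      unfolding x1[OF that(2)] by (rule eval_homog) (use G[OF a] that in \<open>simp add: \<rho>_def\<close>)
    show "finite {t. \<exists>b. (\<forall>v<\<rho> a. (\<Sum>u<\<rho> a. b u * eval (G a u) (xp v t)) = 0) \<and> (\<exists>u<\<rho> a. b u \<noteq> 0)}"
    proof (rule generic_rank[OF arc, where ?t0.0 = 1])
      fix u v assume uv: "u < \<rho> a" "v < u"
      then have "v < r" by (simp add: \<rho>_def)
      then show "eval (G a u) (xp v 1) = 0" using hom[OF uv(1)] G[OF a, of u] uv by (simp add: \<rho>_def)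
    next
      fix u assume u: "u < \<rho> a"
      then have ur: "u < r" by (simp add: \<rho>_def)
      then have "eval (y 0) (x u) \<noteq> 0" using x by blast
      then show "eval (G a u) (xp u 1) \<noteq> 0" using hom[OF u ur] G[OF a, of u] u by (simp add: \<rho>_def)
    qed
  qed
  have good: "distinct_proj_points r ((\<lambda>j. xp j t) ` {..<r}) \<and>
      points_ideal ((\<lambda>j. xp j t) ` {..<r}) \<in> Hilb (h_rn TYPE('n) TYPE('k) r)" if t: "t \<notin> bad1 \<union> bad2" for t
  proof
    let ?X = "(\<lambda>j. xp j t) ` {..<r}" let ?s = "\<lambda>j. \<xi> j + t * (\<eta> j - \<xi> j)"
    have sne: "?s i \<noteq> ?s j" if "j < i" "i < r" for i j
    proof
      assume "?s i = ?s j"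
      then have "poly [:\<xi> i - \<xi> j, (\<eta> i - \<xi> i) - (\<eta> j - \<xi> j):] t = 0" by (simp add: algebra_simps)
      then show False using t that unfolding bad1_def by blast
    qed
    have sinj: "inj_on ?s {..<r}"
    proof (rule inj_onI, rule ccontr)
      fix i j assume ij: "i \<in> {..<r}" "j \<in> {..<r}" "?s i = ?s j" "i \<noteq> j"
      then consider "i < j" | "j < i" by linarith
      then show False using sne[of i j] sne[of j i] ij by cases auto
    qed
    show dX: "distinct_proj_points r ?X" unfolding xp_def by (rule cv_distinct_points[OF sinj])
    then have X: "finite ?X" "card ?X = r" by (auto simp: distinct_proj_points_def)
    have "vdim (Sdeg a :: ('n, 'k) mpoly set) - vdim (comp_deg (points_ideal ?X) a) = min (vdim (Sdeg a :: ('n, 'k) mpoly set)) r" for a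
    proof (cases "a \<le> r")
      case True
      show ?thesis
      proof (rule points_codim[OF X, of a "G a"])
        show "G a u \<in> Sdeg a" if "u < min (vdim (Sdeg a :: ('n, 'k) mpoly set)) r" for u using G[OF True that] by blast
        fix b u assume b: "\<And>x. x \<in> ?X \<Longrightarrow> (\<Sum>u<min (vdim (Sdeg a :: ('n, 'k) mpoly set)) r. b u * eval (G a u) x) = 0"
          and u: "u < min (vdim (Sdeg a :: ('n, 'k) mpoly set)) r"
        have "\<forall>v<\<rho> a. (\<Sum>u<\<rho> a. b u * eval (G a u) (xp v t)) = 0" using b unfolding \<rho>_def by simp
        then show "b u = 0" using t True u unfolding bad2_def \<rho>_def by blast
      qed
    next
      case False
      \<comment> \<open>In degrees above r distinct nodes suffice, by divisibility as for a
        Vandermonde matrix. So only finitely many degrees had to be made generic.\<close>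
      then have ra: "r \<le> Suc a" "min (vdim (Sdeg a :: ('n, 'k) mpoly set)) r = r"
        using vdim_Sdeg_ge[OF inf, of a] by auto
      show ?thesis
      proof (rule points_codim[OF X, of a "\<lambda>u. hh a (monom 1 u)"])
        fix b u assume b: "\<And>x. x \<in> ?X \<Longrightarrow> (\<Sum>u<min (vdim (Sdeg a :: ('n, 'k) mpoly set)) r. b u * eval (hh a (monom 1 u)) x) = 0"
          and "u < min (vdim (Sdeg a :: ('n, 'k) mpoly set)) r"
        then have u: "u < r" by simp
        let ?p = "\<Sum>u<r. monom (b u) u"
        have "poly ?p (?s v) = 0" if v: "v < r" for v
        proof -
          have "eval (hh a (monom 1 u)) (xp v t) = ?s v ^ u" if "u < r" for u
            by (subst eval_hz) (use that ra in \<open>auto simp: xp_def poly_monom intro: order_trans[OF degree_monom_le]\<close>)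
          then show ?thesis using b[of "xp v t"] v ra(2) by (simp add: poly_sum poly_monom)
        qed
        then have dvd: "(\<Prod>v<r. [:- ?s v, 1:]) dvd ?p" by (intro prod_linear_dvd sinj) auto
        have deg: "degree (\<Prod>v<r. [:- ?s v, 1:]) = r" using degree_prod_linear(1)[of ?s "{..<r}"] by simp
        have "degree ?p \<le> r - 1"
          by (rule degree_sum_le) (auto intro: order_trans[OF degree_monom_le])
        then have "degree ?p < r" using u by simp
        then have "?p = 0" using dvd_imp_degree_le[OF dvd] unfolding deg by (meson not_le)
        then have "coeff ?p u = 0" by simp
        then show "b u = 0" using u by (simp add: coeff_sum sum.delta)
      qed simp
    qed
    then show "points_ideal ?X \<in> Hilb (h_rn TYPE('n) TYPE('k) r)"
      by (auto simp: Hilb_def homog_ideal_points_ideal hilb_fun_def h_rn_def)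
  qed
  have "limit_arc xp r"
  proof
    show "finite {t. \<not> (distinct_proj_points r ((\<lambda>j. xp j t) ` {..<r}) \<and>
      points_ideal ((\<lambda>j. xp j t) ` {..<r}) \<in> Hilb (h_rn TYPE('n) TYPE('k) r))}"
      by (rule finite_subset[of _ "bad1 \<union> bad2"]) (use good \<open>finite bad1\<close> \<open>finite bad2\<close> in auto)
  qed (use arc inf in auto)
  then show ?thesis using inj unfolding xp_def by blast
qed

end

section \<open>The sufficient condition\<close>

text \<open>Over a finite field the product of all x - a, plus 1, has no root.\<close>

lemma alg_closed_infinite:
  assumes "alg_closed TYPE('k::field)"
  shows "infinite (UNIV :: 'k set)"
proof
  assume fin: "finite (UNIV :: 'k set)"
  define p :: "'k poly" where "p = (\<Prod>x\<in>UNIV. [:- x, 1:]) + 1"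
  have d: "degree (\<Prod>x\<in>UNIV. [:- x, 1:] :: 'k poly) = card (UNIV :: 'k set)"
    by (rule degree_prod_linear)
  have "0 < card (UNIV :: 'k set)" using fin by (simp add: card_gt_0_iff)
  then have "degree p = card (UNIV :: 'k set)"
    unfolding p_def using d by (subst degree_add_eq_left) simp_all
  then have "0 < degree p" using \<open>0 < card UNIV\<close> by simp
  then obtain x where "poly p x = 0" using assms unfolding alg_closed_def by blast
  moreover have "poly p x = 1" unfolding p_def using poly_prod_linear_eq_0[OF fin, of x "\<lambda>x. x"] by simp
  ultimately show False by simp
qed

lemma alg_closed_splits:
  assumes ac: "alg_closed TYPE('k::field)"
  shows "degree (p :: 'k poly) = m \<Longrightarrow> lead_coeff p = 1 \<Longrightarrow> \<exists>\<xi>. p = (\<Prod>j<m. [:- \<xi> j, 1:])"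
proof (induction m arbitrary: p)
  case 0
  then show ?case using degree_0_id[of p] by (auto simp: one_pCons)
next
  case (Suc m)
  then obtain x where "poly p x = 0" using ac unfolding alg_closed_def by (metis zero_less_Suc)
  then obtain p' where p': "p = [:- x, 1:] * p'" by (auto simp: poly_eq_0_iff_dvd dvd_def)
  have "p' \<noteq> 0" using Suc.prems p' by auto
  then have "degree p' = m" using Suc.prems(1) unfolding p' by (subst (asm) degree_mult_eq) auto
  moreover have "lead_coeff p' = 1" using Suc.prems(2) unfolding p' lead_coeff_mult by simp
  ultimately obtain \<xi> where "p' = (\<Prod>j<m. [:- \<xi> j, 1:])" using Suc.IH by blast
  then have "p = (\<Prod>j<Suc m. [:- (\<xi>(m := x)) j, 1:])" unfolding p' by (simp add: mult.commute)
  then show ?case by blast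
qed

text \<open>The inhomogeneous system becomes homogeneous with an additional unknown scaling the
  right side. That unknown cannot be 0, since by \<open>coeff_eq_lam\<close> only the zero
  polynomial of degree below r pairs to 0 with all powers below r.\<close>

lemma lam_solve:
  fixes g :: "'k::field poly"
  assumes g: "degree g = r" "coeff g r = 1" and r: "1 \<le> r"
  shows "\<exists>P. \<forall>b<r. lam g (monom 1 b * P) = \<psi> b"
proof -
  define Mat where "Mat b k = (if k < r then lam g (monom 1 b * monom 1 k) else - \<psi> b)" for b k
  have "card {..<r} < card {..<Suc r}" by simp
  from hom_system[OF _ _ this, of Mat]
  obtain u where u: "\<exists>k\<in>{..<Suc r}. u k \<noteq> 0" "\<forall>b\<in>{..<r}. (\<Sum>k\<in>{..<Suc r}. Mat b k * u k) = 0"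
    by auto
  define P where "P = (\<Sum>k<r. monom (u k) k)"
  have dP: "degree P < r"
  proof -
    have "degree P \<le> r - 1" unfolding P_def by (rule degree_sum_le) (auto intro: order_trans[OF degree_monom_le])
    then show ?thesis using r by simp
  qed
  have lamP: "lam g (monom 1 b * P) = \<psi> b * u r" if b: "b < r" for b
  proof -
    have "lam g (monom 1 b * P) = (\<Sum>k<r. lam g (monom (u k) k * monom 1 b))"
      unfolding P_def by (simp add: sum_distrib_left lam_sum mult.commute)
    also have "\<dots> = (\<Sum>k<r. Mat b k * u k)"
    proof (intro sum.cong refl)
      fix k assume "k \<in> {..<r}"
      then show "lam g (monom (u k) k * monom 1 b) = Mat b k * u k"
        by (simp add: lam_monom_mult[of g "u k"] Mat_def mult.commute[of "u k"] mult.commute[of "monom 1 k"])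
    qed
    also have "\<dots> = \<psi> b * u r"
      using u(2) b by (simp add: Mat_def)
    finally show ?thesis .
  qed
  have "u r \<noteq> 0"
  proof
    assume ur: "u r = 0"
    have "u k = 0" if k: "k < r" for k
    proof -
      have "coeff P k = 0" unfolding coeff_eq_lam[OF g k dP] using lamP ur k by (intro sum.neutral) simp
      then show ?thesis using k by (simp add: P_def coeff_sum sum.delta)
    qed
    then show False using u(1) ur by (auto simp: less_Suc_eq)
  qed
  then show ?thesis using lamP by (intro exI[of _ "smult (1 / u r) P"]) (simp add: lam_smult)
qed

text \<open>Functions of (t, s) given by a polynomial in s over k[t]. Values along the curves have
  to become such polynomials before divisibility can be used.\<close>

definition biv :: "('k::field \<Rightarrow> 'k \<Rightarrow> 'k) \<Rightarrow> bool" where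
  "biv h \<longleftrightarrow> (\<exists>R :: 'k poly poly. \<forall>t s. h t s = poly (poly R [:s:]) t)"

lemma biv_const: "biv (\<lambda>t s. b)"
  unfolding biv_def by (rule exI[of _ "[:[:b:]:]"]) simp

lemma biv_t: "biv (\<lambda>t s. t)"
  unfolding biv_def by (rule exI[of _ "[:[:0, 1:]:]"]) simp

lemma biv_s: "biv (\<lambda>t s. s)"
  unfolding biv_def by (rule exI[of _ "[:0, 1:]"]) simp

lemma biv_add: "biv f \<Longrightarrow> biv h \<Longrightarrow> biv (\<lambda>t s. f t s + h t s)"
  unfolding biv_def by (metis poly_add)

lemma biv_mult: "biv f \<Longrightarrow> biv h \<Longrightarrow> biv (\<lambda>t s. f t s * h t s)"
  unfolding biv_def by (metis poly_mult)

lemma biv_sum: "(\<And>i. i \<in> A \<Longrightarrow> biv (f i)) \<Longrightarrow> biv (\<lambda>t s. \<Sum>i\<in>A. f i t s)"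
  by (induction A rule: infinite_finite_induct) (auto intro: biv_const biv_add)

lemma biv_power: "biv f \<Longrightarrow> biv (\<lambda>t s. f t s ^ k)"
  by (induction k) (auto intro: biv_const biv_mult)

lemma biv_poly: "biv (\<lambda>t s. poly p s)"
  by (induction p) (simp only: poly_0 poly_pCons, intro biv_const biv_add biv_mult biv_s, assumption?)+

lemma biv_polyfun: "f \<in> polyfun \<Longrightarrow> (\<And>v. biv (\<lambda>t s. M t s v)) \<Longrightarrow> biv (\<lambda>t s. f (M t s))"
  by (induction rule: polyfun.induct) (auto intro: biv_const biv_add biv_mult)

lemma poly_poly_arc: "poly (poly R \<sigma>) t = poly (poly R [:poly \<sigma> t:]) t"
  by (induction R) simp_all

definition at0 :: "'k::field poly poly \<Rightarrow> 'k poly" where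
  "at0 R = map_poly (\<lambda>c. poly c 0) R"

lemma poly_at0: "poly (at0 R) s = poly (poly R [:s:]) 0"
  unfolding at0_def by (induction R) (simp_all add: map_poly_pCons)

text \<open>If every coefficient vanishes at t = 0, each is divisible by t and a common factor t
  comes out.\<close>

lemma at0_eq_0:
  fixes R :: "'k::field poly poly"
  assumes "at0 R = 0"
  shows "\<exists>R'. R = smult [:0, 1:] R'"
proof -
  define R' where "R' = map_poly (\<lambda>c. synthetic_div c 0) R"
  have "R = smult [:0, 1:] R'"
  proof (rule poly_eqI)
    fix i
    have "poly (coeff R i) 0 = coeff (at0 R) i" by (simp add: at0_def coeff_map_poly)
    then have "poly (coeff R i) 0 = 0" using assms by simp
    then show "coeff R i = coeff (smult [:0, 1:] R') i"
      using synthetic_div_correct'[of 0 "coeff R i"] by (simp add: R'_def coeff_map_poly)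
  qed
  then show ?thesis by blast
qed

context coords
begin

lemma biv_eval_cv: "biv (\<lambda>t s. eval H (cv P Q t s))"
proof (rule biv_polyfun[OF polyfun_eval])
  fix i
  have "biv (\<lambda>t s. if l = 0 then 1 else if l = 1 then s else t * poly (P (l - 2)) s + t\<^sup>2 * poly (Q (l - 2)) s)" for l :: nat
    by (cases "l = 0"; cases "l = 1") (simp_all add: biv_const biv_s biv_add biv_mult biv_t biv_poly biv_power)
  then show "biv (\<lambda>t s. cv P Q t s i)"
    unfolding cv_def pt_def by (intro biv_sum biv_mult biv_const) simp
qed

text \<open>On the curve each equation of the line takes the value t (P_i + t Q_i), so the order in
  the ideal of the line becomes the order in t.\<close>

lemma eval_decomposes:
  assumes "decomposes a F p q H"
  shows "eval F (cv P Q t s) = poly p s + t * ((\<Sum>i<n. (poly (P i) s + t * poly (Q i) s) * poly (q i) s)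
    + t * (\<Sum>i<n. \<Sum>j<n. (poly (P i) s + t * poly (Q i) s) * (poly (P j) s + t * poly (Q j) s) * eval (H i j) (cv P Q t s)))"
proof -
  have dp: "degree p \<le> a" and dq: "\<And>i. degree (q i) \<le> a - 1"
    and F: "F = hh a p + (\<Sum>i<n. y (i + 2) * hh (a - 1) (q i)) + (\<Sum>i<n. \<Sum>j<n. y (i + 2) * y (j + 2) * H i j)"
    using assms unfolding decomposes_def by blast+
  have ey: "eval (y (i + 2)) (cv P Q t s) = t * (poly (P i) s + t * poly (Q i) s)" if "i < n" for i
    using eval_cv(4)[OF that] by (simp add: algebra_simps power2_eq_square)
  have eh: "eval (hh b f) (cv P Q t s) = poly f s" if "degree f \<le> b" for b f
    using eval_hz[OF eval_cv(1) that] by (simp only: eval_cv)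
  have 1: "eval (\<Sum>i<n. y (i + 2) * hh (a - 1) (q i)) (cv P Q t s) = t * (\<Sum>i<n. (poly (P i) s + t * poly (Q i) s) * poly (q i) s)"
    unfolding eval_sum sum_distrib_left
    by (intro sum.cong refl) (simp only: eval_mult ey eh[OF dq] lessThan_iff mult.assoc)
  have 2: "eval (\<Sum>i<n. \<Sum>j<n. y (i + 2) * y (j + 2) * H i j) (cv P Q t s) = t * (t * (\<Sum>i<n. \<Sum>j<n. (poly (P i) s + t * poly (Q i) s) * (poly (P j) s + t * poly (Q j) s) * eval (H i j) (cv P Q t s)))"
    unfolding eval_sum sum_distrib_left
    by (intro sum.cong refl) (simp only: eval_mult ey lessThan_iff mult.assoc mult.left_commute)
  show ?thesis
    by (subst F) (simp only: eval_add eh[OF dp] 1 2 distrib_left add.assoc)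
qed

text \<open>Along the curves the family becomes a polynomial in s over k[t] vanishing at the moving
  nodes. It is divisible by the product of their linear factors, which specializes to
  \<open>g\<close> even when roots of \<open>g\<close> coincide. Orders 0 and 1 in t give the two
  conclusions; \<open>p1\<close> comes from the first-order change of the form itself.\<close>

lemma curve_limit:
  fixes F :: "('n, 'k) mpoly poly" and r :: nat
  assumes inf: "infinite (UNIV :: 'k set)"
    and \<eta>: "inj_on \<eta> {..<r}"
    and F: "\<And>i. coeff F i \<in> Sdeg a"
      "\<And>t j. j < r \<Longrightarrow> eval (poly F (pconst t)) (cv P Q t (\<xi> j + t * (\<eta> j - \<xi> j))) = 0"
    and dec: "decomposes a (poly F 0) p q H"
  defines "g \<equiv> \<Prod>j<r. [:- \<xi> j, 1:]"
  shows "g dvd p" "p = 0 \<Longrightarrow> \<exists>p1. degree p1 \<le> a \<and> g dvd (\<Sum>i<n. P i * q i) + p1"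
proof -
  obtain F0 F' where FF: "F = pCons F0 F'" by (cases F)
  have F0: "poly F 0 = F0" by (simp add: FF)
  have F1: "coeff F' 0 \<in> Sdeg a" using F(1)[of 1] by (simp add: FF)
  obtain p1 q1 H1 where dec1: "decomposes a (coeff F' 0) p1 q1 H1" using decomposition[OF F1] by blast
  have dp1: "degree p1 \<le> a" using dec1 by (simp add: decomposes_def)
  define K where "K t s = ((\<Sum>i<n. (poly (P i) s + t * poly (Q i) s) * poly (q i) s)
    + t * (\<Sum>i<n. \<Sum>j<n. (poly (P i) s + t * poly (Q i) s) * (poly (P j) s + t * poly (Q j) s) * eval (H i j) (cv P Q t s)))
    + eval (poly F' (pconst t)) (cv P Q t s)" for t s
  have T: "eval (poly F (pconst t)) (cv P Q t s) = poly p s + t * K t s" for t s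
  proof -
    have "eval (pconst t) x = t" for x :: "'n \<Rightarrow> 'k" by (simp add: pconst_def)
    then show ?thesis
      unfolding FF poly_pCons eval_add eval_mult eval_decomposes[OF dec[unfolded F0]] K_def
      by (simp only: distrib_left add.assoc)
  qed
  have "biv (\<lambda>t s. eval (poly F' (pconst t)) (cv P Q t s))"
    unfolding poly_pconst eval_sum eval_scale
    by (intro biv_sum biv_mult biv_power biv_t biv_eval_cv)
  then have "biv K"
    unfolding K_def
    by (intro biv_add biv_sum biv_mult biv_t biv_poly biv_eval_cv)
  then obtain RK :: "'k poly poly" where RK: "\<And>t s. K t s = poly (poly RK [:s:]) t" unfolding biv_def by blast
  have K0: "K 0 s = poly ((\<Sum>i<n. P i * q i) + p1) s" for s
  proof -
    have "eval (poly F' (pconst 0)) (cv P Q 0 s) = poly p1 s"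
      using eval_decomposes[OF dec1, of P Q 0 s] by (simp add: poly_0_coeff_0)
    then show ?thesis by (simp add: K_def poly_sum)
  qed
  define lift :: "'k poly \<Rightarrow> 'k poly poly" where "lift f = map_poly (\<lambda>c. [:c:]) f" for f
  have lift: "poly (poly (lift f) [:s:]) t = poly f s" for f t s
    unfolding lift_def by (induction f) (simp_all add: map_poly_pCons)
  define R where "R = lift p + smult [:0, 1:] RK"
  have R: "poly (poly R [:s:]) t = poly p s + t * K t s" for t s
    by (simp add: R_def lift RK)
  define X where "X j = [:\<xi> j, \<eta> j - \<xi> j:]" for j
  have "poly R (X j) = 0" if j: "j < r" for j
  proof (rule poly_zeroI[OF inf])
    fix t
    have "poly (X j) t = \<xi> j + t * (\<eta> j - \<xi> j)" by (simp add: X_def)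
    then show "poly (poly R (X j)) t = 0"
      unfolding poly_poly_arc[of R "X j"] R using F(2)[OF j, of t] T by simp
  qed
  \<comment> \<open>Nodes that start together still differ as polynomials in t, because they end at
    distinct values.\<close>
  moreover have "inj_on X {..<r}"
  proof (rule inj_onI)
    fix i j assume ij: "i \<in> {..<r}" "j \<in> {..<r}" "X i = X j"
    then have eq: "\<xi> i = \<xi> j" "\<eta> i - \<xi> i = \<eta> j - \<xi> j" unfolding X_def pCons_eq_iff by blast+
    have "\<eta> i - \<xi> i + \<xi> i = \<eta> j - \<xi> j + \<xi> j"
      by (rule arg_cong2[where f = "(+)", OF eq(2,1)])
    then have "\<eta> i = \<eta> j" by (simp only: diff_add_cancel)
    then show "i = j" using \<eta> ij by (auto dest: inj_onD)
  qed
  ultimately have "(\<Prod>j<r. [:- X j, 1:]) dvd R" by (intro prod_linear_dvd) auto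
  then obtain h where h: "R = (\<Prod>j<r. [:- X j, 1:]) * h" by (auto simp: dvd_def)
  have G0: "poly (poly (\<Prod>j<r. [:- X j, 1:]) [:s:]) 0 = poly g s" for s
    by (simp add: g_def poly_prod X_def)
  have peq: "p = g * at0 h"
  proof -
    have "poly (p - g * at0 h) s = 0" for s
      using R[of s 0] G0[of s] by (simp add: h poly_at0)
    then have "p - g * at0 h = 0" by (rule poly_zeroI[OF inf])
    then show ?thesis by simp
  qed
  then show "g dvd p" by simp
  show "\<exists>p1. degree p1 \<le> a \<and> g dvd (\<Sum>i<n. P i * q i) + p1" if p0: "p = 0"
  proof -
    have "g \<noteq> 0" by (simp add: g_def)
    then have "at0 h = 0" using peq p0 by simp
    \<comment> \<open>When the order-0 part is 0, the cofactor is divisible by t; cancelling t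
      exposes the order-1 part.\<close>
    then obtain h' where h': "h = smult [:0, 1:] h'" using at0_eq_0 by blast
    have "smult [:0, 1:] RK = smult [:0, 1:] ((\<Prod>j<r. [:- X j, 1:]) * h')"
      using h unfolding R_def p0 h' by (simp add: lift_def)
    then have "smult [:0, 1:] (RK - (\<Prod>j<r. [:- X j, 1:]) * h') = 0" by (simp only: smult_diff_right diff_self)
    then have RK': "RK = (\<Prod>j<r. [:- X j, 1:]) * h'" by (simp only: smult_eq_0_iff) simp
    have "poly ((\<Sum>i<n. P i * q i) + p1 - g * at0 h') s = 0" for s
      using K0[of s] RK[of 0 s] G0[of s] by (simp add: RK' poly_at0)
    then have "(\<Sum>i<n. P i * q i) + p1 - g * at0 h' = 0" by (rule poly_zeroI[OF inf])
    then have "(\<Sum>i<n. P i * q i) + p1 = g * at0 h'" by (simp only: right_minus_eq)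
    then have "g dvd (\<Sum>i<n. P i * q i) + p1" by simp
    then show ?thesis using dp1 by blast
  qed
qed

end

section \<open>The limit ideal compared with I\<close>

context good_line
begin

text \<open>In degree r - 2 there are r - 1 binary monomials independent modulo the saturation,
  while \<open>I\<close> has codimension at most r. One vector \<open>W\<close> therefore bridges
  the difference.\<close>

lemma saturation_gap:
  "\<exists>W. \<forall>F\<in>Sdeg (r - 2). F \<in> saturation I \<longrightarrow> (\<exists>b. F - scale b W \<in> I)"
proof (cases "\<forall>F\<in>Sdeg (r - 2). F \<in> saturation I \<longrightarrow> F \<in> I")
  case True
  then show ?thesis by (intro exI[of _ 0]) simp
next
  case False
  let ?a = "r - 2"
  obtain W where W: "W \<in> Sdeg ?a" "W \<in> saturation I" "W \<notin> I" using False by blast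
  have r1: "r - 1 \<le> r" "r - 1 \<le> Suc ?a" "Suc (r - 1) = r" using r4 by auto
  have deg: "degree (\<Sum>k<r - 1. monom (b k) k :: 'k poly) < r" "degree (\<Sum>k<r - 1. monom (b k) k :: 'k poly) \<le> ?a" for b
    using degree_monom_sum[OF r1(2), of b] r4 by auto
  have ind: "indep_mod (comp_deg I ?a) (\<lambda>k. hh ?a (monom 1 k)) (r - 1)"
    using hh_indep_sat[OF r1(1,2)] comp_deg_sat by (rule indep_mod_mono)
  let ?G = "(\<lambda>k. hh ?a (monom 1 k))(r - 1 := W)"
  have "indep_mod (comp_deg I ?a) ?G (Suc (r - 1))"
  proof (rule indep_snoc[OF subsp_comp_deg[OF ideal] ind])
    fix b
    show "W - (\<Sum>j<r - 1. scale (b j) (hh ?a (monom 1 j))) \<notin> comp_deg I ?a"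
    proof
      assume "W - (\<Sum>j<r - 1. scale (b j) (hh ?a (monom 1 j))) \<in> comp_deg I ?a"
      then have d: "W - hh ?a (\<Sum>k<r - 1. monom (b k) k) \<in> I" unfolding hh_monom_sum by (simp add: comp_deg_def)
      have "W - (W - hh ?a (\<Sum>k<r - 1. monom (b k) k)) \<in> saturation I"
        by (intro is_idealD(5)[OF sat_ideal] W(2) I_sub[OF d])
      then have "(\<Sum>k<r - 1. monom (b k) k) = 0" using deg[of b] by (intro goodD) auto
      then show False using d W(3) by simp
    qed
  qed
  then have indG: "indep_mod (comp_deg I ?a) ?G r" unfolding r1(3) .
  have "\<exists>b. F - scale b W \<in> I" if F: "F \<in> Sdeg ?a" "F \<in> saturation I" for F
  proof -
    have "\<exists>b. F - (\<Sum>j<r. scale (b j) (?G j)) \<in> comp_deg I ?a"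
      by (rule indep_mod_span[OF subsp_comp_deg[OF ideal] comp_deg_subset indG])
        (use F W codim[of ?a] in auto)
    then obtain b where b: "F - (\<Sum>j<r. scale (b j) (?G j)) \<in> I" by (auto simp: comp_deg_def)
    have "(\<Sum>j<r. scale (b j) (?G j)) = (\<Sum>j<Suc (r - 1). scale (b j) (?G j))" unfolding r1(3) ..
    also have "\<dots> = hh ?a (\<Sum>k<r - 1. monom (b k) k) + scale (b (r - 1)) W"
      unfolding hh_monom_sum[symmetric] by simp
    finally have eq: "(\<Sum>j<r. scale (b j) (?G j)) = hh ?a (\<Sum>k<r - 1. monom (b k) k) + scale (b (r - 1)) W" .
    have "F - scale (b (r - 1)) W - (F - (\<Sum>j<r. scale (b j) (?G j))) \<in> saturation I"
      by (intro is_idealD(5)[OF sat_ideal] F(2) is_ideal_scale[OF sat_ideal] W(2) I_sub[OF b])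
    then have "hh ?a (\<Sum>k<r - 1. monom (b k) k) \<in> saturation I" unfolding eq by (simp add: algebra_simps)
    then have "(\<Sum>k<r - 1. monom (b k) k) = 0" using deg[of b] by (intro goodD) auto
    then show ?thesis using b unfolding eq by (intro exI[of _ "b (r - 1)"]) simp
  qed
  then show ?thesis by blast
qed

text \<open>The remainder of x^r modulo \<open>I\<close> is subtracted from x^r.\<close>

lemma equation_of_scheme:
  "\<exists>g. degree g = r \<and> coeff g r = 1 \<and> hh r g \<in> I"
proof -
  obtain p where p: "degree p < r" "hh r (monom 1 r) - hh r p \<in> I"
    by (rule hh_rem[of r "hh r (monom 1 r)"]) auto
  have "degree (monom 1 r - p) = r"
  proof -
    have "degree (- p) < degree (monom (1 :: 'k) r)" using p(1) by (simp add: degree_monom_eq)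
    then have "degree (monom 1 r + - p) = degree (monom (1 :: 'k) r)" by (rule degree_add_eq_left)
    then show ?thesis by (simp add: degree_monom_eq)
  qed
  moreover have "coeff (monom 1 r - p) r = 1" using p(1) by (simp add: coeff_eq_0)
  moreover have "hh r (monom 1 r - p) \<in> I" using p(2) by (simp add: hz_diff)
  ultimately show ?thesis by blast
qed

lemma decomposes_sat:
  assumes "decomposes a F p q H"
  shows "F - hh a p \<in> saturation I"
proof -
  have "F - hh a p = (\<Sum>i<n. y (i + 2) * hh (a - 1) (q i)) + (\<Sum>i<n. y (i + 2) * (\<Sum>j<n. y (j + 2) * H i j))"
    using assms by (simp add: decomposes_def sum_distrib_left mult.assoc)
  then show ?thesis using line_sat[of "\<lambda>i. hh (a - 1) (q i)"] line_sat[of "\<lambda>i. \<Sum>j<n. y (j + 2) * H i j"]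
    by (simp only: is_idealD(2)[OF sat_ideal])
qed

lemma sufficient_condition:
  assumes ac: "alg_closed TYPE('k)"
    and sq: "\<And>i j H. i < n \<Longrightarrow> j < n \<Longrightarrow> H \<in> Sdeg (r - 4) \<Longrightarrow> y (i + 2) * y (j + 2) * H \<in> I"
  shows "\<exists>J. homog_ideal J \<and> J \<in> Slip TYPE('n) TYPE('k) r \<and> (\<forall>a. r \<le> a + 2 \<longrightarrow> comp_deg J a = comp_deg I a)"
proof -
  obtain g where g: "degree g = r" "coeff g r = 1" "hh r g \<in> I" using equation_of_scheme by blast
  obtain \<xi> where \<xi>: "g = (\<Prod>j<r. [:- \<xi> j, 1:])" using alg_closed_splits[OF ac g(1)] g by auto
  obtain W where W: "\<And>F. F \<in> Sdeg (r - 2) \<Longrightarrow> F \<in> saturation I \<Longrightarrow> \<exists>b. F - scale b W \<in> I"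
    using saturation_gap by blast
  have yhS: "y (i + 2) * hh (r - 3) f \<in> Sdeg (r - 2)" if "i < n" for i f
    using y_times_Sdeg[of "i + 2" "hh (r - 3) f" "r - 3"] that r4 by (simp add: Suc_diff_Suc numeral_2_eq_2 numeral_3_eq_3)
  have "\<forall>z. \<exists>b. fst z < n \<longrightarrow> y (fst z + 2) * hh (r - 3) (monom 1 (snd z)) - scale b W \<in> I"
    using W[OF yhS] is_idealD(4)[OF sat_ideal y_sat] by blast
  \<comment> \<open>\<open>\<phi>\<close> is the functional cutting out \<open>I\<close> inside its
    saturation, recorded on equations of the line times binary monomials. By hypothesis it ignores
    second-order terms.\<close>
  from choice[OF this] obtain \<phi> where \<phi>: "\<forall>z. fst z < n \<longrightarrow> y (fst z + 2) * hh (r - 3) (monom 1 (snd z)) - scale (\<phi> z) W \<in> I" ..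
  have "\<forall>i. \<exists>P. \<forall>b<r. lam g (monom 1 b * P) = \<phi> (i, b)"
    using lam_solve[OF g(1,2)] r4 by simp
  \<comment> \<open>The pairing by \<open>lam g\<close> is perfect, so the functional is represented
    by displacement polynomials, one for each normal direction.\<close>
  from choice[OF this] obtain P where P: "\<forall>i. \<forall>b<r. lam g (monom 1 b * P i) = \<phi> (i, b)" ..
  obtain \<eta> Q where \<eta>: "inj_on \<eta> {..<r}" and arc: "limit_arc (\<lambda>j t. cv P Q t (\<xi> j + t * (\<eta> j - \<xi> j))) r"
    using arc_exists[OF inf, of r P \<xi>] by blast
  interpret limit_arc "\<lambda>j t. cv P Q t (\<xi> j + t * (\<eta> j - \<xi> j))" r by (rule arc)
  have sub: "Jh a \<subseteq> comp_deg I a" if a: "r \<le> a + 2" for a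
  proof
    fix f assume "f \<in> Jh a"
    then obtain F where F: "fam a F" "f = poly F 0" by (auto simp: Jh_def)
    have fS: "f \<in> Sdeg a" using F by (simp add: fam_def poly_0_coeff_0)
    obtain p q H where dec: "decomposes a f p q H" using decomposition[OF fS] by blast
    have dp: "degree p \<le> a" using dec by (simp add: decomposes_def)
    have F': "\<And>i. coeff F i \<in> Sdeg a"
      "\<And>t j. j < r \<Longrightarrow> eval (poly F (pconst t)) (cv P Q t (\<xi> j + t * (\<eta> j - \<xi> j))) = 0"
      using F(1) by (auto simp: fam_def)
    note lim = curve_limit[OF inf \<eta> F' dec[unfolded F(2)], folded \<xi>]
    have "f \<in> I"
    proof (cases "r \<le> Suc a")
      case True
      \<comment> \<open>From degree r - 1 on divisibility by \<open>g\<close> suffices, because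
        \<open>I\<close> is saturated there.\<close>
      have "hh a p \<in> I"
      proof (cases "p = 0")
        case False
        obtain h where h: "p = g * h" using lim(1) by (auto simp: dvd_def)
        have "h \<noteq> 0" "g \<noteq> 0" using False h by auto
        then have "degree p = r + degree h" using g(1) h by (simp add: degree_mult_eq)
        then have "r + (a - r) = a" "degree h \<le> a - r" using dp by auto
        then have "hh a p = hh r g * hh (a - r) h"
          using hz_mult[of g r h "a - r" "y 0" "y 1"] g(1) h by simp
        then show ?thesis using is_idealD(4)[OF ideal g(3)] by simp
      qed (simp add: is_idealD(1)[OF ideal])
      then have "(f - hh a p) + hh a p \<in> saturation I"
        by (intro is_idealD(2)[OF sat_ideal] decomposes_sat[OF dec] I_sub)
      then show ?thesis using sat_eq[OF True fS] by simp
    next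
      case False
      \<comment> \<open>Only degree r - 2 remains. There \<open>p\<close> has degree below r and is
        divisible by \<open>g\<close>, so it is 0, and the first-order condition becomes
        available.\<close>
      then have ar: "a = r - 2" "a - 1 = r - 3" "a - 2 = r - 4" using a by auto
      have "p = 0"
      proof (rule ccontr)
        assume "p \<noteq> 0"
        then have "r \<le> degree p" using dvd_imp_degree_le[OF lim(1)] g(1) by simp
        then show False using dp ar r4 by simp
      qed
      then obtain p1 where p1: "degree p1 \<le> a" "g dvd (\<Sum>i<n. P i * q i) + p1" using lim(2) by blast
      have "lam g ((\<Sum>i<n. P i * q i) + p1) = 0" using p1(2) by (simp add: lam_def dvd_eq_mod_eq_0)
      moreover have "lam g p1 = 0" using p1(1) ar r4 g(1) by (subst lam_low) (auto simp: coeff_eq_0)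
      ultimately have lam0: "lam g (\<Sum>i<n. P i * q i) = 0" by (simp add: lam_add)
      have dq: "degree (q i) < r - 2" for i
      proof -
        have "degree (q i) \<le> a - 1" using dec by (simp add: decomposes_def)
        then show ?thesis using ar r4 by linarith
      qed
      have lq: "lam g (P i * q i) = (\<Sum>b<r - 2. coeff (q i) b * \<phi> (i, b))" for i
      proof -
        have "lam g (P i * q i) = (\<Sum>b<r - 2. lam g (monom (coeff (q i) b) b * P i))"
          by (subst (1) poly_as_monom_sum[OF dq]) (simp add: sum_distrib_left lam_sum mult.commute)
        also have "\<dots> = (\<Sum>b<r - 2. coeff (q i) b * \<phi> (i, b))"
          by (intro sum.cong refl) (use P in \<open>simp add: lam_monom_mult[of g "coeff _ _"]\<close>)
        finally show ?thesis .
      qed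
      have lin: "y (i + 2) * hh (r - 3) (q i) - scale (lam g (P i * q i)) W \<in> I" if i: "i < n" for i
      proof -
        have "hh (r - 3) (q i) = (\<Sum>b<r - 2. scale (coeff (q i) b) (hh (r - 3) (monom 1 b)))"
          unfolding hh_monom_sum by (subst (1) poly_as_monom_sum[OF dq]) (rule refl)
        then have "y (i + 2) * hh (r - 3) (q i) - scale (lam g (P i * q i)) W
          = (\<Sum>b<r - 2. scale (coeff (q i) b) (y (i + 2) * hh (r - 3) (monom 1 b) - scale (\<phi> (i, b)) W))"
          by (simp add: lq sum_distrib_left scale_mult_right mp.scale_right_diff_distrib sum_subtractf mp.scale_sum_left)
        also have "\<dots> \<in> I"
          by (intro is_idealD(6)[OF ideal] is_ideal_scale[OF ideal]) (use \<phi> i in auto)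
        finally show ?thesis .
      qed
      have "(\<Sum>i<n. y (i + 2) * hh (r - 3) (q i) - scale (lam g (P i * q i)) W) \<in> I"
        by (intro is_idealD(6)[OF ideal] lin) simp
      also have "(\<Sum>i<n. y (i + 2) * hh (r - 3) (q i) - scale (lam g (P i * q i)) W) = (\<Sum>i<n. y (i + 2) * hh (r - 3) (q i))"
        using lam0 by (simp add: sum_subtractf lam_sum flip: mp.scale_sum_left)
      finally have 1: "(\<Sum>i<n. y (i + 2) * hh (r - 3) (q i)) \<in> I" .
      have "H i j \<in> Sdeg (r - 4)" for i j using dec ar by (simp add: decomposes_def)
      then have 2: "(\<Sum>i<n. \<Sum>j<n. y (i + 2) * y (j + 2) * H i j) \<in> I"
        by (intro is_idealD(6)[OF ideal] sq) auto
      have "f = (\<Sum>i<n. y (i + 2) * hh (r - 3) (q i)) + (\<Sum>i<n. \<Sum>j<n. y (i + 2) * y (j + 2) * H i j)"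
        using dec \<open>p = 0\<close> ar unfolding decomposes_def by simp
      then show ?thesis using is_idealD(2)[OF ideal 1 2] by (simp only:)
    qed
    then show "f \<in> comp_deg I a" using fS by (simp add: comp_deg_def)
  qed
  have "comp_deg J a = comp_deg I a" if a: "r \<le> a + 2" for a
    unfolding comp_deg_J
  \<comment> \<open>Both pieces have codimension r, so the inclusion is an equality.\<close>
  proof (rule subsp_eqI[OF subsp_Jh sub[OF a] subsp_comp_deg[OF ideal] comp_deg_subset])
    show "vdim (comp_deg I a) \<le> vdim (Jh a)"
      using vdim_Jh[of a] vdim_comp_deg[OF a] vdim_ge_r[OF a] by simp
  qed
  then show ?thesis using homog_ideal_J J_Slip by blast
qed

end

section \<open>Choice of coordinates and conclusion\<close>

lemma indep_prepend:
  assumes "mp.subspace V" "indep_mod {0} v d" "\<And>j. j < d \<Longrightarrow> v j \<in> V" "indep_mod V G m"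
  shows "indep_mod {0} (\<lambda>j. if j < m then G j else v (j - m)) (m + d)"
  unfolding indep_mod_def
proof (intro allI impI)
  fix c u assume c: "(\<Sum>u<m + d. scale (c u) (if u < m then G u else v (u - m))) \<in> {0}" and u: "u < m + d"
  have *: "(\<Sum>j<m. scale (c j) (G j)) + (\<Sum>j<d. scale (c (m + j)) (v j)) = 0"
    using c by (simp add: sum_lessThan_add)
  have "(\<Sum>j<m. scale (c j) (G j)) = 0 - (\<Sum>j<d. scale (c (m + j)) (v j))"
    unfolding diff_0 by (rule eq_neg_iff_add_eq_0[THEN iffD2, OF *])
  also have "\<dots> \<in> V" by (intro subspD[OF assms(1)] assms(3)) auto
  finally have 1: "c j = 0" if "j < m" for j using indep_modD[OF assms(4)] that by blast
  then have "(\<Sum>j<d. scale (c (m + j)) (v j)) \<in> {0}" using * by simp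
  from indep_modD[OF assms(2) this] have 2: "c (m + j) = 0" if "j < d" for j using that by blast
  show "c u = 0" using 1[of u] 2[of "u - m"] u by (cases "u < m") auto
qed

lemma card_le_vdim_Sdeg_1: "CARD('n::finite) \<le> vdim (Sdeg 1 :: ('n, 'k::field) mpoly set)"
proof -
  have "inj (\<lambda>i :: 'n. Poly_Mapping.single i (1 :: nat))"
    by (rule injI) (metis lookup_single_eq lookup_single_not_eq zero_neq_one)
  then have "CARD('n) = card (range (\<lambda>i :: 'n. Poly_Mapping.single i (1 :: nat)))" by (simp add: card_image)
  also have "\<dots> \<le> card {m :: 'n \<Rightarrow>\<^sub>0 nat. mdeg m = 1}" by (rule card_mono) auto
  finally show ?thesis by (simp add: vdim_Sdeg)
qed

text \<open>The linear forms in the saturation have codimension 2, which is the hypothesis on the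
  Hilbert function; they are the equations of the line. An arbitrary pair \<open>G\<close>
  completing them is used to find a good z0, and the pair is then replaced by
  \<open>Z\<close>.\<close>

lemma good_line_exists:
  fixes I :: "('n::finite, 'k::field) mpoly set" and r :: nat
  assumes inf: "infinite (UNIV :: 'k set)" and "CARD('n) \<ge> 3" and r: "r \<ge> 4"
    and I: "I \<in> Hilb (h_rn TYPE('n) TYPE('k) r)"
    and h1: "hilb_fun (saturation I) 1 = 2"
  shows "\<exists>y n c. good_line y n c I r"
proof -
  interpret hilb_ideal I r
    by unfold_locales (use I hilb_fun_codim[OF I] inf in \<open>auto simp: Hilb_def\<close>)
  let ?V = "comp_deg (saturation I) 1" let ?s = "vdim (Sdeg 1 :: ('n, 'k) mpoly set)"
  define n where "n = vdim ?V"
  have V: "mp.subspace ?V" "?V \<subseteq> Sdeg 1" by (rule subsp_comp_deg[OF sat_ideal], rule comp_deg_subset)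
  have s: "?s = n + 2" "2 + n = ?s" using h1 unfolding hilb_fun_def n_def by auto
  have n1: "1 \<le> n" using card_le_vdim_Sdeg_1[where 'n = 'n and 'k = 'k] assms(2) s by simp
  obtain v where v: "indep_mod {0} v n" "\<And>j. j < n \<Longrightarrow> v j \<in> ?V"
    unfolding n_def by (rule basis_family[OF V]) (rule that[unfolded n_def], assumption+)
  have "\<exists>G. indep_mod ?V G (?s - vdim ?V) \<and> (\<forall>u<?s - vdim ?V. G u \<in> Sdeg 1)"
    by (rule indep_mod_exists[OF V]) blast
  then obtain G where G: "indep_mod ?V G 2" "\<forall>u<2. G u \<in> Sdeg 1"
    using h1 unfolding hilb_fun_def by auto
  have coords: "\<exists>c. line_coords (\<lambda>j. if j < 2 then Z j else v (j - 2)) n c I r"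
    if Z: "indep_mod ?V Z 2" "\<And>u. u < 2 \<Longrightarrow> Z u \<in> Sdeg 1" for Z
  proof -
    let ?y = "\<lambda>j. if j < 2 then Z j else v (j - 2)"
    have ind: "indep_mod {0} ?y (n + 2)"
      using indep_prepend[OF V(1) v(1,2) Z(1)] by (simp only: add.commute[of 2 n])
    have yS: "?y j \<in> Sdeg 1" if "j < n + 2" for j
    proof (cases "j < 2")
      case False
      then have "v (j - 2) \<in> ?V" using that by (intro v(2)) simp
      then show ?thesis using False V(2) by auto
    qed (use Z(2) in simp)
    obtain c where c: "coords ?y n c" using coords_exists[OF ind yS s(1)] by blast
    have "line_coords ?y n c I r"
    proof (intro line_coords.intro c hilb_ideal_axioms line_coords_axioms.intro)
      show "?y (i + 2) \<in> saturation I" if "i < n" for i using v(2)[OF that] by (simp add: comp_deg_def)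
    qed (use r in simp)
    then show ?thesis by (rule exI[of _ c])
  qed
  obtain c1 where c1: "line_coords (\<lambda>j. if j < 2 then G j else v (j - 2)) n c1 I r"
    using coords[OF G(1)] G(2) by blast
  obtain b where b: "good (scale b (G 0) + G 1) (G 0)"
    using line_coords.good_exists[OF c1] by auto
  define Z where "Z j = (if j = 0 then scale b (G 0) + G 1 else G 0)" for j :: nat
  have sum2: "(\<Sum>u<2. f u) = f 0 + f 1" for f :: "nat \<Rightarrow> ('n, 'k) mpoly" by (simp add: numeral_2_eq_2)
  have Z1: "indep_mod ?V Z 2"
    unfolding indep_mod_def
  proof (intro allI impI)
    fix c u assume c: "(\<Sum>u<2. scale (c u) (Z u)) \<in> ?V" and u: "u < (2 :: nat)"
    have "(\<Sum>u<2. scale (c u) (Z u)) = (\<Sum>u<2. scale (if u = 0 then c 0 * b + c 1 else c 0) (G u))"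
      unfolding sum2 by (simp add: Z_def mp.scale_right_distrib mp.scale_left_distrib add_ac)
    then have "(\<Sum>u<2. scale (if u = 0 then c 0 * b + c 1 else c 0) (G u)) \<in> ?V" using c by simp
    from indep_modD[OF G(1) this, of 0] indep_modD[OF G(1) this, of 1]
    have "c 0 = 0" "c 1 = 0" by auto
    then show "c u = 0" using u by (cases "u = 0") (auto simp: less_2_cases_iff)
  qed
  have Z2: "Z u \<in> Sdeg 1" if "u < 2" for u
    using G(2) by (auto simp: Z_def intro!: Sdeg_add Sdeg_scale)
  obtain c2 where c2: "line_coords (\<lambda>j. if j < 2 then Z j else v (j - 2)) n c2 I r"
    using coords[OF Z1 Z2] by blast
  have "good_line (\<lambda>j. if j < 2 then Z j else v (j - 2)) n c2 I r"
    by (intro good_line.intro c2 good_line_axioms.intro) (use b n1 r in \<open>simp_all add: Z_def\<close>)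
  then show ?thesis by blast
qed

lemma ideal_prod_subset_iff:
  assumes "is_ideal I"
  shows "ideal_prod A B \<subseteq> I \<longleftrightarrow> (\<forall>a\<in>A. \<forall>b\<in>B. a * b \<in> I)"
proof
  assume "ideal_prod A B \<subseteq> I"
  then show "\<forall>a\<in>A. \<forall>b\<in>B. a * b \<in> I"
    unfolding ideal_prod_def using ideal_gen_superset[of _ "{a * b |a b. a \<in> A \<and> b \<in> B}"] by blast
next
  assume "\<forall>a\<in>A. \<forall>b\<in>B. a * b \<in> I"
  then show "ideal_prod A B \<subseteq> I"
    unfolding ideal_prod_def by (intro ideal_gen_least[OF assms]) blast
qed

text \<open>The multipliers of all of \<open>C\<close> into \<open>I\<close> form an ideal, so the
  criterion for two factors applies twice.\<close>

lemma ideal_prod3_subset_iff: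
  assumes "is_ideal I"
  shows "ideal_prod (ideal_prod A B) C \<subseteq> I \<longleftrightarrow> (\<forall>a\<in>A. \<forall>b\<in>B. \<forall>c\<in>C. a * b * c \<in> I)"
proof -
  have "is_ideal {f. \<forall>c\<in>C. f * c \<in> I}"
    unfolding is_ideal_def
    using is_idealD[OF assms] by (auto simp: distrib_right mult.assoc)
  from ideal_prod_subset_iff[OF this, of A B] show ?thesis
    unfolding ideal_prod_subset_iff[OF assms] by blast
qed

context good_line
begin

text \<open>Everything splits into homogeneous components. Products of degree at least r - 1 are
  covered by \<open>sat_eq\<close>, and the saturation contains no nonzero constant.\<close>

lemma slip_necessary:
  assumes slip: "I \<in> Slip TYPE('n) TYPE('k) r"
  shows "ideal_prod (ideal_prod (saturation I) (saturation I)) (irrel_pow (r - 4)) \<subseteq> I"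
  unfolding ideal_prod3_subset_iff[OF ideal]
proof (intro ballI)
  fix f1 f2 h :: "('n, 'k) mpoly" assume f: "f1 \<in> saturation I" "f2 \<in> saturation I" and h: "h \<in> irrel_pow (r - 4)"
  have sat_hc: "hcomp a f \<in> saturation I" if "f \<in> saturation I" for a f
    using homog_ideal_saturation[OF homog] that by (simp add: homog_ideal_iff)
  have deg0: "hcomp 0 f = 0" if "f \<in> saturation I" for f
  proof -
    define p where "p = [:lk (hcomp 0 f) 0:]"
    have eq: "hcomp 0 f = hh 0 p"
      using Sdeg_0_const[OF hcomp_Sdeg[of 0 f]] by (simp add: hz_const p_def)
    have "p = 0"
      by (rule goodD[of _ 0]) (use r4 sat_hc[OF that, of 0] in \<open>simp_all only: eq, simp_all add: p_def\<close>)
    then show ?thesis by (simp add: eq)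
  qed
  have comp: "hcomp a f1 * hcomp b f2 * hcomp d h \<in> I" for a b d
  proof (cases "a = 0 \<or> b = 0 \<or> hcomp d h = 0")
    case True
    then show ?thesis using deg0 f is_idealD(1)[OF ideal] by auto
  next
    case False
    have S: "hcomp a f1 * hcomp b f2 * hcomp d h \<in> Sdeg (a + b + d)" by (intro Sdeg_mult) auto
    have d: "r - 4 \<le> d"
    proof (rule ccontr)
      assume "\<not> ?thesis"
      then have "hcomp d h = 0"
        using h by (intro poly_mapping_eqI) (auto simp: irrel_pow_iff in_keys_iff)
      then show False using False by blast
    qed
    show ?thesis
    proof (cases "r \<le> Suc (a + b + d)")
      case True
      show ?thesis
        by (rule sat_eq[OF True S]) (intro is_idealD(4)[OF sat_ideal] sat_hc f)
    next
      case ar: False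
      \<comment> \<open>Both factors from the saturation have degree at least 1 and the third at
        least r - 4, so total degree at most r - 2 leaves this single case.\<close>
      then have abd: "a = 1" "b = 1" "d = r - 4" "b + d = r - 3" using d False r4 by auto
      have "hcomp b f2 * hcomp d h \<in> Sdeg (b + d)" by (intro Sdeg_mult) auto
      then have v: "hcomp b f2 * hcomp d h \<in> Sdeg (r - 3)" using abd(4) by simp
      have "hcomp a f1 * (hcomp b f2 * hcomp d h) \<in> I"
        by (rule necessary_condition[OF slip _ _ v])
          (use sat_hc[OF f(1)] is_idealD(4)[OF sat_ideal sat_hc[OF f(2)]] abd in auto)
      then show ?thesis by (simp only: mult.assoc)
    qed
  qed
  show "f1 * f2 * h \<in> I"
    unfolding mem_homog_ideal_iff[OF homog, of "f1 * f2 * h"] hcomp_mult sum_distrib_right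
    by (intro allI is_idealD(6)[OF ideal] comp)
qed

lemma slip_sufficient:
  assumes ac: "alg_closed TYPE('k)"
    and sub: "ideal_prod (ideal_prod (saturation I) (saturation I)) (irrel_pow (r - 4)) \<subseteq> I"
  shows "\<exists>J. homog_ideal J \<and> J \<in> Slip TYPE('n) TYPE('k) r \<and> trunc_ge I (r - 2) = trunc_ge J (r - 2)"
proof -
  have "y (i + 2) * y (j + 2) * H \<in> I" if "i < n" "j < n" "H \<in> Sdeg (r - 4)" for i j H
    using sub[unfolded ideal_prod3_subset_iff[OF ideal]] y_sat that Sdeg_irrel_pow[OF that(3) order_refl] by blast
  from sufficient_condition[OF ac this] obtain J where J: "homog_ideal J" "J \<in> Slip TYPE('n) TYPE('k) r"
    "\<forall>a. r \<le> a + 2 \<longrightarrow> comp_deg J a = comp_deg I a" by blast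
  have "f \<in> trunc_ge I (r - 2) \<longleftrightarrow> f \<in> trunc_ge J (r - 2)" for f
  proof -
    have "hcomp a f \<in> I \<longleftrightarrow> hcomp a f \<in> J" if f: "\<forall>m\<in>Poly_Mapping.keys f. r - 2 \<le> mdeg m" for a
    proof (cases "r \<le> a + 2")
      case True
      then have "hcomp a f \<in> comp_deg J a \<longleftrightarrow> hcomp a f \<in> comp_deg I a" using J(3) by simp
      then show ?thesis by (simp add: comp_deg_def)
    next
      case False
      have "hcomp a f = 0"
      proof (rule poly_mapping_eqI)
        fix m
        have "m \<notin> Poly_Mapping.keys f" if "mdeg m = a" using f False that by force
        then show "lk (hcomp a f) m = lk 0 m" by (simp add: in_keys_iff)
      qed
      then show ?thesis using is_idealD(1) ideal J(1) by (metis homog_ideal_def)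
    qed
    then show ?thesis
      unfolding trunc_ge_def mem_Collect_eq mem_homog_ideal_iff[OF homog, of f] mem_homog_ideal_iff[OF J(1), of f] by blast
  qed
  then show ?thesis using J(1,2) by blast
qed

end

theorem theorem2p9:
  fixes I :: "('n::finite, 'k::field) mpoly set" and r :: nat
  assumes "alg_closed TYPE('k)"
    and "CARD('n) \<ge> 3"
    and "r \<ge> 4"
    and "I \<in> Hilb (h_rn TYPE('n) TYPE('k) r)"
    and "hilb_fun (saturation I) 1 = 2"
  shows "(I \<in> Slip TYPE('n) TYPE('k) r \<longrightarrow>
            ideal_prod (ideal_prod (saturation I) (saturation I)) (irrel_pow (r - 4)) \<subseteq> I)
       \<and> (ideal_prod (ideal_prod (saturation I) (saturation I)) (irrel_pow (r - 4)) \<subseteq> I \<longrightarrow>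
            (\<exists>J. homog_ideal J \<and> J \<in> Slip TYPE('n) TYPE('k) r \<and> trunc_ge I (r - 2) = trunc_ge J (r - 2)))"
proof -
  obtain y n c where gl: "good_line y n c I r"
    using good_line_exists[OF alg_closed_infinite[OF assms(1)] assms(2-5)] by blast
  show ?thesis
    using good_line.slip_necessary[OF gl] good_line.slip_sufficient[OF gl assms(1)] by blast
qed

end
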